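(* The following groups $\mathrm{Osc}^r(B,l)$, where $r$ runs through all positive integers, form a complete system of pairwise non-isomorphic representatives of the isomorphism classes of discrete split oscillator groups with $T=\operatorname{tr}B\le7$: - $T=3$: $B=\begin{pmatrix}2&1\\1&1\end{pmatrix}$, $l=(0,0)$ (all $r$). - $T=4$: $B=\begin{pmatrix}3&2\\1&1\end{pmatrix}$; $l\in\{(0,0),(1,0)\}$ if $r\equiv0\ (2)$; $l=(0,0)$ if $r\equiv1\ (2)$. - $T=5$: $B=\begin{pmatrix}4&3\\1&1\end{pmatrix}$; $l\in\{(0,0),(1,0)\}$ if $r\equiv0\ (3)$; $l=(0,0)$ if $r\not\equiv0\ (3)$. - $T=6$: $B=\begin{pmatrix}5&4\\1&1\end{pmatrix}$; $l\in\{(0,0),(1,0),(2,0)\}$ if $r\equiv0\ (4)$; $l\in\{(0,0),(1,0)\}$ if $r\equiv2\ (4)$; $l=(0,0)$ if $r\equiv1\ (2)$. And $B=\begin{pmatrix}5&2\\2&1\end{pmatrix}$; $l\in\{(0,0),(1,0),(1,1)\}$ if $r\equiv0\ (2)$; $l=(0,0)$ if $r\equiv1\ (2)$. - $T=7$: $B=\begin{pmatrix}6&5\\1&1\end{pmatrix}$; $l\in\{(0,0),(1,0),(2,0)\}$ if $r\equiv0\ (5)$; $l=(0,0)$ if $r\not\equiv0\ (5)$. And $B=\begin{pmatrix}5&3\\3&2\end{pmatrix}$; $l\in\{(0,0),(0,1)\}$ if $r\equiv0\ (5)$; $l=(0,0)$ if $r\not\equiv0\ (5)$.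
   Context: $H^r(\mathbb Z)=\langle\alpha,\beta,\gamma\mid\alpha\beta\alpha^{-1}\beta^{-1}=\gamma^r,\alpha\gamma=\gamma\alpha,\beta\gamma=\gamma\beta\rangle$ for $r\ge1$. For $B=\begin{pmatrix}a&b\\c&d\end{pmatrix}\in\mathrm{SL}(2,\mathbb Z)$ with $\operatorname{tr}B>2$ and $l=(l_1,l_2)\in(\mathbb Z/r\mathbb Z)^2$ (represented by an integer vector; up to isomorphism the choice does not matter), $\mathrm{Osc}^r(B,l):=H^r(\mathbb Z)\rtimes_\phi\mathbb Z\cdot\delta$ with $\phi(\delta)(\alpha)=\alpha^a\beta^c\gamma^{-l_2}$, $\phi(\delta)(\beta)=\alpha^b\beta^d\gamma^{l_1}$, $\phi(\delta)(\gamma)=\gamma$. A discrete split oscillator group is a semidirect product $H_d\rtimes_\phi\mathbb Z\delta$, with $H_d\cong H^r(\mathbb Z)$ for some $r\ge1$, for which the automorphism induced by $\phi(\delta)$ on $H_d/Z(H_d)\cong\mathbb Z^2$ lies in $\{B\in\mathrm{SL}(2,\mathbb Z)\mid\operatorname{tr}B>2\}$. Each such group is isomorphic to some $\mathrm{Osc}^r(B,l)$, and $r$ and $T=\operatorname{tr}B$ depend only on its isomorphism class. *)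

theory Defs
  imports
    "HOL-Algebra.Elementary_Groups"
    "HOL-Algebra.Bij"
    "HOL-Analysis.Determinants"
begin

section \<open>Groups given by generators and relations\<close>

text \<open>A letter \<open>(x, True)\<close> stands for the generator \<open>x\<close>, and \<open>(x, False)\<close> for its inverse.\<close>

type_synonym 'a gword = "('a \<times> bool) list"

text \<open>The relations are a set \<open>R\<close> of equations between words.\<close>

inductive word_eq :: "('a gword \<times> 'a gword) set \<Rightarrow> 'a gword \<Rightarrow> 'a gword \<Rightarrow> bool"
  for R where
  relation: "(u, v) \<in> R \<Longrightarrow> word_eq R u v"
| cancel: "word_eq R [(x, b), (x, \<not> b)] []"
| cong: "word_eq R u u' \<Longrightarrow> word_eq R v v' \<Longrightarrow> word_eq R (u @ v) (u' @ v')"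
| refl: "word_eq R u u"
| sym: "word_eq R u v \<Longrightarrow> word_eq R v u"
| trans: "word_eq R u v \<Longrightarrow> word_eq R v w \<Longrightarrow> word_eq R u w"

definition word_class :: "('a gword \<times> 'a gword) set \<Rightarrow> 'a gword \<Rightarrow> 'a gword set"
  where "word_class R u = {v. word_eq R u v}"

definition presented_group :: "('a gword \<times> 'a gword) set \<Rightarrow> 'a gword set monoid"
  where "presented_group R =
    \<lparr>carrier = range (word_class R),
     monoid.mult = (\<lambda>U V. \<Union>u\<in>U. \<Union>v\<in>V. word_class R (u @ v)),
     one = word_class R []\<rparr>"

section \<open>The discrete Heisenberg groups\<close>

datatype heis_gen = Alpha | Beta | Gamma

definition heis_relations :: "nat \<Rightarrow> (heis_gen gword \<times> heis_gen gword) set"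
  where "heis_relations r =
    {([(Alpha, True), (Beta, True), (Alpha, False), (Beta, False)], replicate r (Gamma, True)),
     ([(Alpha, True), (Gamma, True)], [(Gamma, True), (Alpha, True)]),
     ([(Beta, True), (Gamma, True)], [(Gamma, True), (Beta, True)])}"

definition heis :: "nat \<Rightarrow> heis_gen gword set monoid"
  where "heis r = presented_group (heis_relations r)"

definition heis_elem :: "nat \<Rightarrow> heis_gen \<Rightarrow> heis_gen gword set"
  where "heis_elem r x = word_class (heis_relations r) [(x, True)]"

section \<open>Semidirect products with the integers\<close>

definition semidirect ::
    "('h, 'm) monoid_scheme \<Rightarrow> ('k, 'n) monoid_scheme \<Rightarrow> ('k \<Rightarrow> 'h \<Rightarrow> 'h) \<Rightarrow> ('h \<times> 'k) monoid"
  where "semidirect H K \<phi> =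
    \<lparr>carrier = carrier H \<times> carrier K,
     monoid.mult = (\<lambda>(h, k) (h', k'). (h \<otimes>\<^bsub>H\<^esub> \<phi> k h', k \<otimes>\<^bsub>K\<^esub> k')),
     one = (\<one>\<^bsub>H\<^esub>, \<one>\<^bsub>K\<^esub>)\<rparr>"

text \<open>The automorphism \<open>\<phi>(\<delta>)\<close> of \<open>H\<^sup>r(\<int>)\<close>. The class of \<open>l = (l\<^sub>1, l\<^sub>2)\<close> in \<open>(\<int>/r\<int>)\<^sup>2\<close> is given by
  an integer representative.\<close>

definition osc_aut ::
    "nat \<Rightarrow> int^2^2 \<Rightarrow> int \<times> int \<Rightarrow> heis_gen gword set \<Rightarrow> heis_gen gword set"
  where "osc_aut r B l = (let H = heis r; \<alpha> = heis_elem r Alpha; \<beta> = heis_elem r Beta;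
                              \<gamma> = heis_elem r Gamma in
    THE f. f \<in> auto H
      \<and> f \<alpha> = \<alpha> [^]\<^bsub>H\<^esub> (B $ 1 $ 1) \<otimes>\<^bsub>H\<^esub> \<beta> [^]\<^bsub>H\<^esub> (B $ 2 $ 1) \<otimes>\<^bsub>H\<^esub> \<gamma> [^]\<^bsub>H\<^esub> (- snd l)
      \<and> f \<beta> = \<alpha> [^]\<^bsub>H\<^esub> (B $ 1 $ 2) \<otimes>\<^bsub>H\<^esub> \<beta> [^]\<^bsub>H\<^esub> (B $ 2 $ 2) \<otimes>\<^bsub>H\<^esub> \<gamma> [^]\<^bsub>H\<^esub> (fst l)
      \<and> f \<gamma> = \<gamma>)"

definition Osc :: "nat \<Rightarrow> int^2^2 \<Rightarrow> int \<times> int \<Rightarrow> (heis_gen gword set \<times> int) monoid"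
  where "Osc r B l =
    semidirect (heis r) integer_group (\<lambda>k. osc_aut r B l [^]\<^bsub>AutoGroup (heis r)\<^esub> k)"

section \<open>Discrete split oscillator groups\<close>

definition center :: "('h, 'm) monoid_scheme \<Rightarrow> 'h set"
  where "center H = {z \<in> carrier H. \<forall>h\<in>carrier H. z \<otimes>\<^bsub>H\<^esub> h = h \<otimes>\<^bsub>H\<^esub> z}"

definition int_plane :: "(int^2) monoid"
  where "int_plane = \<lparr>carrier = UNIV, monoid.mult = (+), one = 0\<rparr>"

text \<open>An automorphism \<open>f\<close> of \<open>H\<close> acts on \<open>H/Z(H)\<close> by taking images of cosets. Identifications of
  \<open>H/Z(H)\<close> with \<open>\<int>\<^sup>2\<close> differ by elements of \<open>GL(2,\<int>)\<close>, so \<open>B\<close> is determined only up to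
  \<open>GL(2,\<int>)\<close>-conjugacy.\<close>

definition induces_matrix :: "('h, 'm) monoid_scheme \<Rightarrow> ('h \<Rightarrow> 'h) \<Rightarrow> int^2^2 \<Rightarrow> bool"
  where "induces_matrix H f B \<longleftrightarrow>
    (\<exists>\<theta> \<in> iso (H Mod center H) int_plane.
       \<forall>C \<in> carrier (H Mod center H). \<theta> (f ` C) = B *v \<theta> C)"

text \<open>The predicate says that \<open>G\<close> is a discrete split oscillator group whose invariant \<open>tr B\<close> is \<open>T\<close>.
  Taking \<open>H\<close> over the same type as \<open>G\<close> loses no generality, because \<open>H\<close> embeds into \<open>G\<close>.\<close>

definition discrete_split_oscillator_group :: "('g, 'm) monoid_scheme \<Rightarrow> int \<Rightarrow> bool"
  where "discrete_split_oscillator_group G T \<longleftrightarrow> group G \<and>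
    (\<exists>(H :: 'g monoid) r \<phi> B.
       group H \<and> 1 \<le> r \<and> H \<cong> heis r \<and>
       \<phi> \<in> hom integer_group (AutoGroup H) \<and>
       induces_matrix H (\<phi> 1) B \<and> det B = 1 \<and> trace B > 2 \<and> trace B = T \<and>
       G \<cong> semidirect H integer_group \<phi>)"

section \<open>The list of representatives\<close>

definition mat2 :: "int \<Rightarrow> int \<Rightarrow> int \<Rightarrow> int \<Rightarrow> int^2^2"
  where "mat2 a b c d = vector [vector [a, b], vector [c, d]]"

text \<open>The pairs \<open>(B, l)\<close> listed for given \<open>T\<close> and \<open>r\<close>.\<close>

definition osc_list :: "int \<Rightarrow> nat \<Rightarrow> ((int^2^2) \<times> (int \<times> int)) set"
  where "osc_list T r =
   (if T = 3 then {mat2 2 1 1 1} \<times> {(0, 0)}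
    else if T = 4 then
      {mat2 3 2 1 1} \<times> (if r mod 2 = 0 then {(0, 0), (1, 0)} else {(0, 0)})
    else if T = 5 then
      {mat2 4 3 1 1} \<times> (if r mod 3 = 0 then {(0, 0), (1, 0)} else {(0, 0)})
    else if T = 6 then
      {mat2 5 4 1 1} \<times> (if r mod 4 = 0 then {(0, 0), (1, 0), (2, 0)}
                         else if r mod 4 = 2 then {(0, 0), (1, 0)} else {(0, 0)})
      \<union> {mat2 5 2 2 1} \<times> (if r mod 2 = 0 then {(0, 0), (1, 0), (1, 1)} else {(0, 0)})
    else if T = 7 then
      {mat2 6 5 1 1} \<times> (if r mod 5 = 0 then {(0, 0), (1, 0), (2, 0)} else {(0, 0)})
      \<union> {mat2 5 3 3 2} \<times> (if r mod 5 = 0 then {(0, 0), (0, 1)} else {(0, 0)})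
    else {})"

end

theory Submission
  imports Defs
begin

text \<open>
  The element \<open>\<alpha>\<^sup>x \<beta>\<^sup>y \<gamma>\<^sup>z\<close> of the Heisenberg group is recorded as \<open>(v, w)\<close> with \<open>v = (x, y)\<close> and
  \<open>w = 2 z + r x y\<close>. In these coordinates the product is \<open>(v + v', w + w' + r \<omega>(v, v'))\<close> with the
  symplectic form \<open>\<omega>\<close>, every automorphism is affine,
  \<open>(v, w) \<mapsto> (S v, det S w + \<mu> v)\<close>, with a parity condition on the row \<open>\<mu>\<close> (\<open>auto_heis_int\<close>), and
  inner automorphisms are those with \<open>S = 1\<close> and \<open>\<mu>\<close> divisible by \<open>2 r\<close>. The oscillator group is then
  determined by a hyperbolic matrix \<open>B\<close> and a row \<open>\<lambda>\<close> that encodes \<open>l\<close> (\<open>Osc_iso_osc_int\<close>), and every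
  discrete split oscillator group arises from such a pair (\<open>discrete_split_model\<close>).

  Since \<open>det (B - 1) = 2 - T\<close> is not zero, every homomorphism from an oscillator group to \<open>\<int>\<close> is a multiple
  of the projection, so an isomorphism maps Heisenberg group to Heisenberg group and \<open>\<delta>\<close> to
  \<open>\<delta>\<^sup>\<plusminus>\<^sup>1\<close> up to an element of the Heisenberg group (\<open>mapping_torus_isoD\<close>). Comparing coordinates, two
  groups are isomorphic only if \<open>r\<close> agrees and some \<open>S\<close> in \<open>GL(2, \<int>)\<close> conjugates \<open>B\<close> to \<open>B'\<close> or its
  inverse and carries \<open>\<lambda>\<close> to \<open>\<plusminus> \<lambda>'\<close> modulo \<open>2 r\<close> and the rows \<open>\<mu> (B - 1)\<close>
  (\<open>torus_iso_necessary\<close>); conversely, conjugation to \<open>B'\<close> itself suffices for an isomorphism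
  (\<open>torus_iso_sufficient\<close>).

  What remains is arithmetic. Choosing a conjugate whose lower left entry is as small as possible shows
  that for \<open>2 < T \<le> 7\<close> the matrix is conjugate to \<open>(T - 1, T - 2; 1, 1)\<close> or to one of the two additional
  matrices for \<open>T = 6, 7\<close> (\<open>sl2_conj_small_trace\<close>). For the first kind, put \<open>n = T - 2\<close>; the row
  \<open>\<lambda>\<close> matters only through \<open>l\<^sub>1\<close> modulo \<open>g = gcd n r\<close>, and the matrices commuting with or inverting
  \<open>B\<close> act on it by \<open>\<plusminus>1\<close>. So the classes are the \<open>i\<close> with \<open>0 \<le> 2 i \<le> g\<close>, which is exactly the
  list (\<open>osc_list_companion\<close>). For \<open>T = 6\<close> and \<open>(5, 2; 2, 1)\<close> with \<open>r\<close> even, \<open>l\<close> matters modulo 2 and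
  the square root \<open>(2, 1; 1, 0)\<close> of \<open>B\<close> interchanges its two entries. For \<open>T = 7\<close> and \<open>(5, 3; 3, 2)\<close> with \<open>5\<close>
  dividing \<open>r\<close>, \<open>l\<close> matters through \<open>l\<^sub>1 - 3 l\<^sub>2\<close> modulo 5, and the fourth root \<open>(1, 1; 1, 0)\<close> of \<open>B\<close>
  permutes the nonzero classes transitively.
\<close>

section \<open>Semidirect products with the integers\<close>

lemma auto_homD: "f \<in> auto H \<Longrightarrow> f \<in> hom H H"
  by (simp add: auto_def)

lemma auto_bij: "f \<in> auto H \<Longrightarrow> bij_betw f (carrier H) (carrier H)"
  by (simp add: auto_def Bij_def)

lemma auto_closed: "f \<in> auto H \<Longrightarrow> h \<in> carrier H \<Longrightarrow> f h \<in> carrier H"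
  using auto_bij bij_betwE by blast

lemma carrier_AutoGroup: "carrier (AutoGroup H) = auto H"
  by (simp add: AutoGroup_def)

lemma AutoGroup_mult:
  assumes "f \<in> auto H" "g \<in> auto H" "h \<in> carrier H"
  shows "(f \<otimes>\<^bsub>AutoGroup H\<^esub> g) h = f (g h)"
  using assms by (simp add: AutoGroup_def BijGroup_def auto_def compose_def)

lemma AutoGroup_one: "h \<in> carrier H \<Longrightarrow> \<one>\<^bsub>AutoGroup H\<^esub> h = h"
  by (simp add: AutoGroup_def BijGroup_def)

lemma semidirect_simps [simp]:
  "carrier (semidirect H K \<phi>) = carrier H \<times> carrier K"
  "(h, k) \<otimes>\<^bsub>semidirect H K \<phi>\<^esub> (h', k') = (h \<otimes>\<^bsub>H\<^esub> \<phi> k h', k \<otimes>\<^bsub>K\<^esub> k')"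
  "\<one>\<^bsub>semidirect H K \<phi>\<^esub> = (\<one>\<^bsub>H\<^esub>, \<one>\<^bsub>K\<^esub>)"
  by (simp_all add: semidirect_def)

lemma group_semidirect:
  assumes H: "group H" and K: "group K" and \<phi>: "\<phi> \<in> hom K (AutoGroup H)"
  shows "group (semidirect H K \<phi>)"
proof -
  interpret H: group H by (rule H)
  interpret K: group K by (rule K)
  have aut: "\<phi> k \<in> auto H" if "k \<in> carrier K" for k
    using \<phi> that by (auto simp: hom_def carrier_AutoGroup)
  have cl: "\<phi> k h \<in> carrier H" if "k \<in> carrier K" "h \<in> carrier H" for k h
    using auto_closed[OF aut] that by simp
  have mul: "\<phi> k (h \<otimes>\<^bsub>H\<^esub> h') = \<phi> k h \<otimes>\<^bsub>H\<^esub> \<phi> k h'"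
    if "k \<in> carrier K" "h \<in> carrier H" "h' \<in> carrier H" for k h h'
    using auto_homD[OF aut] that by (simp add: hom_def)
  have act: "\<phi> (k \<otimes>\<^bsub>K\<^esub> k') h = \<phi> k (\<phi> k' h)"
    if "k \<in> carrier K" "k' \<in> carrier K" "h \<in> carrier H" for k k' h
    using \<phi> that aut by (simp add: hom_def AutoGroup_mult)
  have one: "\<phi> \<one>\<^bsub>K\<^esub> h = h" if "h \<in> carrier H" for h
    using hom_one[OF \<phi> K H.AutoGroup] that by (simp add: AutoGroup_one)
  show ?thesis
  proof (rule groupI)
    fix x assume "x \<in> carrier (semidirect H K \<phi>)"
    then obtain h k where x: "x = (h, k)" "h \<in> carrier H" "k \<in> carrier K" by auto
    let ?y = "(\<phi> (inv\<^bsub>K\<^esub> k) (inv\<^bsub>H\<^esub> h), inv\<^bsub>K\<^esub> k)"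
    have "?y \<otimes>\<^bsub>semidirect H K \<phi>\<^esub> x = \<one>\<^bsub>semidirect H K \<phi>\<^esub>"
      using x mul[of "inv\<^bsub>K\<^esub> k" "inv\<^bsub>H\<^esub> h" h] hom_one[OF auto_homD[OF aut] H H] by simp
    then show "\<exists>y\<in>carrier (semidirect H K \<phi>).
        y \<otimes>\<^bsub>semidirect H K \<phi>\<^esub> x = \<one>\<^bsub>semidirect H K \<phi>\<^esub>"
      using x cl by (intro bexI[of _ ?y]) auto
  qed (auto simp: cl mul act one H.m_assoc K.m_assoc)
qed

text \<open>A semidirect product with \<open>\<int>\<close> depends only on the automorphism by which the generator acts; it is the
algebraic counterpart of the mapping torus of a homeomorphism.\<close>

definition mapping_torus :: "('h, 'm) monoid_scheme \<Rightarrow> ('h \<Rightarrow> 'h) \<Rightarrow> ('h \<times> int) monoid"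
  where "mapping_torus H f = semidirect H integer_group (\<lambda>k. f [^]\<^bsub>AutoGroup H\<^esub> k)"

lemma power_action_hom:
  assumes "group H" "f \<in> auto H"
  shows "(\<lambda>k. f [^]\<^bsub>AutoGroup H\<^esub> (k :: int)) \<in> hom integer_group (AutoGroup H)"
  using group.hom_integer_group_pow[OF group.AutoGroup[OF assms(1)]] assms(2)
  by (simp add: carrier_AutoGroup)

lemma group_mapping_torus:
  assumes "group H" "f \<in> auto H"
  shows "group (mapping_torus H f)"
  unfolding mapping_torus_def
  by (intro group_semidirect power_action_hom assms group_integer_group)

lemma semidirect_integer_eq_mapping_torus:
  assumes "group H" "\<phi> \<in> hom integer_group (AutoGroup H)"
  shows "semidirect H integer_group \<phi> = mapping_torus H (\<phi> 1)"
proof -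
  have pow: "\<phi> k = \<phi> 1 [^]\<^bsub>AutoGroup H\<^esub> k" for k :: int
    using hom_int_pow[OF assms(2), of 1 k] group.AutoGroup[OF assms(1)] by simp
  have "(\<lambda>k. \<phi> 1 [^]\<^bsub>AutoGroup H\<^esub> (k :: int)) = \<phi>" by (rule ext) (rule pow[symmetric])
  then show ?thesis
    unfolding mapping_torus_def by simp
qed

lemma mapping_torus_carrier: "carrier (mapping_torus H f) = carrier H \<times> UNIV"
  by (simp add: mapping_torus_def)

lemma mapping_torus_one: "\<one>\<^bsub>mapping_torus H f\<^esub> = (\<one>\<^bsub>H\<^esub>, 0)"
  by (simp add: mapping_torus_def)

lemma mapping_torus_snd_mult: "snd (x \<otimes>\<^bsub>mapping_torus H f\<^esub> y) = snd x + snd y"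
  by (cases x; cases y) (simp add: mapping_torus_def)

lemma mapping_torus_mult_0:
  "h' \<in> carrier H \<Longrightarrow> (h, 0) \<otimes>\<^bsub>mapping_torus H f\<^esub> (h', k) = (h \<otimes>\<^bsub>H\<^esub> h', k)"
  by (simp add: mapping_torus_def AutoGroup_one)

lemma mapping_torus_mult_1:
  assumes "group H" "f \<in> auto H"
  shows "(h, 1) \<otimes>\<^bsub>mapping_torus H f\<^esub> (h', k) = (h \<otimes>\<^bsub>H\<^esub> f h', 1 + k)"
  using group.int_pow_1[OF group.AutoGroup[OF assms(1)]] assms(2)
  by (simp add: mapping_torus_def carrier_AutoGroup)

lemma mapping_torus_snd_hom: "snd \<in> hom (mapping_torus H f) integer_group"
  by (auto simp: hom_def mapping_torus_carrier mapping_torus_snd_mult)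

text \<open>Under an isomorphism of fibres, the new automorphism may differ from the old one by conjugation with
\<open>c\<close>: the element \<open>(c, 1)\<close> of the target acts on the fibre just as the stable letter of the source does,
so \<open>(h, k) \<mapsto> \<iota>(h) (c, 1)\<^sup>k\<close> is a homomorphism, and it is bijective because it respects the projections
to \<open>\<int>\<close>.\<close>

lemma mapping_torus_iso:
  assumes H: "group H" and H': "group H'" and f: "f \<in> auto H" and f': "f' \<in> auto H'"
    and \<iota>: "\<iota> \<in> iso H H'" and c: "c \<in> carrier H'"
    and rel: "\<And>h. h \<in> carrier H \<Longrightarrow> \<iota> (f h) \<otimes>\<^bsub>H'\<^esub> c = c \<otimes>\<^bsub>H'\<^esub> f' (\<iota> h)"
  shows "mapping_torus H f \<cong> mapping_torus H' f'"
proof -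
  let ?G = "mapping_torus H f" and ?G' = "mapping_torus H' f'"
  interpret H: group H by (rule H)
  interpret H': group H' by (rule H')
  interpret G': group ?G' by (rule group_mapping_torus[OF H' f'])
  interpret A: group "AutoGroup H" by (rule H.AutoGroup)
  have fA: "f \<in> carrier (AutoGroup H)" using f by (simp add: carrier_AutoGroup)
  have \<iota>cl: "\<iota> h \<in> carrier H'" if "h \<in> carrier H" for h
    using \<iota> that by (auto simp: iso_def hom_def)
  have \<iota>hom: "\<iota> (h \<otimes>\<^bsub>H\<^esub> h') = \<iota> h \<otimes>\<^bsub>H'\<^esub> \<iota> h'" if "h \<in> carrier H" "h' \<in> carrier H" for h h'
    using \<iota> that by (auto simp: iso_def hom_def)
  define p where "p k = f [^]\<^bsub>AutoGroup H\<^esub> k" for k :: int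
  have paut: "p k \<in> auto H" for k
    using A.int_pow_closed[OF fA, of k] by (simp add: p_def carrier_AutoGroup)
  have pcl: "p k h \<in> carrier H" if "h \<in> carrier H" for k h
    using auto_closed[OF paut] that by simp
  have padd: "p (j + k) h = p j (p k h)" if "h \<in> carrier H" for j k h
    using A.int_pow_mult[OF fA, of j k] paut that unfolding p_def by (metis AutoGroup_mult)
  have p1: "p 1 = f" using fA by (simp add: p_def)
  have p0: "p 0 h = h" if "h \<in> carrier H" for h
    using that by (simp add: p_def AutoGroup_one)
  define t where "t = (c, 1::int)"
  have t: "t \<in> carrier ?G'" using c by (simp add: t_def mapping_torus_carrier)
  have j: "(\<iota> h, 0) \<in> carrier ?G'" if "h \<in> carrier H" for h
    using \<iota>cl that by (simp add: mapping_torus_carrier)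
  define T where "T k = t [^]\<^bsub>?G'\<^esub> k" for k :: int
  have T: "T k \<in> carrier ?G'" for k using t by (simp add: T_def)
  have Tadd: "T (i + k) = T i \<otimes>\<^bsub>?G'\<^esub> T k" for i k
    using t by (simp add: T_def G'.int_pow_mult)
  have step: "T 1 \<otimes>\<^bsub>?G'\<^esub> (\<iota> h, 0) = (\<iota> (f h), 0) \<otimes>\<^bsub>?G'\<^esub> T 1" if "h \<in> carrier H" for h
    using t c that rel \<iota>cl
    by (simp add: T_def) (simp add: t_def mapping_torus_mult_0 mapping_torus_mult_1[OF H' f'])
  \<comment> \<open>The same relation read from right to left handles negative exponents.\<close>
  have step': "T (-1) \<otimes>\<^bsub>?G'\<^esub> (\<iota> h, 0) = (\<iota> (p (-1) h), 0) \<otimes>\<^bsub>?G'\<^esub> T (-1)"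
    if h: "h \<in> carrier H" for h
  proof -
    have e: "f (p (-1) h) = h" using padd[OF h, of 1 "-1"] p0[OF h] p1 by simp
    have q: "p (-1) h \<in> carrier H" using pcl h by blast
    have inv: "T (-1) \<otimes>\<^bsub>?G'\<^esub> T 1 = \<one>\<^bsub>?G'\<^esub>" "T 1 \<otimes>\<^bsub>?G'\<^esub> T (-1) = \<one>\<^bsub>?G'\<^esub>"
      using Tadd[of "-1" 1] Tadd[of 1 "-1"] by (simp_all add: T_def)
    have "T (-1) \<otimes>\<^bsub>?G'\<^esub> (\<iota> h, 0) = T (-1) \<otimes>\<^bsub>?G'\<^esub> ((\<iota> h, 0) \<otimes>\<^bsub>?G'\<^esub> T 1) \<otimes>\<^bsub>?G'\<^esub> T (-1)"
      by (metis inv(2) T j[OF h] G'.m_assoc G'.m_closed G'.r_one)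
    also have "\<dots> = T (-1) \<otimes>\<^bsub>?G'\<^esub> (T 1 \<otimes>\<^bsub>?G'\<^esub> (\<iota> (p (-1) h), 0)) \<otimes>\<^bsub>?G'\<^esub> T (-1)"
      using step[OF q] e by simp
    also have "\<dots> = (\<iota> (p (-1) h), 0) \<otimes>\<^bsub>?G'\<^esub> T (-1)"
      by (metis inv(1) T j[OF q] G'.m_assoc G'.l_one)
    finally show ?thesis .
  qed
  have comm: "T k \<otimes>\<^bsub>?G'\<^esub> (\<iota> h, 0) = (\<iota> (p k h), 0) \<otimes>\<^bsub>?G'\<^esub> T k" if "h \<in> carrier H" for k h
    using that
  proof (induction k arbitrary: h rule: int_induct[of _ 0])
    case base
    then show ?case using \<iota>cl p0 j by (simp add: T_def)
  next
    case (step1 i)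
    have "T (i + 1) \<otimes>\<^bsub>?G'\<^esub> (\<iota> h, 0) = T i \<otimes>\<^bsub>?G'\<^esub> (T 1 \<otimes>\<^bsub>?G'\<^esub> (\<iota> h, 0))"
      using T j[OF step1.prems] by (simp add: Tadd G'.m_assoc)
    also have "\<dots> = (T i \<otimes>\<^bsub>?G'\<^esub> (\<iota> (f h), 0)) \<otimes>\<^bsub>?G'\<^esub> T 1"
      using step[OF step1.prems] T j[OF auto_closed[OF f step1.prems]] by (simp add: G'.m_assoc)
    also have "\<dots> = (\<iota> (p i (f h)), 0) \<otimes>\<^bsub>?G'\<^esub> T (i + 1)"
      using step1.IH[OF auto_closed[OF f step1.prems]] T j[OF pcl[OF auto_closed[OF f step1.prems]]]
      by (simp add: Tadd G'.m_assoc)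
    finally show ?case using padd[OF step1.prems, of i 1] p1 by simp
  next
    case (step2 i)
    note q = pcl[OF step2.prems, of "-1"]
    have "T (i - 1) \<otimes>\<^bsub>?G'\<^esub> (\<iota> h, 0) = T i \<otimes>\<^bsub>?G'\<^esub> (T (-1) \<otimes>\<^bsub>?G'\<^esub> (\<iota> h, 0))"
      using T j[OF step2.prems] Tadd[of i "-1"] by (simp add: G'.m_assoc)
    also have "\<dots> = (T i \<otimes>\<^bsub>?G'\<^esub> (\<iota> (p (-1) h), 0)) \<otimes>\<^bsub>?G'\<^esub> T (-1)"
      using step'[OF step2.prems] T j[OF q] by (simp add: G'.m_assoc)
    also have "\<dots> = (\<iota> (p i (p (-1) h)), 0) \<otimes>\<^bsub>?G'\<^esub> T (i - 1)"
      using step2.IH[OF q] T j[OF pcl[OF q]] Tadd[of i "-1"] by (simp add: G'.m_assoc)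
    finally show ?case using padd[OF step2.prems, of i "-1"] by simp
  qed
  have sndT: "snd (T k) = k" for k
    using hom_int_pow[OF mapping_torus_snd_hom t G'.is_group, of k]
    by (simp add: T_def t_def)
  define F where "F = (\<lambda>(h, k). (\<iota> h, 0) \<otimes>\<^bsub>?G'\<^esub> T k)"
  have Fhom: "F \<in> hom ?G ?G'"
  proof (rule homI)
    fix x assume "x \<in> carrier ?G"
    then show "F x \<in> carrier ?G'"
      using G'.m_closed[OF j T] by (auto simp: F_def mapping_torus_carrier[of H f])
  next
    fix x y assume "x \<in> carrier ?G" "y \<in> carrier ?G"
    then obtain h k h' k' where xy: "x = (h, k)" "y = (h', k')" and h: "h \<in> carrier H" "h' \<in> carrier H"
      by (auto simp: mapping_torus_carrier)
    have "F (x \<otimes>\<^bsub>?G\<^esub> y) = (\<iota> h, 0) \<otimes>\<^bsub>?G'\<^esub> (\<iota> (p k h'), 0) \<otimes>\<^bsub>?G'\<^esub> (T k \<otimes>\<^bsub>?G'\<^esub> T k')"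
      using h pcl[OF h(2)] \<iota>cl
      by (simp add: F_def xy mapping_torus_def[of H f] mapping_torus_mult_0 \<iota>hom Tadd flip: p_def)
    also have "\<dots> = (\<iota> h, 0) \<otimes>\<^bsub>?G'\<^esub> (T k \<otimes>\<^bsub>?G'\<^esub> (\<iota> h', 0)) \<otimes>\<^bsub>?G'\<^esub> T k'"
      using comm[OF h(2)] j[OF h(1)] j[OF h(2)] j[OF pcl[OF h(2), of k]] T
      by (simp add: G'.m_assoc)
    also have "\<dots> = F x \<otimes>\<^bsub>?G'\<^esub> F y"
      using j[OF h(1)] j[OF h(2)] T by (simp add: F_def xy G'.m_assoc)
    finally show "F (x \<otimes>\<^bsub>?G\<^esub> y) = F x \<otimes>\<^bsub>?G'\<^esub> F y" .
  qed
  interpret F: group_hom ?G ?G' F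
    using Fhom group_mapping_torus[OF H f] by (simp add: group_hom_def group_hom_axioms_def G'.is_group)
  have inj: "inj_on F (carrier ?G)"
  proof (subst F.inj_on_one_iff, intro allI impI)
    fix x assume x: "x \<in> carrier ?G" and e: "F x = \<one>\<^bsub>?G'\<^esub>"
    obtain h k where hk: "x = (h, k)" "h \<in> carrier H" using x by (auto simp: mapping_torus_carrier)
    have "k = 0" using arg_cong[OF e, of snd] by (simp add: hk F_def mapping_torus_snd_mult mapping_torus_one sndT)
    then have "\<iota> h = \<one>\<^bsub>H'\<^esub>" using e \<iota>cl[OF hk(2)] by (simp add: hk F_def T_def mapping_torus_one mapping_torus_mult_0)
    moreover have "\<iota> \<one>\<^bsub>H\<^esub> = \<one>\<^bsub>H'\<^esub>" using \<iota> by (simp add: hom_one[OF _ H H'] iso_def)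
    ultimately have "h = \<one>\<^bsub>H\<^esub>" using \<iota> hk(2) by (auto simp: iso_def bij_betw_def inj_on_def)
    with \<open>k = 0\<close> show "x = \<one>\<^bsub>?G\<^esub>" by (simp add: hk mapping_torus_one)
  qed
  have "carrier ?G' \<subseteq> F ` carrier ?G"
  proof
    fix y assume y: "y \<in> carrier ?G'"
    define k where "k = snd y"
    have z: "y \<otimes>\<^bsub>?G'\<^esub> T (-k) \<in> carrier ?G'" using y T G'.m_closed by blast
    moreover have "snd (y \<otimes>\<^bsub>?G'\<^esub> T (-k)) = 0" by (simp add: mapping_torus_snd_mult sndT k_def)
    ultimately obtain g where g: "g \<in> carrier H'" "y \<otimes>\<^bsub>?G'\<^esub> T (-k) = (g, 0)"
      by (metis mapping_torus_carrier mem_Sigma_iff prod.collapse)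
    then obtain h where h: "h \<in> carrier H" "\<iota> h = g" using \<iota> by (metis imageE iso_iff)
    have "F (h, k) = y \<otimes>\<^bsub>?G'\<^esub> T (-k) \<otimes>\<^bsub>?G'\<^esub> T k" using h g by (simp add: F_def)
    also have "\<dots> = y"
      using y T Tadd[of "-k" k] by (simp add: G'.m_assoc T_def)
    finally show "y \<in> F ` carrier ?G" using h by (intro image_eqI[of _ _ "(h, k)"]) (auto simp: mapping_torus_carrier)
  qed
  then have "F \<in> iso ?G ?G'"
    using Fhom inj by (auto simp: iso_iff dest: hom_carrier)
  then show ?thesis by (rule is_isoI)
qed

section \<open>Groups given by generators and relations\<close>

lemma word_class_eq_iff: "word_class R u = word_class R v \<longleftrightarrow> word_eq R u v"
proof
  assume "word_class R u = word_class R v"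
  moreover have "v \<in> word_class R v" by (simp add: word_class_def word_eq.refl)
  ultimately show "word_eq R u v" by (metis mem_Collect_eq word_class_def)
next
  assume "word_eq R u v"
  then show "word_class R u = word_class R v"
    unfolding word_class_def by (blast intro: word_eq.sym word_eq.trans)
qed

lemma word_class_mult:
  "word_class R u \<otimes>\<^bsub>presented_group R\<^esub> word_class R v = word_class R (u @ v)"
proof -
  have eq: "word_class R (u' @ v') = word_class R (u @ v)"
    if "u' \<in> word_class R u" "v' \<in> word_class R v" for u' v'
  proof -
    have "word_eq R u u'" "word_eq R v v'" using that by (simp_all add: word_class_def)
    then have "word_eq R (u @ v) (u' @ v')" by (rule word_eq.cong)
    then show ?thesis by (simp add: word_class_eq_iff word_eq.sym)
  qed
  have "u \<in> word_class R u" "v \<in> word_class R v"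
    by (simp_all add: word_class_def word_eq.refl)
  have "(\<Union>u'\<in>word_class R u. \<Union>v'\<in>word_class R v. word_class R (u' @ v'))
      = (\<Union>u'\<in>word_class R u. \<Union>v'\<in>word_class R v. word_class R (u @ v))"
    by (rule SUP_cong[OF HOL.refl SUP_cong[OF HOL.refl eq]])
  also have "\<dots> = word_class R (u @ v)"
    using \<open>u \<in> _\<close> \<open>v \<in> _\<close> by blast
  finally show ?thesis by (simp add: presented_group_def)
qed

lemma presented_group_carrier: "carrier (presented_group R) = range (word_class R)"
  and presented_group_one: "\<one>\<^bsub>presented_group R\<^esub> = word_class R []"
  by (simp_all add: presented_group_def)

lemma word_inverse: "word_eq R (rev (map (\<lambda>(x, b). (x, \<not> b)) u) @ u) []"
proof (induction u)
  case (Cons p u)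
  obtain x b where p: "p = (x, b)" by (cases p)
  let ?v = "rev (map (\<lambda>(x, b). (x, \<not> b)) u)"
  have "word_eq R ((?v @ [(x, \<not> b), (x, \<not> \<not> b)]) @ u) ((?v @ []) @ u)"
    by (rule word_eq.cong[OF word_eq.cong[OF word_eq.refl word_eq.cancel] word_eq.refl])
  moreover have "word_eq R ((?v @ []) @ u) []"
    unfolding append_Nil2 by (rule Cons.IH)
  ultimately have "word_eq R ((?v @ [(x, \<not> b), (x, \<not> \<not> b)]) @ u) []"
    by (rule word_eq.trans)
  then show ?case by (simp add: p)
qed (simp add: word_eq.refl)

lemma group_presented_group: "group (presented_group R)"
proof (rule groupI)
  fix x assume "x \<in> carrier (presented_group R)"
  then obtain u where "x = word_class R u" by (auto simp: presented_group_carrier)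
  then show "\<exists>y\<in>carrier (presented_group R). y \<otimes>\<^bsub>presented_group R\<^esub> x = \<one>\<^bsub>presented_group R\<^esub>"
    using word_inverse[of R u]
    by (auto simp: presented_group_carrier presented_group_one word_class_mult word_class_eq_iff)
qed (auto simp: presented_group_carrier presented_group_one word_class_mult simp del: append_assoc
      simp flip: append_assoc)

definition letter_value :: "('b, 'm) monoid_scheme \<Rightarrow> ('a \<Rightarrow> 'b) \<Rightarrow> 'a \<times> bool \<Rightarrow> 'b" where
  "letter_value K \<rho> p = (if snd p then \<rho> (fst p) else inv\<^bsub>K\<^esub> \<rho> (fst p))"

definition word_value :: "('b, 'm) monoid_scheme \<Rightarrow> ('a \<Rightarrow> 'b) \<Rightarrow> 'a gword \<Rightarrow> 'b" where
  "word_value K \<rho> u = foldr (\<lambda>p g. letter_value K \<rho> p \<otimes>\<^bsub>K\<^esub> g) u \<one>\<^bsub>K\<^esub>"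

context group
begin

lemma word_value_Nil [simp]: "word_value G \<rho> [] = \<one>"
  and word_value_Cons [simp]: "word_value G \<rho> (p # u) = letter_value G \<rho> p \<otimes> word_value G \<rho> u"
  by (simp_all add: word_value_def)

lemma letter_value_closed: "(\<And>x. \<rho> x \<in> carrier G) \<Longrightarrow> letter_value G \<rho> p \<in> carrier G"
  by (simp add: letter_value_def)

lemma word_value_closed: "(\<And>x. \<rho> x \<in> carrier G) \<Longrightarrow> word_value G \<rho> u \<in> carrier G"
  by (induction u) (simp_all add: letter_value_closed)

lemma word_value_append:
  "(\<And>x. \<rho> x \<in> carrier G) \<Longrightarrow> word_value G \<rho> (u @ v) = word_value G \<rho> u \<otimes> word_value G \<rho> v"
  by (induction u) (simp_all add: letter_value_closed word_value_closed m_assoc)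

lemma word_value_respects:
  assumes \<rho>: "\<And>x. \<rho> x \<in> carrier G"
    and rels: "\<And>u v. (u, v) \<in> R \<Longrightarrow> word_value G \<rho> u = word_value G \<rho> v"
    and "word_eq R u v"
  shows "word_value G \<rho> u = word_value G \<rho> v"
  using assms(3)
proof (induction rule: word_eq.induct)
  case (cancel x b)
  then show ?case using \<rho>[of x] by (cases b) (simp_all add: letter_value_def)
qed (simp_all add: rels word_value_append \<rho>)

text \<open>The universal property of a group presentation.\<close>

lemma presented_group_hom:
  assumes \<rho>: "\<And>x. \<rho> x \<in> carrier G"
    and rels: "\<And>u v. (u, v) \<in> R \<Longrightarrow> word_value G \<rho> u = word_value G \<rho> v"
  obtains f where "f \<in> hom (presented_group R) G" "\<And>u. f (word_class R u) = word_value G \<rho> u"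
proof
  define f where "f U = word_value G \<rho> (SOME u. word_class R u = U)" for U
  show f: "f (word_class R u) = word_value G \<rho> u" for u
  proof -
    have "word_class R (SOME v. word_class R v = word_class R u) = word_class R u"
      by (rule someI) simp
    then show ?thesis
      unfolding f_def by (intro word_value_respects[OF \<rho> rels]) (auto simp: word_class_eq_iff)
  qed
  show "f \<in> hom (presented_group R) G"
    by (rule homI) (auto simp: presented_group_carrier word_class_mult f \<rho> word_value_append
        word_value_closed)
qed

lemma presented_group_hom_unique:
  assumes f: "f \<in> hom (presented_group R) G" and g: "g \<in> hom (presented_group R) G"
    and gens: "\<And>x. f (word_class R [(x, True)]) = g (word_class R [(x, True)])"
    and U: "U \<in> carrier (presented_group R)"
  shows "f U = g U"
proof -
  let ?P = "presented_group R"
  interpret P: group ?P by (rule group_presented_group)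
  interpret f: group_hom ?P G f using f by unfold_locales
  interpret g: group_hom ?P G g using g by unfold_locales
  have in_P: "word_class R u \<in> carrier ?P" for u by (simp add: presented_group_carrier)
  have "word_class R [(x, False)] = inv\<^bsub>?P\<^esub> word_class R [(x, True)]" for x
    using word_eq.cancel[of R x False]
    by (intro P.inv_equality[symmetric])
      (auto simp: in_P word_class_mult presented_group_one word_class_eq_iff)
  then have gens': "f (word_class R [(x, b)]) = g (word_class R [(x, b)])" for x b
    using gens by (cases b) (simp_all add: in_P)
  have "f (word_class R u) = g (word_class R u)" for u
  proof (induction u)
    case Nil
    then show ?case using f.hom_one g.hom_one by (simp add: presented_group_one)
  next
    case (Cons p u)
    have "word_class R (p # u) = word_class R [p] \<otimes>\<^bsub>?P\<^esub> word_class R u"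
      by (simp add: word_class_mult)
    then show ?case using Cons gens'[of "fst p" "snd p"] by (simp add: in_P)
  qed
  then show ?thesis using U by (auto simp: presented_group_carrier)
qed

lemma int_pow_commute:
  assumes "a \<in> carrier G" "b \<in> carrier G" "a \<otimes> b = b \<otimes> a"
  shows "a [^] (m :: int) \<otimes> b [^] (n :: int) = b [^] n \<otimes> a [^] m"
proof -
  have *: "x [^] n \<otimes> y = y \<otimes> x [^] n"
    if x: "x \<in> carrier G" and y: "y \<in> carrier G" and xy: "x \<otimes> y = y \<otimes> x" for x y and n :: int
  proof -
    let ?c = "\<lambda>g. inv y \<otimes> g \<otimes> y"
    have c: "?c \<in> hom G G"
      using y by (intro homI) (simp_all add: m_assoc inv_solve_left' flip: m_assoc[of y "inv y"])
    have "?c x = x" using x y xy by (simp add: m_assoc inv_solve_left')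
    then have "?c (x [^] n) = x [^] n" using hom_int_pow[OF c x is_group, of n] by simp
    then show ?thesis using x y by (simp add: m_assoc inv_solve_left')
  qed
  show ?thesis
    using *[of a "b [^] n" m] *[of b a n] assms by auto
qed

text \<open>A commutator that commutes with both entries is bilinear. Conjugating \<open>b\<^sup>y\<close> by \<open>a\<close> gives the case
\<open>x = 1\<close>, and conjugating \<open>a\<^sup>x\<close> by the inverse of \<open>b\<^sup>y\<close> gives the rest.\<close>

lemma commutator_int_pow:
  assumes a: "a \<in> carrier G" and b: "b \<in> carrier G" and c: "c \<in> carrier G"
    and ab: "a \<otimes> b = c \<otimes> (b \<otimes> a)" and ac: "a \<otimes> c = c \<otimes> a" and bc: "b \<otimes> c = c \<otimes> b"
  shows "a [^] (x :: int) \<otimes> b [^] (y :: int) = c [^] (x * y) \<otimes> (b [^] y \<otimes> a [^] x)"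
proof -
  have conj: "(\<lambda>g. h \<otimes> g \<otimes> inv h) \<in> hom G G" if "h \<in> carrier G" for h
    using that by (intro homI) (simp_all add: m_assoc inv_solve_left' flip: m_assoc[of "inv h" h])
  have "a \<otimes> b \<otimes> inv a = c \<otimes> b"
    using a b c ab by (simp add: m_assoc)
  then have "a \<otimes> b [^] y \<otimes> inv a = (c \<otimes> b) [^] y"
    using hom_int_pow[OF conj[OF a] b is_group, of y] by simp
  also have "\<dots> = c [^] y \<otimes> b [^] y"
    using b c bc by (simp add: int_pow_mult_distrib)
  finally have 1: "a \<otimes> b [^] y = c [^] y \<otimes> b [^] y \<otimes> a"
    using a b c by (simp add: inv_solve_right')
  then have "inv (b [^] y) \<otimes> a \<otimes> inv (inv (b [^] y)) = c [^] y \<otimes> a"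
    using a b c int_pow_commute[OF b c bc, of y y]
    by (simp add: m_assoc inv_solve_left') (simp flip: m_assoc)
  then have "inv (b [^] y) \<otimes> a [^] x \<otimes> inv (inv (b [^] y)) = (c [^] y \<otimes> a) [^] x"
    using hom_int_pow[OF conj[of "inv (b [^] y)"] a is_group, of x] b by simp
  also have "\<dots> = c [^] (x * y) \<otimes> a [^] x"
    using a c int_pow_commute[OF a c ac, of 1 y]
    by (simp add: int_pow_mult_distrib int_pow_pow mult.commute)
  finally have "a [^] x \<otimes> b [^] y = b [^] y \<otimes> (c [^] (x * y) \<otimes> a [^] x)"
    using a b c by (simp add: m_assoc inv_solve_left')
  then show ?thesis
    using a b c int_pow_commute[OF b c bc, of y "x * y"] by (simp flip: m_assoc)
qed

end

section \<open>An integer model of the discrete Heisenberg groups\<close>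

text \<open>The triple \<open>(x, y, w)\<close> stands for \<open>\<alpha>\<^sup>x \<beta>\<^sup>y \<gamma>\<^sup>z\<close> with \<open>w = 2 z + r x y\<close>, whence the parity condition.
Doubling the central coordinate makes the product and all automorphisms symmetric in \<open>x\<close> and \<open>y\<close>
without introducing halves.\<close>

definition heis_int :: "nat \<Rightarrow> (int \<times> int \<times> int) monoid" where
  "heis_int r =
    \<lparr>carrier = {(x, y, w). even (w - int r * x * y)},
     monoid.mult = (\<lambda>(x, y, w) (x', y', w'). (x + x', y + y', w + w' + int r * (x * y' - x' * y))),
     one = (0, 0, 0)\<rparr>"

lemma heis_int_simps [simp]:
  "(x, y, w) \<in> carrier (heis_int r) \<longleftrightarrow> even (w - int r * x * y)"
  "(x, y, w) \<otimes>\<^bsub>heis_int r\<^esub> (x', y', w') = (x + x', y + y', w + w' + int r * (x * y' - x' * y))"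
  "\<one>\<^bsub>heis_int r\<^esub> = (0, 0, 0)"
  by (simp_all add: heis_int_def)

lemma group_heis_int: "group (heis_int r)"
proof (rule groupI)
  fix p assume "p \<in> carrier (heis_int r)"
  then show "\<exists>q\<in>carrier (heis_int r). q \<otimes>\<^bsub>heis_int r\<^esub> p = \<one>\<^bsub>heis_int r\<^esub>"
    by (cases p) (auto intro!: bexI[of _ "(- fst p, - fst (snd p), - snd (snd p))"])
next
  fix p q assume "p \<in> carrier (heis_int r)" "q \<in> carrier (heis_int r)"
  then show "p \<otimes>\<^bsub>heis_int r\<^esub> q \<in> carrier (heis_int r)"
    by (cases p; cases q) (auto simp: algebra_simps)
qed (auto simp: algebra_simps)

lemma heis_int_inv:
  assumes "(x, y, w) \<in> carrier (heis_int r)"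
  shows "inv\<^bsub>heis_int r\<^esub> (x, y, w) = (-x, -y, -w)"
  by (rule group.inv_equality[OF group_heis_int]) (use assms in auto)

lemma heis_int_nat_pow:
  "(x, y, w) [^]\<^bsub>heis_int r\<^esub> (k :: nat) = (int k * x, int k * y, int k * w)"
  by (induction k) (simp_all add: algebra_simps)

lemma heis_int_pow:
  assumes "(x, y, w) \<in> carrier (heis_int r)"
  shows "(x, y, w) [^]\<^bsub>heis_int r\<^esub> (k :: int) = (k * x, k * y, k * w)"
proof (cases "k < 0")
  case True
  have "(x, y, w) [^]\<^bsub>heis_int r\<^esub> nat (-k) \<in> carrier (heis_int r)"
    using monoid.nat_pow_closed[OF group.is_monoid[OF group_heis_int] assms] .
  then show ?thesis
    using True by (simp add: int_pow_def2 heis_int_nat_pow heis_int_inv del: heis_int_simps(1))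
qed (simp add: int_pow_def2 heis_int_nat_pow)

lemma heis_int_decompose:
  assumes "(x, y, w) \<in> carrier (heis_int r)"
  shows "(x, y, w) = (1, 0, 0) [^]\<^bsub>heis_int r\<^esub> x \<otimes>\<^bsub>heis_int r\<^esub> (0, 1, 0) [^]\<^bsub>heis_int r\<^esub> y
    \<otimes>\<^bsub>heis_int r\<^esub> (0, 0, 2) [^]\<^bsub>heis_int r\<^esub> ((w - int r * x * y) div 2)"
  using assms by (simp add: heis_int_pow)

text \<open>The relations of the Heisenberg group suffice to multiply normal forms: moving \<open>a\<close> past \<open>b\<close> produces
\<open>c\<close> to the power \<open>- r x' y\<close>.\<close>

lemma (in group) heis_int_hom:
  assumes a: "a \<in> carrier G" and b: "b \<in> carrier G" and c: "c \<in> carrier G"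
    and ab: "a \<otimes> b = c [^] int r \<otimes> (b \<otimes> a)"
    and ac: "a \<otimes> c = c \<otimes> a" and bc: "b \<otimes> c = c \<otimes> b"
  shows "(\<lambda>(x, y, w). a [^] x \<otimes> b [^] y \<otimes> c [^] ((w - int r * x * y) div 2)) \<in> hom (heis_int r) G"
    (is "?f \<in> _")
proof (rule homI)
  fix p q assume "p \<in> carrier (heis_int r)" "q \<in> carrier (heis_int r)"
  then obtain x y w x' y' w' where p: "p = (x, y, w)" "(x, y, w) \<in> carrier (heis_int r)"
    and q: "q = (x', y', w')" "(x', y', w') \<in> carrier (heis_int r)"
    by (cases p; cases q) auto
  define z z' where "z = (w - int r * x * y) div 2" and "z' = (w' - int r * x' * y') div 2"
  have w: "w = 2 * z + int r * x * y" "w' = 2 * z' + int r * x' * y'"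
    using p(2) q(2) by (simp_all add: z_def z'_def)
  have fp: "?f p = a [^] x \<otimes> b [^] y \<otimes> c [^] z" and fq: "?f q = a [^] x' \<otimes> b [^] y' \<otimes> c [^] z'"
    by (simp_all add: p q z_def z'_def)
  have "(w + w' + int r * (x * y' - x' * y) - int r * (x + x') * (y + y')) = 2 * (z + z' - int r * (x' * y))"
    by (simp add: w algebra_simps)
  then have fpq: "?f (p \<otimes>\<^bsub>heis_int r\<^esub> q) = a [^] (x + x') \<otimes> b [^] (y + y') \<otimes> c [^] (z + z' - int r * (x' * y))"
    by (simp add: p q)
  have C: "c [^] int r \<in> carrier G" using c by simp
  have acr: "a \<otimes> c [^] int r = c [^] int r \<otimes> a" and bcr: "b \<otimes> c [^] int r = c [^] int r \<otimes> b"
    using int_pow_commute[OF a c ac, of 1 "int r"] int_pow_commute[OF b c bc, of 1 "int r"] a b by simp_all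
  have ba: "b [^] y \<otimes> a [^] x' = c [^] (- (int r * (x' * y))) \<otimes> (a [^] x' \<otimes> b [^] y)"
  proof -
    have "a [^] x' \<otimes> b [^] y = c [^] (int r * (x' * y)) \<otimes> (b [^] y \<otimes> a [^] x')"
      using commutator_int_pow[OF a b C ab acr bcr, of x' y] c by (simp add: int_pow_pow)
    then have "c [^] (- (int r * (x' * y))) \<otimes> (a [^] x' \<otimes> b [^] y)
      = c [^] (- (int r * (x' * y))) \<otimes> c [^] (int r * (x' * y)) \<otimes> (b [^] y \<otimes> a [^] x')"
      using a b c by (simp add: m_assoc)
    then show ?thesis using a b c by (simp flip: int_pow_mult)
  qed
  have ca: "c [^] i \<otimes> a [^] j = a [^] j \<otimes> c [^] i" and cb: "c [^] i \<otimes> b [^] j = b [^] j \<otimes> c [^] i" for i j :: int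
    using int_pow_commute[OF a c ac] int_pow_commute[OF b c bc] by simp_all
  have "?f p \<otimes> ?f q = a [^] x \<otimes> (b [^] y \<otimes> (c [^] z \<otimes> a [^] x')) \<otimes> b [^] y' \<otimes> c [^] z'"
    unfolding fp fq using a b c by (simp add: m_assoc)
  also have "\<dots> = a [^] x \<otimes> (b [^] y \<otimes> a [^] x') \<otimes> (c [^] z \<otimes> b [^] y') \<otimes> c [^] z'"
    using a b c by (simp add: ca m_assoc)
  also have "\<dots> = a [^] x \<otimes> (c [^] (- (int r * (x' * y))) \<otimes> a [^] x') \<otimes> b [^] y \<otimes> b [^] y' \<otimes> (c [^] z \<otimes> c [^] z')"
    using a b c by (simp add: ba cb m_assoc)
  also have "\<dots> = a [^] x \<otimes> a [^] x' \<otimes> (c [^] (- (int r * (x' * y))) \<otimes> (b [^] y \<otimes> b [^] y')) \<otimes> (c [^] z \<otimes> c [^] z')"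
    using a b c by (simp add: ca m_assoc)
  also have "\<dots> = a [^] (x + x') \<otimes> b [^] (y + y') \<otimes> (c [^] (- (int r * (x' * y))) \<otimes> (c [^] (z + z')))"
    using a b c cb by (simp add: m_assoc flip: int_pow_mult)
  also have "\<dots> = ?f (p \<otimes>\<^bsub>heis_int r\<^esub> q)"
    unfolding fpq using c by (simp add: add.commute flip: int_pow_mult)
  finally show "?f (p \<otimes>\<^bsub>heis_int r\<^esub> q) = ?f p \<otimes> ?f q" by (rule HOL.sym)
qed (use a b c in auto)

lemma (in group) heis_int_hom_eq:
  assumes f: "f \<in> hom (heis_int r) G" and p: "(x, y, w) \<in> carrier (heis_int r)"
  shows "f (x, y, w) = f (1, 0, 0) [^] x \<otimes> f (0, 1, 0) [^] y \<otimes> f (0, 0, 2) [^] ((w - int r * x * y) div 2)"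
proof -
  interpret f: group_hom "heis_int r" G f
    using f group_heis_int by (simp add: group_hom_def group_hom_axioms_def is_group)
  have g: "(1, 0, 0) \<in> carrier (heis_int r)" "(0, 1, 0) \<in> carrier (heis_int r)" "(0, 0, 2) \<in> carrier (heis_int r)"
    by simp_all
  show ?thesis
    by (subst heis_int_decompose[OF p]) (simp add: g f.hom_int_pow del: heis_int_simps)
qed

primrec heis_point :: "heis_gen \<Rightarrow> int \<times> int \<times> int" where
  "heis_point Alpha = (1, 0, 0)"
| "heis_point Beta = (0, 1, 0)"
| "heis_point Gamma = (0, 0, 2)"

lemma heis_point_closed: "heis_point g \<in> carrier (heis_int r)"
  by (cases g) simp_all

lemma group_heis: "group (heis r)"
  by (simp add: heis_def group_presented_group)

lemma heis_elem_closed: "heis_elem r g \<in> carrier (heis r)"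
  by (simp add: heis_def heis_elem_def presented_group_carrier)

lemma heis_hom_unique:
  assumes "group K" "f \<in> hom (heis r) K" "g \<in> hom (heis r) K"
    and "\<And>s. f (heis_elem r s) = g (heis_elem r s)" and "U \<in> carrier (heis r)"
  shows "f U = g U"
  using group.presented_group_hom_unique[OF assms(1), of f "heis_relations r" g U] assms(2-)
  by (simp add: heis_def heis_elem_def)

lemma heis_rels:
  fixes r
  defines "a \<equiv> heis_elem r Alpha" and "b \<equiv> heis_elem r Beta" and "c \<equiv> heis_elem r Gamma"
  shows "a \<otimes>\<^bsub>heis r\<^esub> b = c [^]\<^bsub>heis r\<^esub> int r \<otimes>\<^bsub>heis r\<^esub> (b \<otimes>\<^bsub>heis r\<^esub> a)"
    and "a \<otimes>\<^bsub>heis r\<^esub> c = c \<otimes>\<^bsub>heis r\<^esub> a" and "b \<otimes>\<^bsub>heis r\<^esub> c = c \<otimes>\<^bsub>heis r\<^esub> b"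
proof -
  let ?R = "heis_relations r"
  interpret P: group "heis r" by (rule group_heis)
  note m = word_class_mult[of ?R, folded heis_def]
  show "a \<otimes>\<^bsub>heis r\<^esub> c = c \<otimes>\<^bsub>heis r\<^esub> a" "b \<otimes>\<^bsub>heis r\<^esub> c = c \<otimes>\<^bsub>heis r\<^esub> b"
    unfolding a_def b_def c_def heis_elem_def m
    by (auto simp: word_class_eq_iff heis_relations_def intro!: word_eq.relation)
  have cl: "a \<in> carrier (heis r)" "b \<in> carrier (heis r)" "c \<in> carrier (heis r)"
    by (simp_all add: a_def b_def c_def heis_elem_closed)
  have pow: "word_class ?R (replicate k (Gamma, True)) = c [^]\<^bsub>heis r\<^esub> int k" for k
  proof (induction k)
    case 0
    then show ?case by (simp add: heis_def presented_group_one)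
  next
    case (Suc k)
    have "word_class ?R (replicate (Suc k) (Gamma, True))
        = word_class ?R (replicate k (Gamma, True)) \<otimes>\<^bsub>heis r\<^esub> c"
      by (simp add: c_def heis_elem_def m replicate_append_same)
    also have "\<dots> = c [^]\<^bsub>heis r\<^esub> (int k + 1)"
      using Suc cl by (simp add: P.int_pow_mult)
    finally show ?case by (simp add: add.commute)
  qed
  let ?u = "[(Alpha, True), (Beta, True), (Alpha, False), (Beta, False)]"
  have "word_eq ?R (?u @ [(Beta, True), (Alpha, True)]) [(Alpha, True), (Beta, True)]"
  proof -
    have B: "word_eq ?R [(Beta, False), (Beta, True)] []" and A: "word_eq ?R [(Alpha, False), (Alpha, True)] []"
      using word_eq.cancel[of ?R _ False] by simp_all
    have "word_eq ?R ([(Alpha, False)] @ [(Beta, False), (Beta, True)] @ [(Alpha, True)])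
        ([(Alpha, False)] @ [] @ [(Alpha, True)])"
      by (rule word_eq.cong[OF word_eq.refl word_eq.cong[OF B word_eq.refl]])
    then have "word_eq ?R [(Alpha, False), (Beta, False), (Beta, True), (Alpha, True)] []"
      using A by (auto elim: word_eq.trans)
    from word_eq.cong[OF word_eq.refl[of ?R "[(Alpha, True), (Beta, True)]"] this]
    show ?thesis by simp
  qed
  then have "a \<otimes>\<^bsub>heis r\<^esub> b = word_class ?R ?u \<otimes>\<^bsub>heis r\<^esub> (b \<otimes>\<^bsub>heis r\<^esub> a)"
    unfolding a_def b_def heis_elem_def m by (simp add: word_class_eq_iff word_eq.sym)
  also have "word_class ?R ?u = word_class ?R (replicate r (Gamma, True))"
    unfolding word_class_eq_iff by (rule word_eq.relation) (simp add: heis_relations_def)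
  finally show "a \<otimes>\<^bsub>heis r\<^esub> b = c [^]\<^bsub>heis r\<^esub> int r \<otimes>\<^bsub>heis r\<^esub> (b \<otimes>\<^bsub>heis r\<^esub> a)"
    by (simp add: pow)
qed

text \<open>Sending generators to generators gives a map from the presented group to the model, and writing out normal
forms gives a map back; both composites fix the generators.\<close>

lemma heis_iso_heis_int:
  obtains \<iota> where "\<iota> \<in> iso (heis r) (heis_int r)" "\<And>s. \<iota> (heis_elem r s) = heis_point s"
proof -
  let ?M = "heis_int r"
  interpret M: group ?M by (rule group_heis_int)
  interpret P: group "heis r" by (rule group_heis)
  have gam: "word_value ?M heis_point (replicate k (Gamma, True)) = (0, 0, 2 * int k)" for k
    by (induction k) (simp_all add: letter_value_def)
  have rels: "word_value ?M heis_point u = word_value ?M heis_point v"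
    if "(u, v) \<in> heis_relations r" for u v
    using that by (auto simp: heis_relations_def letter_value_def heis_int_inv gam)
  obtain \<iota> where \<iota>: "\<iota> \<in> hom (heis r) ?M"
    and \<iota>w: "\<And>u. \<iota> (word_class (heis_relations r) u) = word_value ?M heis_point u"
    using M.presented_group_hom[of heis_point, OF heis_point_closed rels] unfolding heis_def by blast
  have \<iota>g: "\<iota> (heis_elem r s) = heis_point s" for s
    by (cases s) (simp_all add: heis_elem_def \<iota>w letter_value_def)
  let ?N = "\<lambda>(x, y, w). heis_elem r Alpha [^]\<^bsub>heis r\<^esub> x \<otimes>\<^bsub>heis r\<^esub> heis_elem r Beta [^]\<^bsub>heis r\<^esub> y
    \<otimes>\<^bsub>heis r\<^esub> heis_elem r Gamma [^]\<^bsub>heis r\<^esub> ((w - int r * x * y) div 2)"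
  have N: "?N \<in> hom ?M (heis r)"
    by (rule P.heis_int_hom) (simp_all add: heis_elem_closed heis_rels)
  have N\<iota>: "?N (\<iota> U) = U" if "U \<in> carrier (heis r)" for U
  proof -
    have "(?N \<circ> \<iota>) U = id U"
    proof (rule heis_hom_unique[OF P.is_group _ _ _ that])
      show "?N \<circ> \<iota> \<in> hom (heis r) (heis r)" by (rule hom_compose[OF \<iota> N])
      show "id \<in> hom (heis r) (heis r)" by (simp add: hom_def)
      show "(?N \<circ> \<iota>) (heis_elem r s) = id (heis_elem r s)" for s
        by (cases s) (simp_all add: \<iota>g heis_elem_closed)
    qed
    then show ?thesis by simp
  qed
  have \<iota>N: "\<iota> (?N p) = p" if "p \<in> carrier ?M" for p
  proof -
    obtain x y w where p: "p = (x, y, w)" by (cases p)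
    have "(\<iota> \<circ> ?N) (x, y, w) = (1, 0, 0) [^]\<^bsub>?M\<^esub> x \<otimes>\<^bsub>?M\<^esub> (0, 1, 0) [^]\<^bsub>?M\<^esub> y
        \<otimes>\<^bsub>?M\<^esub> (0, 0, 2) [^]\<^bsub>?M\<^esub> ((w - int r * x * y) div 2)"
      using M.heis_int_hom_eq[OF hom_compose[OF N \<iota>], of x y w] that
      by (simp add: p \<iota>g heis_elem_closed)
    also have "\<dots> = (x, y, w)"
      using heis_int_decompose[of x y w r] that p by simp
    finally show ?thesis by (simp add: p)
  qed
  have "group_isomorphisms (heis r) ?M \<iota> ?N"
    using \<iota> N N\<iota> \<iota>N by (simp add: group_isomorphisms_def)
  then show ?thesis using that \<iota>g group_isomorphisms_imp_iso by blast
qed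

section \<open>Homomorphisms and automorphisms of the Heisenberg groups\<close>

lemma heis_int_proj:
  "fst (p \<otimes>\<^bsub>heis_int r\<^esub> q) = fst p + fst q"
  "fst (snd (p \<otimes>\<^bsub>heis_int r\<^esub> q)) = fst (snd p) + fst (snd q)"
  by (cases p; cases q; simp)+

text \<open>A homomorphism to an abelian group kills the commutator \<open>\<gamma>\<^sup>r\<close>, and the integers have no torsion.\<close>

lemma heis_int_hom_integer:
  assumes r: "1 \<le> r" and f: "f \<in> hom (heis_int r) integer_group"
    and p: "(x, y, w) \<in> carrier (heis_int r)"
  shows "f (x, y, w) = f (1, 0, 0) * x + f (0, 1, 0) * y"
proof -
  interpret Z: group integer_group by simp
  have eq: "f (x, y, w) = x * f (1, 0, 0) + y * f (0, 1, 0) + ((w - int r * x * y) div 2) * f (0, 0, 2)"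
    if "(x, y, w) \<in> carrier (heis_int r)" for x y w
    using Z.heis_int_hom_eq[OF f that] by simp
  have mul: "f (u \<otimes>\<^bsub>heis_int r\<^esub> v) = f u + f v"
    if "u \<in> carrier (heis_int r)" "v \<in> carrier (heis_int r)" for u v
    using f that by (simp add: hom_def)
  have "f (1, 1, int r) = f (1, 1, - int r)"
    using mul[of "(1, 0, 0)" "(0, 1, 0)"] mul[of "(0, 1, 0)" "(1, 0, 0)"] by simp
  then have "f (0, 0, 2) = 0"
    using r eq[of 1 1 "int r"] eq[of 1 1 "- int r"] by auto
  then show ?thesis using eq[OF p] by (simp add: mult.commute)
qed

text \<open>The first two coordinates are homomorphisms to the integers, hence linear. The commutator relation fixes the
factor \<open>e\<close> on the centre, and then the last coordinate minus \<open>e w\<close> is again a homomorphism to the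
integers.\<close>

lemma heis_int_hom_heis_int:
  assumes r: "1 \<le> r" and F: "F \<in> hom (heis_int r) (heis_int r')"
  obtains a b c d e m n where
    "\<And>x y w. (x, y, w) \<in> carrier (heis_int r) \<Longrightarrow>
       F (x, y, w) = (a * x + b * y, c * x + d * y, e * w + m * x + n * y)"
    "int r' * (a * d - b * c) = e * int r"
    "even (m - int r' * a * c)" "even (n - int r' * b * d)"
proof -
  have mul: "F (u \<otimes>\<^bsub>heis_int r\<^esub> v) = F u \<otimes>\<^bsub>heis_int r'\<^esub> F v"
    if "u \<in> carrier (heis_int r)" "v \<in> carrier (heis_int r)" for u v
    using F that by (simp add: hom_def)
  have cl: "F u \<in> carrier (heis_int r')" if "u \<in> carrier (heis_int r)" for u
    using F that by (auto simp: hom_def)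
  have prj: "(\<lambda>p. fst (F p)) \<in> hom (heis_int r) integer_group"
            "(\<lambda>p. fst (snd (F p))) \<in> hom (heis_int r) integer_group"
    by (rule homI; simp add: mul heis_int_proj)+
  obtain a c m where A: "F (1, 0, 0) = (a, c, m)" by (metis prod.exhaust)
  obtain b d n where B: "F (0, 1, 0) = (b, d, n)" by (metis prod.exhaust)
  have xy: "fst (F (x, y, w)) = a * x + b * y" "fst (snd (F (x, y, w))) = c * x + d * y"
    if "(x, y, w) \<in> carrier (heis_int r)" for x y w
    using heis_int_hom_integer[OF r prj(1) that] heis_int_hom_integer[OF r prj(2) that] by (simp_all add: A B)
  obtain e' where "F (0, 0, 2) = (0, 0, e')" using xy[of 0 0 2] by (metis add_0 heis_int_simps(1) mult_zero_right prod.collapse diff_0_right dvd_refl)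
  moreover have "even e'" using cl[of "(0, 0, 2)"] calculation by simp
  ultimately obtain e where E: "F (0, 0, 2) = (0, 0, 2 * e)" by (metis dvdE)
  interpret M: group "heis_int r" by (rule group_heis_int)
  interpret M': group "heis_int r'" by (rule group_heis_int)
  have E': "F (0, 0, 2 * k) = (0, 0, 2 * e * k)" for k
    using hom_int_pow[OF F _ M.is_group M'.is_group, of "(0, 0, 2)" k]
    by (simp add: heis_int_pow E mult.commute)
  have det: "int r' * (a * d - b * c) = e * int r"
  proof -
    have "F (1, 1, int r) = F ((0, 1, 0) \<otimes>\<^bsub>heis_int r\<^esub> (1, 0, 0)) \<otimes>\<^bsub>heis_int r'\<^esub> F (0, 0, 2 * int r)"
      by (subst mul[symmetric]) simp_all
    moreover have "F (1, 1, int r) = F (1, 0, 0) \<otimes>\<^bsub>heis_int r'\<^esub> F (0, 1, 0)"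
      by (subst mul[symmetric]) simp_all
    ultimately have "F (1, 0, 0) \<otimes>\<^bsub>heis_int r'\<^esub> F (0, 1, 0)
        = F (0, 1, 0) \<otimes>\<^bsub>heis_int r'\<^esub> F (1, 0, 0) \<otimes>\<^bsub>heis_int r'\<^esub> F (0, 0, 2 * int r)"
      using mul[of "(0, 1, 0)" "(1, 0, 0)"] by simp
    then show ?thesis unfolding A B E' by (simp add: algebra_simps)
  qed
  define g where "g p = snd (snd (F p)) - e * snd (snd p)" for p
  have "g \<in> hom (heis_int r) integer_group"
  proof (rule homI)
    fix p q assume p: "p \<in> carrier (heis_int r)" and q: "q \<in> carrier (heis_int r)"
    obtain x y w x' y' w' where pq: "p = (x, y, w)" "q = (x', y', w')" by (metis prod.exhaust)
    have "snd (snd (F (p \<otimes>\<^bsub>heis_int r\<^esub> q))) = snd (snd (F p)) + snd (snd (F q))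
        + int r' * ((a * x + b * y) * (c * x' + d * y') - (a * x' + b * y') * (c * x + d * y))"
      using xy[of x y w] xy[of x' y' w'] p q unfolding mul[OF p q] unfolding pq
      by (cases "F (x, y, w)"; cases "F (x', y', w')") simp
    also have "(a * x + b * y) * (c * x' + d * y') - (a * x' + b * y') * (c * x + d * y)
        = (a * d - b * c) * (x * y' - x' * y)"
      by (simp add: algebra_simps)
    also have "int r' * \<dots> = e * int r * (x * y' - x' * y)"
      using det by (simp flip: mult.assoc)
    finally show "g (p \<otimes>\<^bsub>heis_int r\<^esub> q) = g p \<otimes>\<^bsub>integer_group\<^esub> g q"
      by (simp add: g_def pq algebra_simps)
  qed simp
  then have g: "g (x, y, w) = m * x + n * y" if "(x, y, w) \<in> carrier (heis_int r)" for x y w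
    using heis_int_hom_integer[OF r _ that, of g] by (simp add: g_def A B)
  show thesis
  proof
    fix x y w assume "(x, y, w) \<in> carrier (heis_int r)"
    from xy[OF this] g[OF this]
    show "F (x, y, w) = (a * x + b * y, c * x + d * y, e * w + m * x + n * y)"
      by (cases "F (x, y, w)") (simp add: g_def)
  next
    show "int r' * (a * d - b * c) = e * int r" by (rule det)
    show "even (m - int r' * a * c)" using cl[of "(1, 0, 0)"] by (simp add: A)
    show "even (n - int r' * b * d)" using cl[of "(0, 1, 0)"] by (simp add: B)
  qed
qed

lemma heis_int_iso_heis_int:
  assumes r: "1 \<le> r" "1 \<le> r'" and F: "F \<in> iso (heis_int r) (heis_int r')"
  obtains a b c d e m n where
    "\<And>x y w. (x, y, w) \<in> carrier (heis_int r) \<Longrightarrow>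
       F (x, y, w) = (a * x + b * y, c * x + d * y, e * w + m * x + n * y)"
    "r = r'" "e = 1 \<or> e = -1" "a * d - b * c = e"
    "even (m - int r' * a * c)" "even (n - int r' * b * d)"
proof -
  interpret M: group "heis_int r" by (rule group_heis_int)
  obtain F' where iso: "group_isomorphisms (heis_int r) (heis_int r') F F'"
    using F M.iso_iff_group_isomorphisms by blast
  obtain a b c d e m n where
    F: "\<And>x y w. (x, y, w) \<in> carrier (heis_int r) \<Longrightarrow>
       F (x, y, w) = (a * x + b * y, c * x + d * y, e * w + m * x + n * y)"
    and det: "int r' * (a * d - b * c) = e * int r"
    and par: "even (m - int r' * a * c)" "even (n - int r' * b * d)"
    using heis_int_hom_heis_int[of r F r'] r iso unfolding group_isomorphisms_def by blast
  obtain a' b' c' d' e' m' n' where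
    F': "\<And>x y w. (x, y, w) \<in> carrier (heis_int r') \<Longrightarrow>
       F' (x, y, w) = (a' * x + b' * y, c' * x + d' * y, e' * w + m' * x + n' * y)"
    using heis_int_hom_heis_int[of r' F' r] r iso unfolding group_isomorphisms_def by metis
  have cl: "F p \<in> carrier (heis_int r')" and inv: "F' (F p) = p" if "p \<in> carrier (heis_int r)" for p
    using iso that by (auto simp: group_isomorphisms_def hom_def)
  have 1: "F (1, 0, 0) = (a, c, m)" "F (0, 1, 0) = (b, d, n)" "F (0, 0, 2) = (0, 0, 2 * e)"
    using F[of 1 0 0] F[of 0 1 0] F[of 0 0 2] by simp_all
  have "(a' * a + b' * c = 1 \<and> c' * a + d' * c = 0) \<and> (a' * b + b' * d = 0 \<and> c' * b + d' * d = 1) \<and> e' * (2 * e) = 2"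
    using inv[of "(1, 0, 0)"] inv[of "(0, 1, 0)"] inv[of "(0, 0, 2)"]
      cl[of "(1, 0, 0)"] cl[of "(0, 1, 0)"] cl[of "(0, 0, 2)"]
    unfolding 1 using F'[of a c m] F'[of b d n] F'[of 0 0 "2 * e"] by simp
  then have "(a' * d' - b' * c') * (a * d - b * c) = 1" "e' * e = 1"
    by (algebra, simp)
  then have units: "a * d - b * c = 1 \<or> a * d - b * c = -1" "e = 1 \<or> e = -1"
    by (metis dvd_triv_right zdvd1_eq abs_eq_iff' abs_1)+
  then have "r = r'" "a * d - b * c = e" using det r by auto
  then show thesis using that F units par by blast
qed

definition heis_aff where
  "heis_aff r a b c d e m n =
    restrict (\<lambda>(x, y, w). (a * x + b * y, c * x + d * y, e * w + m * x + n * y)) (carrier (heis_int r))"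

lemma heis_aff_apply:
  "(x, y, w) \<in> carrier (heis_int r) \<Longrightarrow>
    heis_aff r a b c d e m n (x, y, w) = (a * x + b * y, c * x + d * y, e * w + m * x + n * y)"
  by (simp add: heis_aff_def)

text \<open>The parity conditions say that the images of the two generators lie in the group; modulo 2 they are
equivalent to the affine map preserving the parity condition in both directions.\<close>

lemma heis_aff_auto:
  fixes a b c d e m n :: int
  assumes e: "e = 1 \<or> e = -1" and det: "a * d - b * c = e"
    and par: "even (m - int r * a * c)" "even (n - int r * b * d)"
  shows "heis_aff r a b c d e m n \<in> auto (heis_int r)"
proof -
  let ?M = "heis_int r" and ?F = "heis_aff r a b c d e m n"
  have mem: "(a * x + b * y, c * x + d * y, e * w + m * x + n * y) \<in> carrier ?M
     \<longleftrightarrow> (x, y, w) \<in> carrier ?M" for x y w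
  proof -
    have "odd (a * d - b * c)" "odd e" using e det by auto
    then show ?thesis using par by (simp; safe; auto)
  qed
  have "?F \<in> hom ?M ?M"
  proof (rule homI)
    fix p assume "p \<in> carrier ?M"
    then show "?F p \<in> carrier ?M" using mem by (cases p) (simp add: heis_aff_apply del: heis_int_simps)
  next
    fix p q assume p: "p \<in> carrier ?M" and q: "q \<in> carrier ?M"
    obtain x y w x' y' w' where pq: "p = (x, y, w)" "q = (x', y', w')" by (metis prod.exhaust)
    have pq': "p \<otimes>\<^bsub>?M\<^esub> q \<in> carrier ?M"
      using group.is_monoid[OF group_heis_int] p q by (rule monoid.m_closed)
    have "int r * ((a * x + b * y) * (c * x' + d * y') - (a * x' + b * y') * (c * x + d * y))
        = e * (int r * (x * y' - x' * y))"
      unfolding det[symmetric] by (simp add: algebra_simps)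
    then show "?F (p \<otimes>\<^bsub>?M\<^esub> q) = ?F p \<otimes>\<^bsub>?M\<^esub> ?F q"
      using p q pq' unfolding pq heis_int_simps(2)
      by (simp add: heis_aff_apply algebra_simps del: heis_int_simps(1))
  qed
  moreover have "inj_on ?F (carrier ?M)"
  proof (rule inj_onI)
    fix p q assume p: "p \<in> carrier ?M" and q: "q \<in> carrier ?M" and eq: "?F p = ?F q"
    obtain x y w x' y' w' where pq: "p = (x, y, w)" "q = (x', y', w')" by (metis prod.exhaust)
    have h: "a * x + b * y = a * x' + b * y'" "c * x + d * y = c * x' + d * y'"
      "e * w + m * x + n * y = e * w' + m * x' + n * y'"
      using eq p q by (simp_all add: pq heis_aff_apply del: heis_int_simps(1))
    have "(a * d - b * c) * (x - x') = 0" "(a * d - b * c) * (y - y') = 0" using h(1,2) by algebra+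
    then have "x = x'" "y = y'" using det e by auto
    then show "p = q" using h(3) e by (auto simp: pq)
  qed
  moreover have "?F ` carrier ?M = carrier ?M"
  proof
    show "?F ` carrier ?M \<subseteq> carrier ?M" using calculation(1) by (auto simp: hom_def)
    show "carrier ?M \<subseteq> ?F ` carrier ?M"
    proof
      fix p assume p: "p \<in> carrier ?M"
      obtain x y w where xyw: "p = (x, y, w)" by (metis prod.exhaust)
      \<comment> \<open>Cramer's rule; e is its own inverse.\<close>
      define x0 y0 where "x0 = e * (d * x - b * y)" and "y0 = e * (a * y - c * x)"
      define w0 where "w0 = e * (w - m * x0 - n * y0)"
      have ee: "e * e = 1" using e by auto
      have "a * x0 + b * y0 = e * (a * d - b * c) * x" "c * x0 + d * y0 = e * (a * d - b * c) * y"
        by (simp_all add: x0_def y0_def algebra_simps)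
      moreover have "e * w0 = w - m * x0 - n * y0" by (simp add: w0_def ee flip: mult.assoc)
      ultimately have eq: "a * x0 + b * y0 = x" "c * x0 + d * y0 = y" "e * w0 + m * x0 + n * y0 = w"
        by (simp_all add: det ee)
      then have mem0: "(x0, y0, w0) \<in> carrier ?M" using mem[of x0 y0 w0] p xyw by simp
      with eq have "?F (x0, y0, w0) = p" by (simp add: heis_aff_apply xyw)
      with mem0 show "p \<in> ?F ` carrier ?M" by (metis image_eqI)
    qed
  qed
  ultimately show ?thesis by (simp add: auto_def Bij_def bij_betw_def heis_aff_def)
qed

lemma auto_heis_int:
  assumes r: "1 \<le> r" and f: "f \<in> auto (heis_int r)"
  obtains a b c d e m n where "f = heis_aff r a b c d e m n"
    "e = 1 \<or> e = -1" "a * d - b * c = e" "even (m - int r * a * c)" "even (n - int r * b * d)"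
proof -
  have "f \<in> iso (heis_int r) (heis_int r)" using f by (simp add: auto_def Bij_def iso_def)
  from heis_int_iso_heis_int[OF r r this] obtain a b c d e m n where
    F: "\<And>x y w. (x, y, w) \<in> carrier (heis_int r) \<Longrightarrow>
       f (x, y, w) = (a * x + b * y, c * x + d * y, e * w + m * x + n * y)"
    and abc: "e = 1 \<or> e = -1" "a * d - b * c = e" "even (m - int r * a * c)" "even (n - int r * b * d)"
    by metis
  have "f = heis_aff r a b c d e m n"
  proof
    fix p show "f p = heis_aff r a b c d e m n p"
    proof (cases "p \<in> carrier (heis_int r)")
      case True then show ?thesis using F by (cases p) (simp add: heis_aff_apply)
    next
      case False
      have "f \<in> extensional (carrier (heis_int r))" using f by (simp add: auto_def Bij_def)
      from extensional_arb[OF this False] False show ?thesis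
        by (simp only: heis_aff_def restrict_apply if_False)
    qed
  qed
  then show thesis using abc by (rule that)
qed

section \<open>Isomorphisms between mapping tori\<close>

text \<open>Over such a fibre, the projection is up to multiples the only homomorphism from the mapping torus to the
integers.\<close>

definition no_invariant_hom :: "('h, 'm) monoid_scheme \<Rightarrow> ('h \<Rightarrow> 'h) \<Rightarrow> bool" where
  "no_invariant_hom H f \<longleftrightarrow>
    (\<forall>u \<in> hom H integer_group. (\<forall>h\<in>carrier H. u (f h) = u h) \<longrightarrow> (\<forall>h\<in>carrier H. u h = 0))"

lemma mapping_torus_hom_fibre:
  assumes H: "group H" and f: "f \<in> auto H" and no: "no_invariant_hom H f"
    and \<Phi>: "\<Phi> \<in> hom (mapping_torus H f) (mapping_torus K g)" and h: "h \<in> carrier H"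
  shows "snd (\<Phi> (h, 0)) = 0"
proof -
  interpret H: group H by (rule H)
  let ?u = "\<lambda>h. snd (\<Phi> (h, 0))"
  have mul: "snd (\<Phi> (x \<otimes>\<^bsub>mapping_torus H f\<^esub> y)) = snd (\<Phi> x) + snd (\<Phi> y)"
    if "x \<in> carrier (mapping_torus H f)" "y \<in> carrier (mapping_torus H f)" for x y
    using hom_mult[OF \<Phi> that] by (simp add: mapping_torus_snd_mult)
  have U: "?u \<in> hom H integer_group"
  proof (rule homI)
    fix x y assume "x \<in> carrier H" "y \<in> carrier H"
    then show "?u (x \<otimes>\<^bsub>H\<^esub> y) = ?u x \<otimes>\<^bsub>integer_group\<^esub> ?u y"
      using mul[of "(x, 0)" "(y, 0)"] by (simp add: mapping_torus_carrier mapping_torus_mult_0)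
  qed simp
  have I: "?u (f x) = ?u x" if x: "x \<in> carrier H" for x
  proof -
    have fx: "f x \<in> carrier H" using auto_closed[OF f x] .
    have "(\<one>\<^bsub>H\<^esub>, 1) \<otimes>\<^bsub>mapping_torus H f\<^esub> (x, 0) = (f x, 0) \<otimes>\<^bsub>mapping_torus H f\<^esub> (\<one>\<^bsub>H\<^esub>, 1)"
      using x fx by (simp add: mapping_torus_mult_0 mapping_torus_mult_1[OF H f])
    from arg_cong[OF this, of "\<lambda>p. snd (\<Phi> p)"] show ?thesis
      using x fx by (simp add: mul mapping_torus_carrier)
  qed
  from no have "\<forall>h\<in>carrier H. ?u h = 0"
    unfolding no_invariant_hom_def by (rule bspec[OF _ U, THEN mp]) (simp add: I)
  then show ?thesis using h by simp
qed

text \<open>Both the isomorphism and its inverse map fibre to fibre, so they induce mutually inverse maps of the base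
\<open>\<int>\<close>, and the stable letter goes to an element over \<open>1\<close> or \<open>-1\<close>. In the second case the relation is
stated for the inverse of the stable letter, so that only the automorphisms themselves occur.\<close>

lemma mapping_torus_isoD:
  assumes H: "group H" and K: "group K" and f: "f \<in> auto H" and g: "g \<in> auto K"
    and noH: "no_invariant_hom H f" and noK: "no_invariant_hom K g"
    and iso: "mapping_torus H f \<cong> mapping_torus K g"
  obtains F c where "F \<in> iso H K" "c \<in> carrier K"
    "(\<forall>h\<in>carrier H. F (f h) \<otimes>\<^bsub>K\<^esub> c = c \<otimes>\<^bsub>K\<^esub> g (F h)) \<or>
     (\<forall>h\<in>carrier H. c \<otimes>\<^bsub>K\<^esub> g (F (f h)) = F h \<otimes>\<^bsub>K\<^esub> c)"
proof -
  interpret H: group H by (rule H)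
  interpret K: group K by (rule K)
  let ?S = "mapping_torus H f" and ?T = "mapping_torus K g"
  interpret S: group ?S by (rule group_mapping_torus[OF H f])
  interpret T: group ?T by (rule group_mapping_torus[OF K g])
  obtain \<Phi> \<Psi> where "group_isomorphisms ?S ?T \<Phi> \<Psi>"
    using iso S.iso_iff_group_isomorphisms unfolding is_iso_def by blast
  then have \<Phi>: "\<Phi> \<in> hom ?S ?T" and \<Psi>: "\<Psi> \<in> hom ?T ?S"
    and \<Psi>\<Phi>: "\<And>x. x \<in> carrier ?S \<Longrightarrow> \<Psi> (\<Phi> x) = x" and \<Phi>\<Psi>: "\<And>y. y \<in> carrier ?T \<Longrightarrow> \<Phi> (\<Psi> y) = y"
    by (auto simp: group_isomorphisms_def)
  define F where "F h = fst (\<Phi> (h, 0))" for h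
  define F' where "F' h = fst (\<Psi> (h, 0))" for h
  have F: "\<Phi> (h, 0) = (F h, 0)" if "h \<in> carrier H" for h
    using mapping_torus_hom_fibre[OF H f noH \<Phi> that] by (simp add: F_def prod_eq_iff)
  have F': "\<Psi> (h, 0) = (F' h, 0)" if "h \<in> carrier K" for h
    using mapping_torus_hom_fibre[OF K g noK \<Psi> that] by (simp add: F'_def prod_eq_iff)
  have inS: "(h, k) \<in> carrier ?S \<longleftrightarrow> h \<in> carrier H" for h k by (simp add: mapping_torus_carrier)
  have inT: "(h, k) \<in> carrier ?T \<longleftrightarrow> h \<in> carrier K" for h k by (simp add: mapping_torus_carrier)
  have Fcl: "F h \<in> carrier K" if "h \<in> carrier H" for h
    using hom_in_carrier[OF \<Phi>, of "(h, 0)"] that by (simp add: inS F inT)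
  have F'cl: "F' h \<in> carrier H" if "h \<in> carrier K" for h
    using hom_in_carrier[OF \<Psi>, of "(h, 0)"] that by (simp add: inS F' inT)
  have "group_isomorphisms H K F F'"
    unfolding group_isomorphisms_def
  proof (intro conjI ballI)
    show "F \<in> hom H K"
    proof (rule homI[OF Fcl])
      fix x y assume xy: "x \<in> carrier H" "y \<in> carrier H"
      then have "\<Phi> ((x, 0) \<otimes>\<^bsub>?S\<^esub> (y, 0)) = \<Phi> (x, 0) \<otimes>\<^bsub>?T\<^esub> \<Phi> (y, 0)"
        using hom_mult[OF \<Phi>] by (simp add: inS)
      then show "F (x \<otimes>\<^bsub>H\<^esub> y) = F x \<otimes>\<^bsub>K\<^esub> F y"
        using xy by (simp add: mapping_torus_mult_0 F Fcl)
    qed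
    show "F' \<in> hom K H"
    proof (rule homI[OF F'cl])
      fix x y assume xy: "x \<in> carrier K" "y \<in> carrier K"
      then have "\<Psi> ((x, 0) \<otimes>\<^bsub>?T\<^esub> (y, 0)) = \<Psi> (x, 0) \<otimes>\<^bsub>?S\<^esub> \<Psi> (y, 0)"
        using hom_mult[OF \<Psi>] by (simp add: inT)
      then show "F' (x \<otimes>\<^bsub>K\<^esub> y) = F' x \<otimes>\<^bsub>H\<^esub> F' y"
        using xy by (simp add: mapping_torus_mult_0 F' F'cl)
    qed
    show "F' (F x) = x" if "x \<in> carrier H" for x
      using \<Psi>\<Phi>[of "(x, 0)"] that by (simp add: inS F F' Fcl)
    show "F (F' y) = y" if "y \<in> carrier K" for y
      using \<Phi>\<Psi>[of "(y, 0)"] that by (simp add: inT F F' F'cl)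
  qed
  then have Fiso: "F \<in> iso H K" by (rule group_isomorphisms_imp_iso)
  define t where "t = (\<one>\<^bsub>H\<^esub>, 1::int)"
  have t: "t \<in> carrier ?S" by (simp add: t_def inS)
  have t_rel: "t \<otimes>\<^bsub>?S\<^esub> (h, 0) = (f h, 0) \<otimes>\<^bsub>?S\<^esub> t" if "h \<in> carrier H" for h
    using that auto_closed[OF f that] by (simp add: t_def mapping_torus_mult_0 mapping_torus_mult_1[OF H f])
  have snd_pow: "snd (x [^]\<^bsub>?T\<^esub> k) = k * snd x" if "x \<in> carrier ?T" for x and k :: int
    using hom_int_pow[OF mapping_torus_snd_hom that T.is_group, of k] by simp
  have sndS_pow: "snd (x [^]\<^bsub>?S\<^esub> k) = k * snd x" if "x \<in> carrier ?S" for x and k :: int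
    using hom_int_pow[OF mapping_torus_snd_hom that S.is_group, of k] by simp
  \<comment> \<open>The stable letter goes to an element over a generator of the base.\<close>
  have "\<exists>x. snd (\<Phi> x) = 1 \<and> x \<in> carrier ?S"
    using \<Phi>\<Psi>[of "(\<one>\<^bsub>K\<^esub>, 1)"] hom_in_carrier[OF \<Psi>, of "(\<one>\<^bsub>K\<^esub>, 1)"] by (metis inT K.one_closed snd_conv)
  then obtain h k where hk: "snd (\<Phi> (h, k)) = 1" "h \<in> carrier H"
    by (metis inS prod.exhaust)
  have "(h, 0) \<otimes>\<^bsub>?S\<^esub> t [^]\<^bsub>?S\<^esub> k = (h, k)"
  proof -
    have tk: "t [^]\<^bsub>?S\<^esub> k \<in> carrier ?S" using t by simp
    have "t [^]\<^bsub>?S\<^esub> k = (\<one>\<^bsub>H\<^esub>, k)"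
    proof (induction k rule: int_induct[of _ 0])
      case base
      then show ?case by (simp add: mapping_torus_one)
    next
      case (step1 i)
      have "t [^]\<^bsub>?S\<^esub> (1 + i) = t \<otimes>\<^bsub>?S\<^esub> t [^]\<^bsub>?S\<^esub> i" using t by (simp add: S.int_pow_mult)
      also have "\<dots> = (\<one>\<^bsub>H\<^esub>, 1 + i)"
        unfolding step1 using hom_one[OF auto_homD[OF f] H H] by (simp add: t_def mapping_torus_mult_1[OF H f])
      finally show ?case by (simp add: add.commute)
    next
      case (step2 i)
      have "t \<otimes>\<^bsub>?S\<^esub> t [^]\<^bsub>?S\<^esub> (i - 1) = t [^]\<^bsub>?S\<^esub> i"
        using S.int_pow_mult[OF t, of 1 "i - 1"] t by simp
      also have "\<dots> = t \<otimes>\<^bsub>?S\<^esub> (\<one>\<^bsub>H\<^esub>, i - 1)"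
        unfolding step2 using hom_one[OF auto_homD[OF f] H H] by (simp add: t_def mapping_torus_mult_1[OF H f])
      finally show ?case using t by (simp add: inS)
    qed
    then show ?thesis using hk by (simp add: mapping_torus_mult_0)
  qed
  then have "\<Phi> (h, k) = \<Phi> (h, 0) \<otimes>\<^bsub>?T\<^esub> \<Phi> t [^]\<^bsub>?T\<^esub> k"
    using hom_mult[OF \<Phi>, of "(h, 0)" "t [^]\<^bsub>?S\<^esub> k"] hom_int_pow[OF \<Phi> t S.is_group T.is_group, of k] hk t
    by (simp add: inS)
  then have "k * snd (\<Phi> t) = 1"
    using hk F[OF hk(2)] snd_pow[OF hom_in_carrier[OF \<Phi> t], of k] by (simp add: mapping_torus_snd_mult)
  then have "snd (\<Phi> t) = 1 \<or> snd (\<Phi> t) = -1"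
    by (metis dvd_triv_right zdvd1_eq abs_eq_iff' abs_1)
  then show thesis
  proof
    assume "snd (\<Phi> t) = 1"
    then obtain c where c: "\<Phi> t = (c, 1)" by (metis prod.collapse)
    have ccl: "c \<in> carrier K" using hom_in_carrier[OF \<Phi> t] by (simp add: c inT)
    have "F (f h) \<otimes>\<^bsub>K\<^esub> c = c \<otimes>\<^bsub>K\<^esub> g (F h)" if h: "h \<in> carrier H" for h
      using arg_cong[OF t_rel[OF h], of \<Phi>] h t auto_closed[OF f h] ccl
      by (simp add: hom_mult[OF \<Phi>] inS F c mapping_torus_mult_0 mapping_torus_mult_1[OF K g])
    then show thesis using that[OF Fiso ccl] by blast
  next
    assume m: "snd (\<Phi> t) = -1"
    let ?s = "inv\<^bsub>?S\<^esub> t"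
    have s: "?s \<in> carrier ?S" using t by simp
    interpret \<Phi>: group_hom ?S ?T \<Phi> using \<Phi> by unfold_locales
    have "snd (\<Phi> ?s) = 1"
      using snd_pow[OF hom_in_carrier[OF \<Phi> t], of "-1"] t m
      by (simp add: T.int_pow_neg[OF hom_in_carrier[OF \<Phi> t]])
    then obtain c where c: "\<Phi> ?s = (c, 1)" by (metis prod.collapse)
    have ccl: "c \<in> carrier K" using hom_in_carrier[OF \<Phi> s] by (simp add: c inT)
    have "c \<otimes>\<^bsub>K\<^esub> g (F (f h)) = F h \<otimes>\<^bsub>K\<^esub> c" if h: "h \<in> carrier H" for h
    proof -
      note fh = auto_closed[OF f h]
      have "?s \<otimes>\<^bsub>?S\<^esub> (f h, 0) \<otimes>\<^bsub>?S\<^esub> t = ?s \<otimes>\<^bsub>?S\<^esub> (t \<otimes>\<^bsub>?S\<^esub> (h, 0))"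
        using t s h fh by (simp add: t_rel inS S.m_assoc)
      also have "\<dots> = (h, 0)" using t h by (simp add: inS flip: S.m_assoc)
      finally have "?s \<otimes>\<^bsub>?S\<^esub> (f h, 0) = (h, 0) \<otimes>\<^bsub>?S\<^esub> ?s"
        using t s h fh by (simp add: inS S.inv_solve_right)
      from arg_cong[OF this, of \<Phi>] show ?thesis
        using h s fh ccl by (simp add: inS F c mapping_torus_mult_0 mapping_torus_mult_1[OF K g])
    qed
    then show thesis using that[OF Fiso ccl] by blast
  qed
qed

text \<open>An invariant row vector is killed by \<open>B - 1\<close>, whose determinant is \<open>2 - (a + d)\<close>.\<close>

lemma heis_aff_no_invariant_hom:
  assumes r: "1 \<le> r" and det: "a * d - b * c = 1" and tr: "a + d \<noteq> 2"
    and par: "even (m - int r * a * c)" "even (n - int r * b * d)"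
  shows "no_invariant_hom (heis_int r) (heis_aff r a b c d 1 m n)"
  unfolding no_invariant_hom_def
proof (intro ballI impI)
  fix u p assume u: "u \<in> hom (heis_int r) integer_group"
    and inv: "\<forall>h\<in>carrier (heis_int r). u (heis_aff r a b c d 1 m n h) = u h"
    and p: "p \<in> carrier (heis_int r)"
  define \<alpha> \<beta> where "\<alpha> = u (1, 0, 0)" and "\<beta> = u (0, 1, 0)"
  have "(a, c, m) \<in> carrier (heis_int r)" "(b, d, n) \<in> carrier (heis_int r)" using par by simp_all
  then have "\<alpha> * a + \<beta> * c = \<alpha>" "\<alpha> * b + \<beta> * d = \<beta>"
    using inv[rule_format, of "(1, 0, 0)"] inv[rule_format, of "(0, 1, 0)"]
      heis_int_hom_integer[OF r u, of a c m] heis_int_hom_integer[OF r u, of b d n]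
    by (simp_all add: heis_aff_apply \<alpha>_def \<beta>_def)
  note fixed = this
  have "(2 - (a + d)) * \<alpha> = (1 - d) * (\<alpha> - (\<alpha> * a + \<beta> * c)) + c * (\<beta> - (\<alpha> * b + \<beta> * d))
      + (1 - (a * d - b * c)) * \<alpha>"
    by (simp add: algebra_simps)
  then have "(2 - (a + d)) * \<alpha> = 0" unfolding fixed det by simp
  moreover have "(2 - (a + d)) * \<beta> = b * (\<alpha> - (\<alpha> * a + \<beta> * c)) + (1 - a) * (\<beta> - (\<alpha> * b + \<beta> * d))
      + (1 - (a * d - b * c)) * \<beta>"
    by (simp add: algebra_simps)
  then have "(2 - (a + d)) * \<beta> = 0" unfolding fixed det by simp
  ultimately have "\<alpha> = 0" "\<beta> = 0" using tr by auto
  then show "u p = 0"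
    using heis_int_hom_integer[OF r u, of "fst p" "fst (snd p)" "snd (snd p)"] p by (simp add: \<alpha>_def \<beta>_def)
qed

text \<open>Writing \<open>S = (p, q; s, t)\<close>, \<open>\<lambda> = (k, l)\<close>, \<open>\<lambda>' = (k', l')\<close> and \<open>\<mu> = (m, n)\<close>, the conclusion reads either
\<open>S B = B' S\<close> and \<open>e \<lambda> + \<mu> B = \<mu> + \<lambda>' S\<close> modulo \<open>2 r\<close>, or \<open>S B = B'\<^sup>-\<^sup>1 S\<close> and
\<open>e \<lambda> + \<mu> B + \<lambda>' S B = \<mu>\<close> modulo \<open>2 r\<close>. The multiples \<open>2 r X\<close> and \<open>2 r Y\<close> come from the inner
automorphism by the fibre component of the image of the stable letter or of its inverse.\<close>

lemma torus_iso_necessary: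
  assumes r: "1 \<le> r" "1 \<le> r'"
    and B: "a * d - b * c = 1" "a + d \<noteq> 2" "even (k - int r * a * c)" "even (l - int r * b * d)"
    and B': "a' * d' - b' * c' = 1" "a' + d' \<noteq> 2" "even (k' - int r' * a' * c')" "even (l' - int r' * b' * d')"
    and iso: "mapping_torus (heis_int r) (heis_aff r a b c d 1 k l)
      \<cong> mapping_torus (heis_int r') (heis_aff r' a' b' c' d' 1 k' l')"
  obtains p q s t e m n X Y where "r = r'" "e = 1 \<or> e = -1" "p * t - q * s = e"
    "even (m - int r * p * s)" "even (n - int r * q * t)"
    "(p * a + q * c = a' * p + b' * s \<and> p * b + q * d = a' * q + b' * t \<and>
      s * a + t * c = c' * p + d' * s \<and> s * b + t * d = c' * q + d' * t \<and>
      e * k + (m * a + n * c) = m + (k' * p + l' * s) + 2 * int r * X \<and>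
      e * l + (m * b + n * d) = n + (k' * q + l' * t) + 2 * int r * Y) \<or>
     (p * a + q * c = d' * p - b' * s \<and> p * b + q * d = d' * q - b' * t \<and>
      s * a + t * c = a' * s - c' * p \<and> s * b + t * d = a' * t - c' * q \<and>
      e * k + (m * a + n * c) + (k' * (p * a + q * c) + l' * (s * a + t * c)) = m + 2 * int r * X \<and>
      e * l + (m * b + n * d) + (k' * (p * b + q * d) + l' * (s * b + t * d)) = n + 2 * int r * Y)"
proof -
  let ?f = "heis_aff r a b c d 1 k l" and ?g = "heis_aff r' a' b' c' d' 1 k' l'"
  have f: "?f \<in> auto (heis_int r)" and g: "?g \<in> auto (heis_int r')"
    by (rule heis_aff_auto[OF disjI1[OF HOL.refl]]; fact B B')+
  obtain F c0 where F: "F \<in> iso (heis_int r) (heis_int r')" and c0: "c0 \<in> carrier (heis_int r')"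
    and rel: "(\<forall>h\<in>carrier (heis_int r). F (?f h) \<otimes>\<^bsub>heis_int r'\<^esub> c0 = c0 \<otimes>\<^bsub>heis_int r'\<^esub> ?g (F h)) \<or>
     (\<forall>h\<in>carrier (heis_int r). c0 \<otimes>\<^bsub>heis_int r'\<^esub> ?g (F (?f h)) = F h \<otimes>\<^bsub>heis_int r'\<^esub> c0)"
    using mapping_torus_isoD[OF group_heis_int group_heis_int f g _ _ iso]
      heis_aff_no_invariant_hom[OF r(1) B] heis_aff_no_invariant_hom[OF r(2) B'] by blast
  from heis_int_iso_heis_int[OF r F] obtain p q s t e m n where
    Fe: "\<And>x y w. (x, y, w) \<in> carrier (heis_int r) \<Longrightarrow>
       F (x, y, w) = (p * x + q * y, s * x + t * y, e * w + m * x + n * y)"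
    and e: "r = r'" "e = 1 \<or> e = -1" "p * t - q * s = e"
    "even (m - int r' * p * s)" "even (n - int r' * q * t)" by metis
  have twice: "A = A' + 2 * i * (u - v)" if "A + i * (v - u) = A' + i * (u - v)" for A A' i u v :: int
    using that by (simp add: algebra_simps)
  obtain x0 y0 w0 where c0e: "c0 = (x0, y0, w0)" by (metis prod.exhaust)
  have Fcl: "F h \<in> carrier (heis_int r')" if "h \<in> carrier (heis_int r)" for h
    using F that by (auto simp: iso_def hom_def)
  have m1: "(a, c, k) \<in> carrier (heis_int r)" "(b, d, l) \<in> carrier (heis_int r)"
    using B by simp_all
  have fe: "?f (1, 0, 0) = (a, c, k)" "?f (0, 1, 0) = (b, d, l)" by (simp_all add: heis_aff_apply)
  have Fb: "F (1, 0, 0) = (p, s, m)" "F (0, 1, 0) = (q, t, n)"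
    using Fe[of 1 0 0] Fe[of 0 1 0] by simp_all
  have F1: "(p, s, m) \<in> carrier (heis_int r')" "(q, t, n) \<in> carrier (heis_int r')"
    using Fcl[of "(1, 0, 0)"] Fcl[of "(0, 1, 0)"] unfolding Fb by simp_all
  note gF = heis_aff_apply[OF F1(1), of a' b' c' d' 1 k' l'] heis_aff_apply[OF F1(2), of a' b' c' d' 1 k' l']
  have Ff: "F (a, c, k) = (p * a + q * c, s * a + t * c, e * k + m * a + n * c)"
    "F (b, d, l) = (p * b + q * d, s * b + t * d, e * l + m * b + n * d)"
    using Fe m1 by blast+
  note gFf = heis_aff_apply[OF Fcl[OF m1(1), unfolded Ff], of a' b' c' d' 1 k' l']
    heis_aff_apply[OF Fcl[OF m1(2), unfolded Ff], of a' b' c' d' 1 k' l']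
  from rel show thesis
  proof
    assume R: "\<forall>h\<in>carrier (heis_int r). F (?f h) \<otimes>\<^bsub>heis_int r'\<^esub> c0 = c0 \<otimes>\<^bsub>heis_int r'\<^esub> ?g (F h)"
    have "F (a, c, k) \<otimes>\<^bsub>heis_int r'\<^esub> c0 = c0 \<otimes>\<^bsub>heis_int r'\<^esub> ?g (p, s, m)"
      "F (b, d, l) \<otimes>\<^bsub>heis_int r'\<^esub> c0 = c0 \<otimes>\<^bsub>heis_int r'\<^esub> ?g (q, t, n)"
      using R[rule_format, of "(1, 0, 0)"] R[rule_format, of "(0, 1, 0)"] by (simp_all add: fe Fb)
    note eqs = this[unfolded Ff gF c0e heis_int_simps prod.inject]
    have conj: "a' * p + b' * s = p * a + q * c" "c' * p + d' * s = s * a + t * c"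
      "a' * q + b' * t = p * b + q * d" "c' * q + d' * t = s * b + t * d"
      using eqs by linarith+
    note eqs' = eqs[unfolded conj, THEN conjunct2, THEN conjunct2, THEN twice, folded e(1)]
    show thesis
      by (rule that[OF e(1) e(2) e(3) e(4)[folded e(1)] e(5)[folded e(1)] disjI1,
          of "x0 * (s * a + t * c) - (p * a + q * c) * y0" "x0 * (s * b + t * d) - (p * b + q * d) * y0"])
        (intro conjI; insert eqs' conj; linarith)
  next
    assume R: "\<forall>h\<in>carrier (heis_int r). c0 \<otimes>\<^bsub>heis_int r'\<^esub> ?g (F (?f h)) = F h \<otimes>\<^bsub>heis_int r'\<^esub> c0"
    have "c0 \<otimes>\<^bsub>heis_int r'\<^esub> ?g (F (a, c, k)) = (p, s, m) \<otimes>\<^bsub>heis_int r'\<^esub> c0"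
      "c0 \<otimes>\<^bsub>heis_int r'\<^esub> ?g (F (b, d, l)) = (q, t, n) \<otimes>\<^bsub>heis_int r'\<^esub> c0"
      using R[rule_format, of "(1, 0, 0)"] R[rule_format, of "(0, 1, 0)"] by (simp_all add: fe Fb)
    note eqs = this[unfolded Ff, unfolded gFf c0e heis_int_simps prod.inject]
    have conj: "a' * (p * a + q * c) + b' * (s * a + t * c) = p"
      "c' * (p * a + q * c) + d' * (s * a + t * c) = s"
      "a' * (p * b + q * d) + b' * (s * b + t * d) = q"
      "c' * (p * b + q * d) + d' * (s * b + t * d) = t"
      using eqs by linarith+
    have adj: "u = d' * x - b' * y \<and> v = a' * y - c' * x"
      if "a' * u + b' * v = x" "c' * u + d' * v = y" for u v x y
    proof -
      have "d' * x - b' * y = (a' * d' - b' * c') * u" "a' * y - c' * x = (a' * d' - b' * c') * v"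
        by (simp_all add: algebra_simps flip: that)
      then show ?thesis by (simp add: B'(1))
    qed
    have conj': "p * a + q * c = d' * p - b' * s" "s * a + t * c = a' * s - c' * p"
      "p * b + q * d = d' * q - b' * t" "s * b + t * d = a' * t - c' * q"
      using adj[OF conj(1,2)] adj[OF conj(3,4)] by blast+
    note eqs' = eqs[unfolded conj, THEN conjunct2, THEN conjunct2, THEN twice, folded e(1)]
    show thesis
      by (rule that[OF e(1) e(2) e(3) e(4)[folded e(1)] e(5)[folded e(1)] disjI2,
          of "p * y0 - x0 * s" "q * y0 - x0 * t"])
        (intro conjI conj'; insert eqs'; simp add: distrib_left)
  qed
qed

text \<open>The affine map given by \<open>S\<close> and \<open>\<mu>\<close> is the isomorphism of fibres, corrected by an inner automorphism
that absorbs \<open>2 r X\<close> and \<open>2 r Y\<close>.\<close>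

lemma torus_iso_sufficient:
  fixes p q s t e m n X Y :: int
  assumes B: "a * d - b * c = 1" "even (k - int r * a * c)" "even (l - int r * b * d)"
    and B': "a' * d' - b' * c' = 1" "even (k' - int r * a' * c')" "even (l' - int r * b' * d')"
    and S: "e = 1 \<or> e = -1" "p * t - q * s = e" "even (m - int r * p * s)" "even (n - int r * q * t)"
    and conj: "p * a + q * c = a' * p + b' * s" "p * b + q * d = a' * q + b' * t"
      "s * a + t * c = c' * p + d' * s" "s * b + t * d = c' * q + d' * t"
    and lin: "e * k + (m * a + n * c) = m + (k' * p + l' * s) + 2 * int r * X"
      "e * l + (m * b + n * d) = n + (k' * q + l' * t) + 2 * int r * Y"
  shows "mapping_torus (heis_int r) (heis_aff r a b c d 1 k l)
      \<cong> mapping_torus (heis_int r) (heis_aff r a' b' c' d' 1 k' l')"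
proof -
  let ?M = "heis_int r"
  let ?f = "heis_aff r a b c d 1 k l" and ?g = "heis_aff r a' b' c' d' 1 k' l'"
    and ?F = "heis_aff r p q s t e m n"
  have f: "?f \<in> auto ?M" and g: "?g \<in> auto ?M"
    by (rule heis_aff_auto[OF disjI1[OF HOL.refl]]; fact B B')+
  have F: "?F \<in> auto ?M" by (rule heis_aff_auto[OF S])
  then have Fiso: "?F \<in> iso ?M ?M" by (simp add: auto_def Bij_def iso_def)
  define P Q U V where "P = p * a + q * c" and "Q = p * b + q * d" and "U = s * a + t * c" and "V = s * b + t * d"
  have "P * V - Q * U = (p * t - q * s) * (a * d - b * c)"
    by (simp add: P_def Q_def U_def V_def algebra_simps)
  then have detSB: "P * V - Q * U = e" by (simp add: S(2) B(1))
  have ee: "e * e = 1" using S(1) by auto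
  \<comment> \<open>An inner automorphism adds a multiple of 2 r; unimodularity of SB makes every multiple occur.\<close>
  define x0 y0 where "x0 = e * (P * Y - Q * X)" and "y0 = e * (U * Y - V * X)"
  have X: "x0 * U - P * y0 = X" and Y: "x0 * V - Q * y0 = Y"
  proof -
    have "x0 * U - P * y0 = e * (P * V - Q * U) * X" "x0 * V - Q * y0 = e * (P * V - Q * U) * Y"
      by (simp_all add: x0_def y0_def algebra_simps)
    then show "x0 * U - P * y0 = X" "x0 * V - Q * y0 = Y" by (simp_all add: detSB ee)
  qed
  define c0 where "c0 = (x0, y0, int r * x0 * y0)"
  have c0: "c0 \<in> carrier ?M" by (simp add: c0_def)
  show ?thesis
  proof (rule mapping_torus_iso[OF group_heis_int group_heis_int f g Fiso c0])
    fix h assume h: "h \<in> carrier ?M"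
    obtain x y w where hxy: "h = (x, y, w)" by (metis prod.exhaust)
    have fh: "?f h = (a * x + b * y, c * x + d * y, 1 * w + k * x + l * y)"
      unfolding hxy by (rule heis_aff_apply[OF h[unfolded hxy]])
    have Fh: "?F h = (p * x + q * y, s * x + t * y, e * w + m * x + n * y)"
      unfolding hxy by (rule heis_aff_apply[OF h[unfolded hxy]])
    note Ffh = heis_aff_apply[OF auto_closed[OF f h, unfolded fh], of p q s t e m n]
    note gFh = heis_aff_apply[OF auto_closed[OF F h, unfolded Fh], of a' b' c' d' 1 k' l']
    have 1: "p * (a * x + b * y) + q * (c * x + d * y) = P * x + Q * y"
      "s * (a * x + b * y) + t * (c * x + d * y) = U * x + V * y"
      by (simp_all add: P_def Q_def U_def V_def algebra_simps)
    have 2: "a' * (p * x + q * y) + b' * (s * x + t * y) = P * x + Q * y"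
      "c' * (p * x + q * y) + d' * (s * x + t * y) = U * x + V * y"
      unfolding P_def Q_def U_def V_def conj by (simp_all add: algebra_simps)
    have "e * (1 * w + k * x + l * y) + m * (a * x + b * y) + n * (c * x + d * y)
        = e * w + (e * k + (m * a + n * c)) * x + (e * l + (m * b + n * d)) * y"
      by (simp add: algebra_simps)
    also have "\<dots> = e * w + (m + (k' * p + l' * s)) * x + (n + (k' * q + l' * t)) * y
        + 2 * int r * (x0 * U - P * y0) * x + 2 * int r * (x0 * V - Q * y0) * y"
      unfolding lin X Y by (simp add: algebra_simps)
    finally have 3: "e * (1 * w + k * x + l * y) + m * (a * x + b * y) + n * (c * x + d * y)
        + int r * ((P * x + Q * y) * y0 - x0 * (U * x + V * y))
      = (1 * (e * w + m * x + n * y) + k' * (p * x + q * y) + l' * (s * x + t * y))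
        + int r * (x0 * (U * x + V * y) - (P * x + Q * y) * y0)"
      by (simp add: algebra_simps)
    show "?F (?f h) \<otimes>\<^bsub>?M\<^esub> c0 = c0 \<otimes>\<^bsub>?M\<^esub> ?g (?F h)"
      unfolding fh Fh Ffh gFh 1 2 c0_def heis_int_simps(2) using 3 by (simp only: prod.inject) simp
  qed
qed

section \<open>Oscillator groups in the integer model\<close>

text \<open>The generators satisfy \<open>\<phi>(\<alpha>) = \<alpha>\<^sup>a \<beta>\<^sup>c \<gamma>\<^bsup>-l\<^sub>2\<^esup>\<close> and \<open>\<phi>(\<beta>) = \<alpha>\<^sup>b \<beta>\<^sup>d \<gamma>\<^bsup>l\<^sub>1\<^esup>\<close>; the last two entries are
the coordinates \<open>w\<close> of these products.\<close>

definition osc_int :: "nat \<Rightarrow> int \<Rightarrow> int \<Rightarrow> int \<Rightarrow> int \<Rightarrow> int \<times> int \<Rightarrow> ((int \<times> int \<times> int) \<times> int) monoid" where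
  "osc_int r a b c d l = mapping_torus (heis_int r)
     (heis_aff r a b c d 1 (int r * a * c - 2 * snd l) (int r * b * d + 2 * fst l))"

lemma auto_transport:
  assumes H: "group H" and \<iota>: "\<iota> \<in> iso H K" and g: "g \<in> auto K"
  obtains f where "f \<in> auto H" "\<And>h. h \<in> carrier H \<Longrightarrow> \<iota> (f h) = g (\<iota> h)"
proof
  let ?j = "inv_into (carrier H) \<iota>"
  let ?f = "\<lambda>h\<in>carrier H. ?j (g (\<iota> h))"
  have j: "?j \<in> iso K H" by (rule group.iso_set_sym[OF H \<iota>])
  have g': "g \<in> iso K K" using g by (simp add: auto_def Bij_def iso_def)
  have "?j \<circ> (g \<circ> \<iota>) \<in> iso H H"
    by (rule iso_set_trans[OF iso_set_trans[OF \<iota> g'] j])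
  then have "?f \<in> iso H H" by (rule group.iso_eq[OF H]) simp
  then show "?f \<in> auto H" by (simp add: auto_def Bij_def iso_def)
  show "\<iota> (?f h) = g (\<iota> h)" if h: "h \<in> carrier H" for h
  proof -
    have "g (\<iota> h) \<in> carrier K" using \<iota> g' h by (auto simp: iso_def hom_def)
    then have "g (\<iota> h) \<in> \<iota> ` carrier H" using \<iota> by (simp add: iso_iff)
    then show ?thesis using h by (simp add: f_inv_into_f)
  qed
qed

lemma osc_aut_heis_int:
  fixes r :: nat and B :: "int^2^2" and l :: "int \<times> int"
  defines "g \<equiv> heis_aff r (B $ 1 $ 1) (B $ 1 $ 2) (B $ 2 $ 1) (B $ 2 $ 2) 1
    (int r * B $ 1 $ 1 * B $ 2 $ 1 - 2 * snd l) (int r * B $ 1 $ 2 * B $ 2 $ 2 + 2 * fst l)"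
  assumes det: "B $ 1 $ 1 * B $ 2 $ 2 - B $ 1 $ 2 * B $ 2 $ 1 = 1"
  obtains \<iota> where "\<iota> \<in> iso (heis r) (heis_int r)" "osc_aut r B l \<in> auto (heis r)"
    "\<And>h. h \<in> carrier (heis r) \<Longrightarrow> \<iota> (osc_aut r B l h) = g (\<iota> h)"
proof -
  let ?H = "heis r" and ?M = "heis_int r"
  interpret H: group ?H by (rule group_heis)
  interpret M: group ?M by (rule group_heis_int)
  obtain \<iota> where \<iota>: "\<iota> \<in> iso ?H ?M" and \<iota>g: "\<And>s. \<iota> (heis_elem r s) = heis_point s"
    using heis_iso_heis_int[of r] by metis
  have g: "g \<in> auto ?M" unfolding g_def using det by (auto intro!: heis_aff_auto)
  obtain f where f: "f \<in> auto ?H" and fg: "\<And>h. h \<in> carrier ?H \<Longrightarrow> \<iota> (f h) = g (\<iota> h)"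
    using auto_transport[OF H.is_group \<iota> g] by metis
  interpret \<iota>: group_hom ?H ?M \<iota> using \<iota> by unfold_locales (simp add: iso_def)
  have word: "\<iota> (heis_elem r Alpha [^]\<^bsub>?H\<^esub> i \<otimes>\<^bsub>?H\<^esub> heis_elem r Beta [^]\<^bsub>?H\<^esub> j \<otimes>\<^bsub>?H\<^esub> heis_elem r Gamma [^]\<^bsub>?H\<^esub> k)
      = (i, j, 2 * k + int r * i * j)" for i j k :: int
    by (simp add: \<iota>g heis_elem_closed \<iota>.hom_int_pow heis_int_pow mult.commute)
  have gp: "g (heis_point Alpha) = (B $ 1 $ 1, B $ 2 $ 1, 2 * (- snd l) + int r * B $ 1 $ 1 * B $ 2 $ 1)"
    "g (heis_point Beta) = (B $ 1 $ 2, B $ 2 $ 2, 2 * fst l + int r * B $ 1 $ 2 * B $ 2 $ 2)"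
    "g (heis_point Gamma) = heis_point Gamma"
    by (simp_all add: g_def heis_aff_apply)
  have inj: "u = v" if "\<iota> u = \<iota> v" "u \<in> carrier ?H" "v \<in> carrier ?H" for u v
    using \<iota> that by (meson iso_iff inj_onD)
  let ?P = "\<lambda>f. f \<in> auto ?H
      \<and> f (heis_elem r Alpha) = heis_elem r Alpha [^]\<^bsub>?H\<^esub> (B $ 1 $ 1) \<otimes>\<^bsub>?H\<^esub> heis_elem r Beta [^]\<^bsub>?H\<^esub> (B $ 2 $ 1) \<otimes>\<^bsub>?H\<^esub> heis_elem r Gamma [^]\<^bsub>?H\<^esub> (- snd l)
      \<and> f (heis_elem r Beta) = heis_elem r Alpha [^]\<^bsub>?H\<^esub> (B $ 1 $ 2) \<otimes>\<^bsub>?H\<^esub> heis_elem r Beta [^]\<^bsub>?H\<^esub> (B $ 2 $ 2) \<otimes>\<^bsub>?H\<^esub> heis_elem r Gamma [^]\<^bsub>?H\<^esub> (fst l)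
      \<and> f (heis_elem r Gamma) = heis_elem r Gamma"
  have fP: "?P f"
  proof (intro conjI f)
  qed (rule inj; simp add: fg \<iota>g heis_elem_closed auto_closed[OF f] gp word del: \<iota>.hom_mult heis_point.simps)+
  have "osc_aut r B l = f"
    unfolding osc_aut_def Let_def
  proof (rule the_equality)
    show "?P f" by (rule fP)
  next
    fix f' assume f': "?P f'"
    have "f' (heis_elem r s) = f (heis_elem r s)" for s
      using f' fP by (cases s) simp_all
    then have "f' h = f h" if "h \<in> carrier ?H" for h
      using heis_hom_unique[OF H.is_group _ _ _ that] auto_homD f f' by blast
    moreover have "f \<in> extensional (carrier ?H)" "f' \<in> extensional (carrier ?H)"
      using f f' by (simp_all add: auto_def Bij_def)
    ultimately show "f' = f" by (metis extensionalityI)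
  qed
  then show thesis using that[OF \<iota>] f fg by simp
qed

lemma Osc_eq_mapping_torus: "Osc r B l = mapping_torus (heis r) (osc_aut r B l)"
  by (simp add: Osc_def mapping_torus_def)

lemma Osc_iso_osc_int:
  fixes B :: "int^2^2"
  assumes det: "B $ 1 $ 1 * B $ 2 $ 2 - B $ 1 $ 2 * B $ 2 $ 1 = 1"
  shows "group (Osc r B l)"
    and "Osc r B l \<cong> osc_int r (B $ 1 $ 1) (B $ 1 $ 2) (B $ 2 $ 1) (B $ 2 $ 2) l"
proof -
  let ?g = "heis_aff r (B $ 1 $ 1) (B $ 1 $ 2) (B $ 2 $ 1) (B $ 2 $ 2) 1
    (int r * B $ 1 $ 1 * B $ 2 $ 1 - 2 * snd l) (int r * B $ 1 $ 2 * B $ 2 $ 2 + 2 * fst l)"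
  obtain \<iota> where \<iota>: "\<iota> \<in> iso (heis r) (heis_int r)" and f: "osc_aut r B l \<in> auto (heis r)"
    and rel: "\<And>h. h \<in> carrier (heis r) \<Longrightarrow> \<iota> (osc_aut r B l h) = ?g (\<iota> h)"
    using osc_aut_heis_int[OF det, of r l] by blast
  show "group (Osc r B l)"
    unfolding Osc_eq_mapping_torus by (rule group_mapping_torus[OF group_heis f])
  interpret M: group "heis_int r" by (rule group_heis_int)
  have g: "?g \<in> auto (heis_int r)" using det by (auto intro!: heis_aff_auto)
  have \<iota>cl: "\<iota> h \<in> carrier (heis_int r)" if "h \<in> carrier (heis r)" for h
    using \<iota> that by (auto simp: iso_def hom_def)
  show "Osc r B l \<cong> osc_int r (B $ 1 $ 1) (B $ 1 $ 2) (B $ 2 $ 1) (B $ 2 $ 2) l"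
    unfolding Osc_eq_mapping_torus osc_int_def
    by (rule mapping_torus_iso[OF group_heis group_heis_int f g \<iota> M.one_closed])
      (simp add: rel M.r_one M.l_one \<iota>cl auto_closed[OF g] del: heis_int_simps)
qed

section \<open>The action on the quotient by the centre\<close>

lemma group_int_plane: "group int_plane"
proof (rule groupI)
  fix x assume "x \<in> carrier int_plane"
  show "\<exists>y\<in>carrier int_plane. y \<otimes>\<^bsub>int_plane\<^esub> x = \<one>\<^bsub>int_plane\<^esub>"
    by (rule bexI[of _ "- x"]) (simp_all add: int_plane_def)
qed (simp_all add: int_plane_def)

definition plane_point :: "int \<times> int \<times> int \<Rightarrow> int^2" where
  "plane_point p = vector [fst p, fst (snd p)]"

lemma vec2_eq_iff: "(u :: 'a^2) = v \<longleftrightarrow> u $ 1 = v $ 1 \<and> u $ 2 = v $ 2"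
  by (simp add: vec_eq_iff forall_2)

lemma matrix_vector_2: "(A *v x) $ i = A $ i $ 1 * x $ 1 + A $ i $ 2 * x $ (2 :: 2)"
  by (simp add: matrix_vector_mult_def sum_2)

lemma plane_point_hom: "plane_point \<in> hom (heis_int r) int_plane"
  by (rule homI) (simp_all add: int_plane_def plane_point_def vec2_eq_iff heis_int_proj)

lemma center_heis_int:
  assumes "1 \<le> r"
  shows "(x, y, w) \<in> center (heis_int r) \<longleftrightarrow> even w \<and> x = 0 \<and> y = 0"
proof
  assume z: "(x, y, w) \<in> center (heis_int r)"
  then have "(x, y, w) \<otimes>\<^bsub>heis_int r\<^esub> (1, 0, 0) = (1, 0, 0) \<otimes>\<^bsub>heis_int r\<^esub> (x, y, w)"
    "(x, y, w) \<otimes>\<^bsub>heis_int r\<^esub> (0, 1, 0) = (0, 1, 0) \<otimes>\<^bsub>heis_int r\<^esub> (x, y, w)"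
    unfolding center_def by (auto simp del: heis_int_simps(2))
  then have "x = 0" "y = 0" using assms by auto
  with z show "even w \<and> x = 0 \<and> y = 0" by (simp add: center_def)
qed (auto simp: center_def)

lemma center_iso:
  assumes H: "group H" and \<iota>: "\<iota> \<in> iso H K" and h: "h \<in> carrier H"
  shows "h \<in> center H \<longleftrightarrow> \<iota> h \<in> center K"
proof -
  have mul: "\<iota> (u \<otimes>\<^bsub>H\<^esub> v) = \<iota> u \<otimes>\<^bsub>K\<^esub> \<iota> v" if "u \<in> carrier H" "v \<in> carrier H" for u v
    using \<iota> that by (simp add: iso_def hom_def)
  have surj: "\<iota> ` carrier H = carrier K" and inj: "inj_on \<iota> (carrier H)" using \<iota> by (simp_all add: iso_iff)
  show ?thesis
  proof
    assume "h \<in> center H"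
    then show "\<iota> h \<in> center K"
      using h by (auto simp: center_def simp flip: surj mul)
  next
    assume z: "\<iota> h \<in> center K"
    show "h \<in> center H"
      unfolding center_def
    proof (intro CollectI conjI ballI h)
      fix u assume u: "u \<in> carrier H"
      have "\<iota> h \<otimes>\<^bsub>K\<^esub> \<iota> u = \<iota> u \<otimes>\<^bsub>K\<^esub> \<iota> h"
        using z u surj by (auto simp: center_def)
      then have "\<iota> (h \<otimes>\<^bsub>H\<^esub> u) = \<iota> (u \<otimes>\<^bsub>H\<^esub> h)" using h u by (simp add: mul)
      moreover have "h \<otimes>\<^bsub>H\<^esub> u \<in> carrier H" "u \<otimes>\<^bsub>H\<^esub> h \<in> carrier H"
        using monoid.m_closed[OF group.is_monoid[OF H]] h u by simp_all
      ultimately show "h \<otimes>\<^bsub>H\<^esub> u = u \<otimes>\<^bsub>H\<^esub> h" using inj by (meson inj_onD)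
    qed
  qed
qed


lemma auto_image_center:
  assumes H: "group H" and f: "f \<in> auto H"
  shows "f ` center H = center H"
proof -
  have f': "f \<in> iso H H" using f by (simp add: auto_def Bij_def iso_def)
  show ?thesis
  proof
    show "f ` center H \<subseteq> center H"
      using center_iso[OF H f'] by (auto simp: center_def)
    show "center H \<subseteq> f ` center H"
    proof
      fix z assume z: "z \<in> center H"
      then have "z \<in> f ` carrier H" using f' by (simp add: iso_iff center_def)
      then obtain h where "h \<in> carrier H" "z = f h" by blast
      then show "z \<in> f ` center H" using z center_iso[OF H f'] by blast
    qed
  qed
qed

lemma center_subset: "center H \<subseteq> carrier H"
  by (auto simp: center_def)

lemma auto_image_coset:
  assumes H: "group H" and f: "f \<in> auto H" and h: "h \<in> carrier H"
  shows "f ` (center H #>\<^bsub>H\<^esub> h) = center H #>\<^bsub>H\<^esub> f h"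
proof -
  have "f ` (center H #>\<^bsub>H\<^esub> h) = (\<lambda>z. f z \<otimes>\<^bsub>H\<^esub> f h) ` center H"
    using hom_mult[OF auto_homD[OF f] _ h] center_subset[of H]
    by (force simp: r_coset_def image_iff)
  also have "\<dots> = (f ` center H) #>\<^bsub>H\<^esub> f h" by (auto simp: r_coset_def)
  finally show ?thesis by (simp add: auto_image_center[OF H f])
qed

lemma center_eq_kernel:
  assumes H: "group H" and r: "1 \<le> r" and \<iota>: "\<iota> \<in> iso H (heis_int r)"
  shows "center H = kernel H int_plane (\<lambda>h. plane_point (\<iota> h))"
proof -
  have "h \<in> center H \<longleftrightarrow> plane_point (\<iota> h) = 0" if h: "h \<in> carrier H" for h
  proof -
    obtain x y w where xyw: "\<iota> h = (x, y, w)" by (metis prod.exhaust)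
    have "\<iota> h \<in> carrier (heis_int r)" using \<iota> h by (auto simp: iso_def hom_def)
    then show ?thesis
      unfolding center_iso[OF H \<iota> h] xyw center_heis_int[OF r]
      by (auto simp: plane_point_def vec2_eq_iff)
  qed
  then show ?thesis using center_subset[of H] by (auto simp: kernel_def int_plane_def)
qed

text \<open>The centre is the kernel of the map to the plane, so the first isomorphism theorem identifies the quotient
with the plane.\<close>

lemma induces_matrixI:
  fixes B :: "int^2^2"
  assumes H: "group H" and r: "1 \<le> r" and \<iota>: "\<iota> \<in> iso H (heis_int r)"
    and rel: "\<And>h. h \<in> carrier H \<Longrightarrow> plane_point (\<iota> (f h)) = B *v plane_point (\<iota> h)"
  shows "induces_matrix H f B"
proof -
  let ?q = "\<lambda>h. plane_point (\<iota> h)"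
  have "plane_point \<circ> \<iota> \<in> hom H int_plane"
    using \<iota> plane_point_hom by (auto simp: iso_def intro: hom_compose)
  then have q: "?q \<in> hom H int_plane" by (simp add: comp_def)
  interpret q: group_hom H int_plane ?q
    using q H group_int_plane by (simp add: group_hom_def group_hom_axioms_def)
  have "?q ` carrier H = plane_point ` carrier (heis_int r)"
    using \<iota> by (simp add: iso_iff image_image[symmetric, of plane_point \<iota>])
  also have "\<dots> = UNIV"
  proof -
    have "v \<in> plane_point ` carrier (heis_int r)" for v :: "int^2"
      by (rule image_eqI[of _ _ "(v $ 1, v $ 2, int r * v $ 1 * v $ 2)"])
        (simp_all add: plane_point_def vec2_eq_iff)
    then show ?thesis by blast
  qed
  finally have "?q ` carrier H = carrier int_plane" by (simp add: int_plane_def)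
  from q.FactGroup_iso_set[OF this]
  have \<theta>: "(\<lambda>X. the_elem (?q ` X)) \<in> iso (H Mod center H) int_plane"
    by (simp add: center_eq_kernel[OF H r \<iota>])
  show ?thesis
    unfolding induces_matrix_def
  proof (intro bexI[OF _ \<theta>] ballI)
    fix C assume "C \<in> carrier (H Mod center H)"
    then obtain h where h: "h \<in> carrier H" and C: "C = center H #>\<^bsub>H\<^esub> h"
      by (auto simp: carrier_FactGroup)
    have Csub: "C \<subseteq> carrier H"
      unfolding C using group.is_monoid[OF H] h center_subset[of H]
      by (auto simp: r_coset_def intro: monoid.m_closed)
    have qC: "?q ` C = {?q h}"
      unfolding C center_eq_kernel[OF H r \<iota>] using h q.one_closed
      by (auto simp: kernel_def r_coset_def intro!: imageI)
    have "?q ` (f ` C) = (\<lambda>v. B *v v) ` ?q ` C"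
      unfolding image_image using Csub rel by (intro image_cong) auto
    then show "the_elem (?q ` f ` C) = B *v the_elem (?q ` C)" by (simp add: qC)
  qed
qed

text \<open>Composing an arbitrary identification of the quotient with the projection gives an invertible integer
matrix that intertwines the two actions, so they share determinant and trace.\<close>

lemma induces_matrixD:
  fixes B :: "int^2^2"
  assumes H: "group H" and r: "1 \<le> r" and \<iota>: "\<iota> \<in> iso H (heis_int r)" and f: "f \<in> auto H"
    and rel: "\<And>h. h \<in> carrier H \<Longrightarrow> \<iota> (f h) = heis_aff r a b c d e m n (\<iota> h)"
    and ind: "induces_matrix H f B" and det: "det B = 1"
  shows "a * d - b * c = 1" "a + d = trace B"
proof -
  interpret H: group H by (rule H)
  let ?N = "center H"
  obtain \<theta> where \<theta>: "\<theta> \<in> iso (H Mod ?N) int_plane"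
    and \<theta>B: "\<And>C. C \<in> carrier (H Mod ?N) \<Longrightarrow> \<theta> (f ` C) = B *v \<theta> C"
    using ind unfolding induces_matrix_def by blast
  have q: "(\<lambda>h. plane_point (\<iota> h)) \<in> hom H int_plane"
    using hom_compose[of \<iota> H "heis_int r" plane_point int_plane] \<iota> plane_point_hom
    by (simp add: iso_def comp_def)
  interpret q: group_hom H int_plane "\<lambda>h. plane_point (\<iota> h)"
    using q H group_int_plane by (simp add: group_hom_def group_hom_axioms_def)
  have normal: "?N \<lhd> H" using q.normal_kernel by (simp add: center_eq_kernel[OF H r \<iota>])
  let ?\<pi> = "\<lambda>h. ?N #>\<^bsub>H\<^esub> h"
  have \<pi>: "?\<pi> \<in> hom H (H Mod ?N)" by (rule normal.r_coset_hom_Mod[OF normal])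
  have \<pi>surj: "?\<pi> ` carrier H = carrier (H Mod ?N)" by (simp add: carrier_FactGroup)
  let ?j = "inv_into (carrier H) \<iota>"
  have j: "?j \<in> iso (heis_int r) H" by (rule H.iso_set_sym[OF \<iota>])
  define Q where "Q p = \<theta> (?\<pi> (?j p))" for p
  have Q: "Q \<in> hom (heis_int r) int_plane"
    using hom_compose[OF hom_compose[OF _ \<pi>], of ?j "heis_int r" \<theta> int_plane] j \<theta>
    by (simp add: iso_def comp_def Q_def[abs_def])
  have Qsurj: "Q ` carrier (heis_int r) = UNIV"
  proof -
    have "Q ` carrier (heis_int r) = \<theta> ` ?\<pi> ` ?j ` carrier (heis_int r)"
      by (simp add: image_image Q_def)
    also have "\<dots> = UNIV"
      using j \<theta> \<pi>surj by (simp add: iso_iff int_plane_def)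
    finally show ?thesis .
  qed
  have Qcomp: "(\<lambda>p. Q p $ i) \<in> hom (heis_int r) integer_group" for i
    by (rule homI) (use hom_mult[OF Q] in \<open>simp_all add: int_plane_def\<close>)
  define \<alpha> \<beta> where "\<alpha> = Q (1, 0, 0)" and "\<beta> = Q (0, 1, 0)"
  have Qlin: "Q (x, y, w) $ i = \<alpha> $ i * x + \<beta> $ i * y" if "(x, y, w) \<in> carrier (heis_int r)" for x y w i
    using heis_int_hom_integer[OF r Qcomp that] by (simp add: \<alpha>_def \<beta>_def)
  have \<iota>cl: "\<iota> h \<in> carrier (heis_int r)" if "h \<in> carrier H" for h
    using \<iota> that by (auto simp: iso_def hom_def)
  have Q\<iota>: "Q (\<iota> h) = \<theta> (?\<pi> h)" if "h \<in> carrier H" for h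
    using \<iota> that by (simp add: Q_def iso_iff)
  have QB: "Q (heis_aff r a b c d e m n p) = B *v Q p" if p: "p \<in> carrier (heis_int r)" for p
  proof -
    obtain h where h: "h \<in> carrier H" "p = \<iota> h" using p \<iota> by (metis imageE iso_iff)
    have fh: "f h \<in> carrier H" by (rule auto_closed[OF f h(1)])
    have "Q (heis_aff r a b c d e m n p) = \<theta> (?\<pi> (f h))"
      using rel[OF h(1)] Q\<iota>[OF fh] h(2) by simp
    also have "\<dots> = \<theta> (f ` ?\<pi> h)" by (simp add: auto_image_coset[OF H f h(1)])
    also have "\<dots> = B *v \<theta> (?\<pi> h)"
      using h \<pi>surj by (intro \<theta>B) blast
    finally show ?thesis by (simp add: h Q\<iota>)
  qed
  have af: "heis_aff r a b c d e m n (\<iota> h) \<in> carrier (heis_int r)" if "h \<in> carrier H" for h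
    using rel[OF that] \<iota>cl[OF auto_closed[OF f that]] by simp
  have af': "heis_aff r a b c d e m n p \<in> carrier (heis_int r)" if "p \<in> carrier (heis_int r)" for p
    using that af \<iota> by (metis imageE iso_iff)
  have 1: "heis_aff r a b c d e m n (1, 0, 0) = (a, c, m)" "heis_aff r a b c d e m n (0, 1, 0) = (b, d, n)"
    by (simp_all add: heis_aff_apply)
  have cl: "(a, c, m) \<in> carrier (heis_int r)" "(b, d, n) \<in> carrier (heis_int r)"
    using af'[of "(1, 0, 0)"] af'[of "(0, 1, 0)"] unfolding 1 by simp_all
  have e1: "\<alpha> $ i * a + \<beta> $ i * c = B $ i $ 1 * \<alpha> $ 1 + B $ i $ 2 * \<alpha> $ 2" for i
    using QB[of "(1, 0, 0)"] Qlin[OF cl(1), of i] unfolding 1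
    by (simp add: matrix_vector_2 flip: \<alpha>_def)
  have e2: "\<alpha> $ i * b + \<beta> $ i * d = B $ i $ 1 * \<beta> $ 1 + B $ i $ 2 * \<beta> $ 2" for i
    using QB[of "(0, 1, 0)"] Qlin[OF cl(2), of i] unfolding 1
    by (simp add: matrix_vector_2 flip: \<beta>_def)
  obtain p where p: "p \<in> carrier (heis_int r)" "Q p = vector [1, 0]" using Qsurj by (metis UNIV_I imageE)
  obtain p' where p': "p' \<in> carrier (heis_int r)" "Q p' = vector [0, 1]" using Qsurj by (metis UNIV_I imageE)
  obtain x y w x' y' w' where xy: "p = (x, y, w)" "p' = (x', y', w')" by (metis prod.exhaust)
  have s: "\<alpha> $ 1 * x + \<beta> $ 1 * y = 1" "\<alpha> $ 2 * x + \<beta> $ 2 * y = 0"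
    "\<alpha> $ 1 * x' + \<beta> $ 1 * y' = 0" "\<alpha> $ 2 * x' + \<beta> $ 2 * y' = 1"
    using Qlin[OF p(1)[unfolded xy], of 1] Qlin[OF p(1)[unfolded xy], of 2]
      Qlin[OF p'(1)[unfolded xy], of 1] Qlin[OF p'(1)[unfolded xy], of 2]
      p(2) p'(2) unfolding xy by simp_all
  define D where "D = \<alpha> $ 1 * \<beta> $ 2 - \<alpha> $ 2 * \<beta> $ 1"
  have "D * (x * y' - x' * y) = (\<alpha> $ 1 * x + \<beta> $ 1 * y) * (\<alpha> $ 2 * x' + \<beta> $ 2 * y')
      - (\<alpha> $ 2 * x + \<beta> $ 2 * y) * (\<alpha> $ 1 * x' + \<beta> $ 1 * y')"
    by (simp add: D_def algebra_simps)
  then have D: "D \<noteq> 0" using s by auto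
  have detB: "B $ 1 $ 1 * B $ 2 $ 2 - B $ 1 $ 2 * B $ 2 $ 1 = 1" using det by (simp add: det_2)
  have "D * (a * d - b * c) = (\<alpha> $ 1 * a + \<beta> $ 1 * c) * (\<alpha> $ 2 * b + \<beta> $ 2 * d)
      - (\<alpha> $ 2 * a + \<beta> $ 2 * c) * (\<alpha> $ 1 * b + \<beta> $ 1 * d)"
    by (simp add: D_def algebra_simps)
  also have "\<dots> = D * (B $ 1 $ 1 * B $ 2 $ 2 - B $ 1 $ 2 * B $ 2 $ 1)"
    unfolding e1 e2 by (simp add: D_def algebra_simps)
  finally show "a * d - b * c = 1" using D detB by simp
  have "D * (a + d) = \<beta> $ 2 * (\<alpha> $ 1 * a + \<beta> $ 1 * c) - \<beta> $ 1 * (\<alpha> $ 2 * a + \<beta> $ 2 * c)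
      + \<alpha> $ 1 * (\<alpha> $ 2 * b + \<beta> $ 2 * d) - \<alpha> $ 2 * (\<alpha> $ 1 * b + \<beta> $ 1 * d)"
    by (simp add: D_def algebra_simps)
  also have "\<dots> = D * (B $ 1 $ 1 + B $ 2 $ 2)"
    unfolding e1 e2 by (simp add: D_def algebra_simps)
  finally show "a + d = trace B" using D by (simp add: trace_def sum_2)
qed

section \<open>Discrete split oscillator groups in the integer model\<close>

text \<open>The fibre must be realized over the element type of the group itself, which is done by the copy of the
Heisenberg group inside the semidirect product.\<close>

lemma Osc_discrete_split:
  assumes r: "1 \<le> r" and det: "det B = 1" and tr: "trace B > 2"
  shows "discrete_split_oscillator_group (Osc r B l) (trace B)"
proof -
  have det': "B $ 1 $ 1 * B $ 2 $ 2 - B $ 1 $ 2 * B $ 2 $ 1 = 1" using det by (simp add: det_2)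
  interpret h: group "heis r" by (rule group_heis)
  obtain \<iota> where \<iota>: "\<iota> \<in> iso (heis r) (heis_int r)" and a: "osc_aut r B l \<in> auto (heis r)"
    and rel: "\<And>h. h \<in> carrier (heis r) \<Longrightarrow> \<iota> (osc_aut r B l h)
      = heis_aff r (B $ 1 $ 1) (B $ 1 $ 2) (B $ 2 $ 1) (B $ 2 $ 2) 1
          (int r * B $ 1 $ 1 * B $ 2 $ 1 - 2 * snd l) (int r * B $ 1 $ 2 * B $ 2 $ 2 + 2 * fst l) (\<iota> h)"
    using osc_aut_heis_int[OF det', of r l] by metis
  define H :: "(heis_gen gword set \<times> int) monoid" where
    "H = \<lparr>carrier = carrier (heis r) \<times> {0},
          monoid.mult = (\<lambda>(g, _) (h, _). (g \<otimes>\<^bsub>heis r\<^esub> h, 0)), one = (\<one>\<^bsub>heis r\<^esub>, 0)\<rparr>"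
  have H: "group H"
  proof (rule groupI)
    fix x assume "x \<in> carrier H"
    then show "\<exists>y\<in>carrier H. y \<otimes>\<^bsub>H\<^esub> x = \<one>\<^bsub>H\<^esub>"
      by (intro bexI[of _ "(inv\<^bsub>heis r\<^esub> fst x, 0)"]) (auto simp: H_def)
  next
    fix x y z assume "x \<in> carrier H" "y \<in> carrier H" "z \<in> carrier H"
    then show "x \<otimes>\<^bsub>H\<^esub> y \<otimes>\<^bsub>H\<^esub> z = x \<otimes>\<^bsub>H\<^esub> (y \<otimes>\<^bsub>H\<^esub> z)"
      unfolding H_def by (clarsimp simp: h.m_assoc)
  qed (unfold H_def, clarsimp+)
  have fst_iso: "fst \<in> iso H (heis r)"
    by (auto simp: iso_iff H_def hom_def inj_on_def)
  obtain f where f: "f \<in> auto H" and ff: "\<And>h. h \<in> carrier H \<Longrightarrow> fst (f h) = osc_aut r B l (fst h)"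
    using auto_transport[OF H fst_iso a] by metis
  have fstcl: "fst h \<in> carrier (heis r)" if "h \<in> carrier H" for h
    using that by (auto simp: H_def)
  have "induces_matrix H f B"
  proof (rule induces_matrixI[OF H r iso_set_trans[OF fst_iso \<iota>]])
    fix h assume h: "h \<in> carrier H"
    obtain x y w where xyw: "\<iota> (fst h) = (x, y, w)" by (metis prod.exhaust)
    have "(x, y, w) \<in> carrier (heis_int r)"
      using \<iota> fstcl[OF h] xyw by (metis iso_imp_homomorphism hom_in_carrier)
    then show "plane_point ((\<iota> \<circ> fst) (f h)) = B *v plane_point ((\<iota> \<circ> fst) h)"
      using rel[OF fstcl[OF h]]
      by (simp add: ff[OF h] xyw heis_aff_apply plane_point_def vec2_eq_iff matrix_vector_2)
  qed
  moreover have "mapping_torus H f \<cong> Osc r B l"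
    unfolding Osc_eq_mapping_torus
    by (rule mapping_torus_iso[OF H h.is_group f a fst_iso h.one_closed])
      (simp add: ff fstcl auto_closed[OF a])
  then have "Osc r B l \<cong> mapping_torus H f"
    by (rule group.iso_sym[OF group_mapping_torus[OF H f]])
  moreover have "f [^]\<^bsub>AutoGroup H\<^esub> (1::int) = f"
    using group.int_pow_1[OF group.AutoGroup[OF H]] f by (simp add: carrier_AutoGroup)
  ultimately show ?thesis
    unfolding discrete_split_oscillator_group_def
    using Osc_iso_osc_int(1)[OF det', of r l] H r fst_iso power_action_hom[OF H f] det tr
    by (intro conjI exI[of _ H] exI[of _ r] exI[of _ "\<lambda>k. f [^]\<^bsub>AutoGroup H\<^esub> k"] exI[of _ B])
      (auto simp: mapping_torus_def intro: is_isoI)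
qed

lemma discrete_split_model:
  assumes "discrete_split_oscillator_group G T"
  obtains r a b c d k l where "1 \<le> r" "a * d - b * c = 1" "a + d = T" "2 < T"
    "even (k - int r * a * c)" "even (l - int r * b * d)"
    "G \<cong> mapping_torus (heis_int r) (heis_aff r a b c d 1 k l)"
proof -
  obtain H :: "'a monoid" and r \<phi> B where H: "group H" and r: "1 \<le> r" and Hr: "H \<cong> heis r"
    and \<phi>: "\<phi> \<in> hom integer_group (AutoGroup H)" and ind: "induces_matrix H (\<phi> 1) B"
    and B: "det B = 1" "trace B > 2" "trace B = T" and G: "G \<cong> semidirect H integer_group \<phi>"
    using assms unfolding discrete_split_oscillator_group_def by blast
  obtain \<kappa> where "\<kappa> \<in> iso H (heis r)" using Hr by (auto simp: is_iso_def)
  moreover obtain \<iota>' where "\<iota>' \<in> iso (heis r) (heis_int r)" using heis_iso_heis_int[of r] by metis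
  ultimately obtain \<iota> where \<iota>: "\<iota> \<in> iso H (heis_int r)" using iso_set_trans by blast
  define f where "f = \<phi> 1"
  have f: "f \<in> auto H" using \<phi> by (auto simp: f_def hom_def carrier_AutoGroup)
  let ?j = "inv_into (carrier H) \<iota>"
  have j: "?j \<in> iso (heis_int r) H" by (rule group.iso_set_sym[OF H \<iota>])
  obtain g where g: "g \<in> auto (heis_int r)" and gf: "\<And>p. p \<in> carrier (heis_int r) \<Longrightarrow> ?j (g p) = f (?j p)"
    using auto_transport[OF group_heis_int j f] by metis
  have \<iota>cl: "\<iota> h \<in> carrier (heis_int r)" if "h \<in> carrier H" for h
    using \<iota> that by (auto simp: iso_def hom_def)
  have rel: "\<iota> (f h) = g (\<iota> h)" if h: "h \<in> carrier H" for h
  proof -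
    have "f h = ?j (g (\<iota> h))" using gf[OF \<iota>cl[OF h]] \<iota> h by (simp add: iso_iff)
    moreover have "g (\<iota> h) \<in> \<iota> ` carrier H" using auto_closed[OF g \<iota>cl[OF h]] \<iota> by (simp add: iso_iff)
    ultimately show ?thesis by (simp add: f_inv_into_f)
  qed
  obtain a b c d e k l where ge: "g = heis_aff r a b c d e k l"
    and e: "a * d - b * c = e" and par: "even (k - int r * a * c)" "even (l - int r * b * d)"
    using auto_heis_int[OF r g] by metis
  have S: "a * d - b * c = 1" "a + d = trace B"
    using induces_matrixD[OF H r \<iota> f _ ind[folded f_def] B(1), of a b c d e k l] rel
    unfolding ge by blast+
  interpret M: group "heis_int r" by (rule group_heis_int)
  have "G \<cong> mapping_torus H f"
    using G semidirect_integer_eq_mapping_torus[OF H \<phi>] by (simp add: f_def)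
  also have "mapping_torus H f \<cong> mapping_torus (heis_int r) g"
    by (rule mapping_torus_iso[OF H group_heis_int f g \<iota> M.one_closed])
      (simp add: rel \<iota>cl auto_closed[OF g] M.r_one M.l_one del: heis_int_simps)
  finally have "G \<cong> mapping_torus (heis_int r) (heis_aff r a b c d 1 k l)"
    using e S(1) by (simp add: ge)
  then show thesis using that r S par B by auto
qed

text \<open>That the transported row satisfies the parity condition needs no computation: the conjugate of an
automorphism is an automorphism, hence affine of the admissible kind.\<close>

lemma torus_conjugate:
  assumes r: "1 \<le> r"
    and B: "a * d - b * c = 1" "even (k - int r * a * c)" "even (l - int r * b * d)"
    and S: "e = 1 \<or> e = -1" "p * t - q * s = e"
    and conj: "p * a + q * c = a' * p + b' * s" "p * b + q * d = a' * q + b' * t"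
      "s * a + t * c = c' * p + d' * s" "s * b + t * d = c' * q + d' * t"
  obtains k' l' where "even (k' - int r * a' * c')" "even (l' - int r * b' * d')"
    "mapping_torus (heis_int r) (heis_aff r a b c d 1 k l)
      \<cong> mapping_torus (heis_int r) (heis_aff r a' b' c' d' 1 k' l')"
proof -
  let ?M = "heis_int r"
  let ?f = "heis_aff r a b c d 1 k l" and ?F = "heis_aff r p q s t e (int r * p * s) (int r * q * t)"
  interpret M: group ?M by (rule group_heis_int)
  have f: "?f \<in> auto ?M" by (rule heis_aff_auto[OF disjI1[OF HOL.refl] B])
  have F: "?F \<in> auto ?M" by (rule heis_aff_auto[OF S]) simp_all
  have Fiso: "?F \<in> iso ?M ?M" using F by (simp add: auto_def Bij_def iso_def)
  let ?j = "inv_into (carrier ?M) ?F"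
  have j: "?j \<in> iso ?M ?M" by (rule M.iso_set_sym[OF Fiso])
  obtain g where g: "g \<in> auto ?M" and gf: "\<And>h. h \<in> carrier ?M \<Longrightarrow> ?j (g h) = ?f (?j h)"
    using auto_transport[OF M.is_group j f] by metis
  have rel: "?F (?f h) = g (?F h)" if h: "h \<in> carrier ?M" for h
  proof -
    have "?f h = ?j (g (?F h))"
      using gf[OF auto_closed[OF F h]] Fiso h by (simp add: iso_iff del: heis_int_simps)
    moreover have "g (?F h) \<in> ?F ` carrier ?M"
      using auto_closed[OF g auto_closed[OF F h]] Fiso by (simp add: iso_iff del: heis_int_simps)
    ultimately show ?thesis by (simp add: f_inv_into_f)
  qed
  obtain a1 b1 c1 d1 e1 k1 l1 where ge: "g = heis_aff r a1 b1 c1 d1 e1 k1 l1"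
    and par: "even (k1 - int r * a1 * c1)" "even (l1 - int r * b1 * d1)"
    using auto_heis_int[OF r g] by metis
  have fx: "?f (1, 0, 0) = (a, c, k)" "?f (0, 1, 0) = (b, d, l)" "?f (0, 0, 2) = (0, 0, 2)"
    and Fx: "?F (1, 0, 0) = (p, s, int r * p * s)" "?F (0, 1, 0) = (q, t, int r * q * t)" "?F (0, 0, 2) = (0, 0, 2 * e)"
    by (simp_all add: heis_aff_apply)
  have m: "(a, c, k) \<in> carrier ?M" "(b, d, l) \<in> carrier ?M" using B by simp_all
  have "e1 * (2 * e) = 2 * e"
    using rel[of "(0, 0, 2)"] unfolding fx Fx ge by (simp add: heis_aff_apply)
  then have e1: "e1 = 1" using S(1) by auto
  have 1: "p * a + q * c = a1 * p + b1 * s" "s * a + t * c = c1 * p + d1 * s"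
    using rel[of "(1, 0, 0)"] unfolding fx Fx ge heis_aff_apply[OF m(1)] by (simp_all add: heis_aff_apply)
  have 2: "p * b + q * d = a1 * q + b1 * t" "s * b + t * d = c1 * q + d1 * t"
    using rel[of "(0, 1, 0)"] unfolding fx Fx ge heis_aff_apply[OF m(2)] by (simp_all add: heis_aff_apply)
  have cancel: "x = x' \<and> y = y'" if "x * p + y * s = x' * p + y' * s" "x * q + y * t = x' * q + y' * t"
    for x y x' y' :: int
  proof -
    have "(x - x') * (p * t - q * s) = t * ((x * p + y * s) - (x' * p + y' * s)) - s * ((x * q + y * t) - (x' * q + y' * t))"
      "(y - y') * (p * t - q * s) = p * ((x * q + y * t) - (x' * q + y' * t)) - q * ((x * p + y * s) - (x' * p + y' * s))"
      by (simp_all add: algebra_simps)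
    then have "(x - x') * e = 0" "(y - y') * e = 0" unfolding that S(2) by simp_all
    then show ?thesis using S(1) by auto
  qed
  have eq: "a1 = a' \<and> b1 = b'" "c1 = c' \<and> d1 = d'"
    using cancel[of a1 b1 a' b'] cancel[of c1 d1 c' d'] 1 2 conj by simp_all
  have "mapping_torus ?M ?f \<cong> mapping_torus ?M g"
    by (rule mapping_torus_iso[OF M.is_group M.is_group f g Fiso M.one_closed])
      (simp add: rel auto_closed[OF F] auto_closed[OF g] M.r_one M.l_one del: heis_int_simps)
  then show thesis using that[of k1 l1] par eq unfolding ge e1 by simp
qed

text \<open>The case \<open>S = 1\<close>: changing \<open>l\<close> by multiples of \<open>r\<close> and along the row lattice of \<open>B - 1\<close> does not affect the
group.\<close>

lemma osc_int_shift:
  assumes "a * d - b * c = 1"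
    and l2: "l2' = l2 - u * (a - 1) - v * c + int r * X" and l1: "l1' = l1 + u * b + v * (d - 1) + int r * Y"
  shows "osc_int r a b c d (l1, l2) \<cong> osc_int r a b c d (l1', l2')"
  unfolding osc_int_def
  by (rule torus_iso_sufficient[of a d b c _ r _ a d b c _ _ 1 1 1 0 0 "2 * u" "2 * v" X "-Y"])
    (use assms(1) in \<open>simp_all add: l1 l2 algebra_simps\<close>)

text \<open>The case \<open>S = -1\<close>.\<close>

lemma osc_int_neg:
  assumes "a * d - b * c = 1"
  shows "osc_int r a b c d (l1, l2) \<cong> osc_int r a b c d (- l1 - int r * b * d, int r * a * c - l2)"
  unfolding osc_int_def
  by (rule torus_iso_sufficient[of a d b c _ r _ a d b c _ _ 1 "-1" "-1" 0 0 0 0 0 0])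
    (use assms(1) in \<open>simp_all add: algebra_simps\<close>)

text \<open>Here \<open>S = (2, 1; 1, 0)\<close> is a square root of \<open>B\<close> of determinant \<open>-1\<close>; modulo 2 it interchanges the
coordinates.\<close>

lemma osc_int_swap:
  "osc_int r 5 2 2 1 (l1, l2) \<cong> osc_int r 5 2 2 1 (l2 + 2 * l1 - 4 * int r, 6 * int r + l1)"
  unfolding osc_int_def
  by (rule torus_iso_sufficient[of 5 1 2 2 _ r _ 5 1 2 2 _ _ "-1" 2 0 1 1 0 0 0 0])
    (simp_all add: algebra_simps)

text \<open>Here \<open>S = (1, 1; 1, 0)\<close>, the matrix of multiplication by the golden ratio, is a fourth root of \<open>B\<close>.\<close>

lemma osc_int_golden:
  "osc_int r 5 3 3 2 (l1, l2) \<cong> osc_int r 5 3 3 2 (l1 + l2 - 7 * int r, l1 + 9 * int r)"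
  unfolding osc_int_def
  by (rule torus_iso_sufficient[of 5 2 3 3 _ r _ 5 2 3 3 _ _ "-1" 1 0 1 1 "int r" 0 0 0])
    (simp_all add: algebra_simps)

section \<open>Reduction of hyperbolic matrices of small trace\<close>

text \<open>Conjugacy of \<open>(a, b; c, d)\<close> and \<open>(a', b'; c', d')\<close> under \<open>GL(2, \<int>)\<close>, written without inverses.\<close>

definition gl2_conj :: "int \<Rightarrow> int \<Rightarrow> int \<Rightarrow> int \<Rightarrow> int \<Rightarrow> int \<Rightarrow> int \<Rightarrow> int \<Rightarrow> bool" where
  "gl2_conj a b c d a' b' c' d' \<longleftrightarrow>
    (\<exists>p q s t. (p * t - q * s = 1 \<or> p * t - q * s = -1) \<and>
      p * a + q * c = a' * p + b' * s \<and> p * b + q * d = a' * q + b' * t \<and>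
      s * a + t * c = c' * p + d' * s \<and> s * b + t * d = c' * q + d' * t)"

lemma gl2_conj_trans:
  assumes "gl2_conj a b c d a' b' c' d'" "gl2_conj a' b' c' d' a'' b'' c'' d''"
  shows "gl2_conj a b c d a'' b'' c'' d''"
proof -
  obtain p q s t where 1: "p * t - q * s = 1 \<or> p * t - q * s = -1"
      "p * a + q * c = a' * p + b' * s" "p * b + q * d = a' * q + b' * t"
      "s * a + t * c = c' * p + d' * s" "s * b + t * d = c' * q + d' * t"
    using assms(1) unfolding gl2_conj_def by blast
  obtain x y z w where 2: "x * w - y * z = 1 \<or> x * w - y * z = -1"
      "x * a' + y * c' = a'' * x + b'' * z" "x * b' + y * d' = a'' * y + b'' * w"
      "z * a' + w * c' = c'' * x + d'' * z" "z * b' + w * d' = c'' * y + d'' * w"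
    using assms(2) unfolding gl2_conj_def by blast
  have det: "(x * p + y * s) * (z * q + w * t) - (x * q + y * t) * (z * p + w * s)
      = (x * w - y * z) * (p * t - q * s)"
    by (simp add: algebra_simps)
  have left: "(x * p + y * s) * u + (x * q + y * t) * v = x * (p * u + q * v) + y * (s * u + t * v)" for u v x y
    by (simp add: algebra_simps)
  have mid: "x * (a' * u + b' * v) + y * (c' * u + d' * v) = (x * a' + y * c') * u + (x * b' + y * d') * v" for x y u v
    by (simp add: algebra_simps)
  show ?thesis
    unfolding gl2_conj_def
  proof (intro exI conjI)
    show "(x * p + y * s) * (z * q + w * t) - (x * q + y * t) * (z * p + w * s) = 1 \<or>
      (x * p + y * s) * (z * q + w * t) - (x * q + y * t) * (z * p + w * s) = -1"
      unfolding det using 1(1) 2(1) by auto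
  qed (unfold left 1 mid 2, simp_all add: algebra_simps)
qed

lemma gl2_conj_shear: "gl2_conj a b c d (a + n * c) (b + n * (d - a) - n * n * c) c (d - n * c)"
  unfolding gl2_conj_def by (rule exI[of _ 1], rule exI[of _ n], rule exI[of _ 0], rule exI[of _ 1])
    (simp add: algebra_simps)

lemma gl2_conj_swap: "gl2_conj a b c d d c b a"
  unfolding gl2_conj_def by (rule exI[of _ 0], rule exI[of _ 1], rule exI[of _ 1], rule exI[of _ 0]) simp

lemma gl2_conj_neg: "gl2_conj a b c d a (-b) (-c) d"
  unfolding gl2_conj_def by (rule exI[of _ 1], rule exI[of _ 0], rule exI[of _ 0], rule exI[of _ "-1"]) simp

text \<open>This is Gauss reduction of the binary form \<open>c x\<^sup>2 + (d - a) x y - b y\<^sup>2\<close> attached to the matrix. A shear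
changes \<open>a - d\<close> by a multiple of \<open>2 c\<close>; if afterwards the upper right entry is smaller than \<open>c\<close> in absolute value, a swap
makes progress.\<close>

lemma gl2_conj_reduced:
  fixes a b c d :: int
  assumes "a * d - b * c = 1" "a + d > 2"
  obtains a' b' c' d' where "gl2_conj a b c d a' b' c' d'" "a' * d' - b' * c' = 1" "a' + d' = a + d"
    "c' > 0" "\<bar>a' - d'\<bar> \<le> c'" "c' \<le> \<bar>b'\<bar>"
proof -
  have "\<exists>a' b' c' d'. gl2_conj a b c d a' b' c' d' \<and> a' * d' - b' * c' = 1 \<and> a' + d' = a + d \<and>
      c' > 0 \<and> \<bar>a' - d'\<bar> \<le> c' \<and> c' \<le> \<bar>b'\<bar>"
    using assms
  proof (induction "nat \<bar>c\<bar>" arbitrary: a b c d rule: less_induct)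
    case less
    have "c \<noteq> 0"
    proof
      assume "c = 0"
      then have "a * d = 1" using less.prems by simp
      then have "a = 1 \<and> d = 1 \<or> a = -1 \<and> d = -1" by (simp add: zmult_eq_1_iff)
      then show False using less.prems by auto
    qed
    define b1 c1 where "b1 = (if c > 0 then b else -b)" and "c1 = \<bar>c\<bar>"
    have C1: "gl2_conj a b c d a b1 c1 d"
      using gl2_conj_neg[of a b c d] gl2_conj_shear[of a b c d 0] \<open>c \<noteq> 0\<close> by (auto simp: b1_def c1_def)
    have c1: "c1 > 0" and det1: "a * d - b1 * c1 = 1"
      using \<open>c \<noteq> 0\<close> less.prems by (auto simp: b1_def c1_def)
    define n where "n = - ((a - d + c1) div (2 * c1))"
    define a2 b2 d2 where "a2 = a + n * c1" and "b2 = b1 + n * (d - a) - n * n * c1" and "d2 = d - n * c1"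
    have C2: "gl2_conj a b c d a2 b2 c1 d2"
      using gl2_conj_trans[OF C1 gl2_conj_shear[of a b1 c1 d n]] by (simp add: a2_def b2_def d2_def)
    have "a2 - d2 + c1 = (a - d + c1) mod (2 * c1)"
      unfolding a2_def d2_def n_def minus_div_mult_eq_mod[symmetric] by (simp add: algebra_simps)
    then have small: "\<bar>a2 - d2\<bar> \<le> c1"
      using pos_mod_bound[of "2 * c1" "a - d + c1"] pos_mod_sign[of "2 * c1" "a - d + c1"] c1 by linarith
    have det2: "a2 * d2 - b2 * c1 = 1" and tr2: "a2 + d2 = a + d"
      using det1 by (simp_all add: a2_def b2_def d2_def algebra_simps)
    show ?case
    proof (cases "c1 \<le> \<bar>b2\<bar>")
      case True
      then show ?thesis using C2 det2 tr2 c1 small by blast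
    next
      case False
      then have "nat \<bar>b2\<bar> < nat \<bar>c\<bar>" using c1 by (simp add: c1_def)
      moreover have "d2 * a2 - c1 * b2 = 1" "d2 + a2 > 2" using det2 tr2 less.prems by (simp_all add: algebra_simps)
      ultimately obtain a' b' c' d' where "gl2_conj d2 c1 b2 a2 a' b' c' d'" "a' * d' - b' * c' = 1" "a' + d' = d2 + a2"
        "c' > 0" "\<bar>a' - d'\<bar> \<le> c'" "c' \<le> \<bar>b'\<bar>"
        using less.hyps[of b2 d2 a2 c1] by blast
      moreover from this(1) have "gl2_conj a b c d a' b' c' d'"
        by (rule gl2_conj_trans[OF gl2_conj_trans[OF C2 gl2_conj_swap]])
      ultimately show ?thesis using tr2 by (metis add.commute)
    qed
  qed
  then show thesis using that by blast
qed

text \<open>For a reduced matrix \<open>4 b c + (a - d)\<^sup>2 = T\<^sup>2 - 4 \<le> 45\<close> with \<open>c \<le> b\<close>, so \<open>c \<le> 3\<close>, and only finitely many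
matrices are left. A matrix with \<open>c = 1\<close> is determined up to conjugacy by its trace.\<close>

lemma sl2_conj_small_trace:
  fixes a b c d :: int
  assumes det: "a * d - b * c = 1" and T: "2 < a + d" "a + d \<le> 7"
  shows "gl2_conj a b c d (a + d - 1) (a + d - 2) 1 1 \<or>
    a + d = 6 \<and> gl2_conj a b c d 5 2 2 1 \<or> a + d = 7 \<and> gl2_conj a b c d 5 3 3 2"
proof -
  obtain a' b' c' d' where C: "gl2_conj a b c d a' b' c' d'" and det': "a' * d' - b' * c' = 1"
    and tr: "a' + d' = a + d" and c': "c' > 0" "\<bar>a' - d'\<bar> \<le> c'" "c' \<le> \<bar>b'\<bar>"
    using gl2_conj_reduced[OF det T(1)] by metis
  have disc: "4 * (b' * c') + (a' - d')\<^sup>2 = (a' + d')\<^sup>2 - 4"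
    using det' by (simp add: power2_eq_square algebra_simps)
  have d2: "(a' - d')\<^sup>2 \<le> c'\<^sup>2" using c' by (simp add: abs_le_square_iff[symmetric])
  have T2: "3\<^sup>2 \<le> (a' + d')\<^sup>2" "(a' + d')\<^sup>2 \<le> 7\<^sup>2" 
    using power_mono[of 3 "a' + d'" 2] power_mono[of "a' + d'" 7 2] T tr by simp_all
  have b': "c' \<le> b'"
  proof (rule ccontr)
    assume "\<not> c' \<le> b'"
    then have "b' * c' \<le> (- c') * c'" using c' by (intro mult_right_mono) auto
    then show False using disc d2 T2 zero_le_square[of c'] by (simp add: power2_eq_square)
  qed
  then have "c' * c' \<le> b' * c'" using c' by (intro mult_right_mono) auto
  then have "4 * c'\<^sup>2 \<le> 45" using disc T2 zero_le_square[of "a' - d'"]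
    unfolding power2_eq_square by linarith
  then have "c'\<^sup>2 < 4\<^sup>2" by simp
  then have "c' < 4" by (rule power_less_imp_less_base) simp
  then consider "c' = 1" | "c' = 2" | "c' = 3" using c' by linarith
  then show ?thesis
  proof cases
    case 1
    have "b' = a' * d' - 1" using det' 1 by simp
    then have "b' + (d' - 1) * (d' - a') - (d' - 1) * (d' - 1) * 1 = a' + d' - 2"
      by (simp add: algebra_simps)
    then have "gl2_conj a' b' c' d' (a' + d' - 1) (a' + d' - 2) 1 1"
      using gl2_conj_shear[of a' b' c' d' "d' - 1"] unfolding 1 by (simp add: add_diff_eq)
    then have "gl2_conj a' b' c' d' (a + d - 1) (a + d - 2) 1 1" by (simp only: tr)
    then show ?thesis using gl2_conj_trans[OF C] by blast
  next
    case 2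
    have T': "a + d = 3 \<or> a + d = 4 \<or> a + d = 5 \<or> a + d = 6 \<or> a + d = 7" using T by linarith
    have d': "d' = a + d - a'" using tr by simp
    have a': "a' = 1 \<or> a' = 2 \<or> a' = 3 \<or> a' = 4" using 2 c' T d' by linarith
    have "2 * b' = a' * (a + d - a') - 1" using det' 2 d' by simp
    then have "a + d = 6 \<and> a' = 3 \<and> d' = 3 \<and> b' = 4"
      using T' a' b' 2 d' c' by (elim disjE; simp; presburger)
    then show ?thesis
      using gl2_conj_trans[OF C] gl2_conj_shear[of 3 4 2 3 1] 2 by auto
  next
    case 3
    have T': "a + d = 3 \<or> a + d = 4 \<or> a + d = 5 \<or> a + d = 6 \<or> a + d = 7" using T by linarith
    have d': "d' = a + d - a'" using tr by simp
    have a': "a' = 0 \<or> a' = 1 \<or> a' = 2 \<or> a' = 3 \<or> a' = 4 \<or> a' = 5" using 3 c' T d' by linarith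
    have "3 * b' = a' * (a + d - a') - 1" using det' 3 d' by simp
    then have "a + d = 7 \<and> b' = 3 \<and> (a' = 5 \<and> d' = 2 \<or> a' = 2 \<and> d' = 5)"
      using T' a' b' 3 d' c' by (elim disjE; simp; presburger)
    then show ?thesis
      using C gl2_conj_trans[OF C gl2_conj_swap] 3 by auto
  qed
qed

lemma discrete_split_osc_int:
  assumes G: "discrete_split_oscillator_group G T" and T: "T \<le> 7"
  obtains r a b c d l where "1 \<le> r" "a * d - b * c = 1" "G \<cong> osc_int r a b c d l" "2 < T"
    "(a, b, c, d) = (T - 1, T - 2, 1, 1) \<or> T = 6 \<and> (a, b, c, d) = (5, 2, 2, 1) \<or>
     T = 7 \<and> (a, b, c, d) = (5, 3, 3, 2)"
proof -
  obtain r a b c d k l where r: "1 \<le> r" and B: "a * d - b * c = 1" and tr: "a + d = T" "2 < T"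
    and par: "even (k - int r * a * c)" "even (l - int r * b * d)"
    and iso: "G \<cong> mapping_torus (heis_int r) (heis_aff r a b c d 1 k l)"
    using discrete_split_model[OF G] by metis
  obtain a' b' c' d' where C: "gl2_conj a b c d a' b' c' d'"
    and form: "(a', b', c', d') = (T - 1, T - 2, 1, 1) \<or> T = 6 \<and> (a', b', c', d') = (5, 2, 2, 1) \<or>
     T = 7 \<and> (a', b', c', d') = (5, 3, 3, 2)"
    using sl2_conj_small_trace[OF B] tr T by blast
  have det: "a' * d' - b' * c' = 1" using form by auto
  obtain p q s t where S: "p * t - q * s = 1 \<or> p * t - q * s = -1"
      "p * a + q * c = a' * p + b' * s" "p * b + q * d = a' * q + b' * t"
      "s * a + t * c = c' * p + d' * s" "s * b + t * d = c' * q + d' * t"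
    using C unfolding gl2_conj_def by blast
  obtain k' l' where par': "even (k' - int r * a' * c')" "even (l' - int r * b' * d')"
    and iso': "mapping_torus (heis_int r) (heis_aff r a b c d 1 k l)
      \<cong> mapping_torus (heis_int r) (heis_aff r a' b' c' d' 1 k' l')"
    using torus_conjugate[OF r B par S(1) HOL.refl S(2-5)] by metis
  have "k' = int r * a' * c' - 2 * ((int r * a' * c' - k') div 2)"
    "l' = int r * b' * d' + 2 * ((l' - int r * b' * d') div 2)"
    using par' by (simp_all add: algebra_simps)
  then have "G \<cong> osc_int r a' b' c' d' ((l' - int r * b' * d') div 2, (int r * a' * c' - k') div 2)"
    unfolding osc_int_def using iso_trans[OF iso iso'] by simp
  then show thesis using that[OF r det] form tr(2) by blast
qed

text \<open>The rows of \<open>B - 1\<close> span the same lattice as \<open>(1, 0)\<close> and \<open>(0, n)\<close>, so \<open>l\<^sub>2\<close> can be removed and \<open>l\<^sub>1\<close> matters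
modulo \<open>n\<close> and \<open>r\<close> only.\<close>

lemma osc_int_companion_shift:
  fixes n :: int
  assumes "gcd n (int r) dvd l1 - i"
  shows "osc_int r (n + 1) n 1 1 (l1, l2) \<cong> osc_int r (n + 1) n 1 1 (i, 0)"
proof -
  obtain w where w: "l1 - i = gcd n (int r) * w" using assms by blast
  obtain u v where uv: "u * n + v * int r = gcd n (int r)" using bezout_int by blast
  show ?thesis
    by (rule osc_int_shift[of _ _ _ _ _ _ "- (u * w)" "l2 + u * w * n" _ 0 _ _ "- (v * w)"])
      (use w in \<open>simp_all add: algebra_simps flip: uv\<close>)
qed

lemma osc_int_companion_neg:
  fixes n :: int
  assumes "gcd n (int r) dvd l1 + i"
  shows "osc_int r (n + 1) n 1 1 (l1, l2) \<cong> osc_int r (n + 1) n 1 1 (i, 0)"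
proof -
  have "osc_int r (n + 1) n 1 1 (l1, l2) \<cong> osc_int r (n + 1) n 1 1 (- l1 - int r * n * 1, int r * (n + 1) * 1 - l2)"
    by (rule osc_int_neg) simp
  also have "\<dots> \<cong> osc_int r (n + 1) n 1 1 (i, 0)"
  proof (rule osc_int_companion_shift)
    have "gcd n (int r) dvd - (l1 + i) - int r * n"
      using assms by (intro dvd_diff dvd_mult2) (simp_all only: dvd_minus_iff gcd_dvd2)
    moreover have "- l1 - int r * n * 1 - i = - (l1 + i) - int r * n" by simp
    ultimately show "gcd n (int r) dvd - l1 - int r * n * 1 - i" by (simp only:)
  qed
  finally show ?thesis .
qed

text \<open>The row lattice of \<open>B - 1\<close> is the kernel of \<open>l\<^sub>1 - 3 l\<^sub>2\<close> modulo 5.\<close>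

lemma osc_int_golden_shift:
  assumes "gcd 5 (int r) dvd l1 - 3 * l2 - (l1' - 3 * l2')"
  shows "osc_int r 5 3 3 2 (l1, l2) \<cong> osc_int r 5 3 3 2 (l1', l2')"
proof -
  obtain w where w: "l1 - 3 * l2 - (l1' - 3 * l2') = gcd 5 (int r) * w" using assms by blast
  obtain u v where uv: "u * 5 + v * int r = gcd 5 (int r)" using bezout_int by blast
  show ?thesis
    by (rule osc_int_shift[of _ _ _ _ _ _ "- 2 * (l2 - l2') - 3 * u * w" "3 * (l2 - l2') + 4 * u * w" _ 0 _ _ "- (v * w)"])
      (use w in \<open>simp_all add: algebra_simps flip: uv\<close>)
qed

section \<open>Pairwise non-isomorphic groups\<close>

lemma osc_int_iso_necessary:
  assumes r: "1 \<le> r" "1 \<le> r'"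
    and B: "a * d - b * c = 1" "a + d \<noteq> 2" and B': "a' * d' - b' * c' = 1" "a' + d' \<noteq> 2"
    and iso: "osc_int r a b c d l \<cong> osc_int r' a' b' c' d' l'"
  obtains p q s t e m n X Y where "r = r'" "e = 1 \<or> e = -1" "p * t - q * s = e"
    "even (m - int r * p * s)" "even (n - int r * q * t)"
    "(p * a + q * c = a' * p + b' * s \<and> p * b + q * d = a' * q + b' * t \<and>
      s * a + t * c = c' * p + d' * s \<and> s * b + t * d = c' * q + d' * t \<and>
      e * (int r * a * c - 2 * snd l) + (m * a + n * c)
        = m + ((int r' * a' * c' - 2 * snd l') * p + (int r' * b' * d' + 2 * fst l') * s) + 2 * int r * X \<and>
      e * (int r * b * d + 2 * fst l) + (m * b + n * d)
        = n + ((int r' * a' * c' - 2 * snd l') * q + (int r' * b' * d' + 2 * fst l') * t) + 2 * int r * Y) \<or>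
     (p * a + q * c = d' * p - b' * s \<and> p * b + q * d = d' * q - b' * t \<and>
      s * a + t * c = a' * s - c' * p \<and> s * b + t * d = a' * t - c' * q \<and>
      e * (int r * a * c - 2 * snd l) + (m * a + n * c)
        + ((int r' * a' * c' - 2 * snd l') * (p * a + q * c) + (int r' * b' * d' + 2 * fst l') * (s * a + t * c))
        = m + 2 * int r * X \<and>
      e * (int r * b * d + 2 * fst l) + (m * b + n * d)
        + ((int r' * a' * c' - 2 * snd l') * (p * b + q * d) + (int r' * b' * d' + 2 * fst l') * (s * b + t * d))
        = n + 2 * int r * Y)"
proof -
  have par: "even (int r * a * c - 2 * snd l - int r * a * c)" "even (int r * b * d + 2 * fst l - int r * b * d)"
    "even (int r' * a' * c' - 2 * snd l' - int r' * a' * c')" "even (int r' * b' * d' + 2 * fst l' - int r' * b' * d')"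
    by simp_all
  show thesis
    by (rule torus_iso_necessary[OF r B par(1,2) B' par(3,4) iso[unfolded osc_int_def]], rule that)
qed

text \<open>The trace is invariant under conjugation and, in \<open>SL(2, \<int>)\<close>, under inversion.\<close>

lemma osc_int_iso_invariants:
  assumes r: "1 \<le> r" "1 \<le> r'"
    and B: "a * d - b * c = 1" "a + d \<noteq> 2" and B': "a' * d' - b' * c' = 1" "a' + d' \<noteq> 2"
    and iso: "osc_int r a b c d l \<cong> osc_int r' a' b' c' d' l'"
  shows "r = r'" "a + d = a' + d'"
proof -
  obtain p q s t e where "r = r'" and e: "e = 1 \<or> e = -1" "p * t - q * s = e" and
    conj: "(p * a + q * c = a' * p + b' * s \<and> p * b + q * d = a' * q + b' * t \<and>
      s * a + t * c = c' * p + d' * s \<and> s * b + t * d = c' * q + d' * t) \<or>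
     (p * a + q * c = d' * p - b' * s \<and> p * b + q * d = d' * q - b' * t \<and>
      s * a + t * c = a' * s - c' * p \<and> s * b + t * d = a' * t - c' * q)"
    by (rule osc_int_iso_necessary[OF r B B' iso]) blast
  then show "r = r'" by simp
  have "e * (a + d) = t * (p * a + q * c) - s * (p * b + q * d) - q * (s * a + t * c) + p * (s * b + t * d)"
    unfolding e(2)[symmetric] by (simp add: algebra_simps)
  also have "\<dots> = e * (a' + d')"
    using conj unfolding e(2)[symmetric] by (elim disjE conjE; simp only:; simp add: algebra_simps)
  finally show "a + d = a' + d'" using e(1) by auto
qed

text \<open>The second matrix is the identity modulo 2, which is preserved by conjugation and inversion, and the first is
not.\<close>

lemma osc_int_5411_5221:
  assumes r: "1 \<le> r" "1 \<le> r'"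
  shows "\<not> osc_int r 5 4 1 1 l \<cong> osc_int r' 5 2 2 1 l'"
proof
  assume iso: "osc_int r 5 4 1 1 l \<cong> osc_int r' 5 2 2 1 l'"
  obtain p q s t e :: int where e: "e = 1 \<or> e = -1" "p * t - q * s = e" and
    conj: "(p * 5 + q * 1 = 5 * p + 2 * s \<and> s * 5 + t * 1 = 2 * p + 1 * s) \<or>
     (p * 5 + q * 1 = 1 * p - 2 * s \<and> s * 5 + t * 1 = 5 * s - 2 * p)"
    by (rule osc_int_iso_necessary[OF r _ _ _ _ iso], simp, simp, simp, simp, rule that, assumption, assumption, blast)
  have "even q" "even t" using conj by presburger+
  then have "even e" unfolding e(2)[symmetric] by simp
  then show False using e(1) by auto
qed

text \<open>The second matrix is \<open>-1\<close> modulo 3, and the first is not.\<close>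

lemma osc_int_6511_5332:
  assumes r: "1 \<le> r" "1 \<le> r'"
  shows "\<not> osc_int r 6 5 1 1 l \<cong> osc_int r' 5 3 3 2 l'"
proof
  assume iso: "osc_int r 6 5 1 1 l \<cong> osc_int r' 5 3 3 2 l'"
  obtain p q s t e :: int where e: "e = 1 \<or> e = -1" "p * t - q * s = e" and
    conj: "(p * 6 + q * 1 = 5 * p + 3 * s \<and> s * 6 + t * 1 = 3 * p + 2 * s) \<or>
     (p * 6 + q * 1 = 2 * p - 3 * s \<and> s * 6 + t * 1 = 5 * s - 3 * p)"
    by (rule osc_int_iso_necessary[OF r _ _ _ _ iso], simp, simp, simp, simp, rule that, assumption, assumption, blast)
  from conj have "q = 3 * s - p \<and> t = 3 * p - 4 * s \<or> q = - 4 * p - 3 * s \<and> t = - 3 * p - s" by linarith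
  then have "e = 3 * (p * p - p * s - s * s) \<or> e = 3 * (- (p * p) + p * s + s * s)"
    unfolding e(2)[symmetric] by (elim disjE conjE; simp only:; simp add: algebra_simps)
  then have "3 dvd e" by (metis dvd_triv_left)
  then show False using e(1) by auto
qed

text \<open>The matrices \<open>S\<close> with \<open>S B = B S\<close> are \<open>(p, n s; s, p - n s)\<close>, and those with \<open>S B = B\<^sup>-\<^sup>1 S\<close> are
\<open>(p, - n (p + s); s, - p)\<close>. Both act on the relevant coordinate of \<open>l\<close> modulo \<open>n\<close> as multiplication by
\<open>p\<close> up to sign, and up to sign both have determinant \<open>p\<^sup>2 - n p s - n s\<^sup>2\<close>.\<close>

lemma osc_int_companion_necessary:
  fixes n g i j :: int
  assumes r: "1 \<le> r" and n: "n \<ge> 1" and g: "g dvd n" "g dvd int r"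
    and iso: "osc_int r (n + 1) n 1 1 (i, 0) \<cong> osc_int r (n + 1) n 1 1 (j, 0)"
  obtains p s e where "e = 1 \<or> e = -1"
    "p * p - n * p * s - n * s * s = 1 \<or> p * p - n * p * s - n * s * s = -1" "g dvd e * i - p * j"
proof -
  have B: "(n + 1) * 1 - n * 1 = 1" "n + 1 + 1 \<noteq> 2" using n by auto
  obtain p q s t e m m' Y where e: "e = 1 \<or> e = -1" "p * t - q * s = e" and m: "even (m - int r * p * s)" and
    cases: "(p * (n + 1) + q * 1 = (n + 1) * p + n * s \<and> p * n + q * 1 = (n + 1) * q + n * t \<and>
      e * (int r * n * 1 + 2 * i) + (m * n + m' * 1)
        = m' + ((int r * (n + 1) * 1 - 2 * 0) * q + (int r * n * 1 + 2 * j) * t) + 2 * int r * Y) \<or>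
     (p * (n + 1) + q * 1 = 1 * p - n * s \<and> s * (n + 1) + t * 1 = (n + 1) * s - 1 * p \<and>
      s * n + t * 1 = (n + 1) * t - 1 * q \<and> p * n + q * 1 = 1 * q - n * t \<and>
      e * (int r * n * 1 + 2 * i) + (m * n + m' * 1)
        + ((int r * (n + 1) * 1 - 2 * 0) * (p * n + q * 1) + (int r * n * 1 + 2 * j) * (s * n + t * 1))
        = m' + 2 * int r * Y)"
    by (rule osc_int_iso_necessary[OF r r B B iso, unfolded fst_conv snd_conv], rule that, assumption, assumption, assumption, blast)
  obtain m0 where m0: "m = int r * p * s + 2 * m0" using m by (metis add_diff_cancel_left' diff_add_cancel dvdE add.commute)
  let ?w = "p * p - n * p * s - n * s * s"
  have "(?w = e \<or> ?w = - e) \<and>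
    (\<exists>Z. 2 * (e * i - p * j) = int r * n * (s + p - e - p * s) + 2 * (int r * Y - m0 * n - j * n * s))"
    using cases
  proof (elim disjE conjE)
    assume 1: "p * (n + 1) + q * 1 = (n + 1) * p + n * s" and 2: "p * n + q * 1 = (n + 1) * q + n * t"
      and eq: "e * (int r * n * 1 + 2 * i) + (m * n + m' * 1)
        = m' + ((int r * (n + 1) * 1 - 2 * 0) * q + (int r * n * 1 + 2 * j) * t) + 2 * int r * Y"
    have q: "q = n * s" using 1 by (simp add: algebra_simps)
    have "n * (p - q - t) = 0" using 2 by (simp add: algebra_simps)
    then have t: "t = p - n * s" using n q by simp
    have "?w = e" using e(2) unfolding q t by (simp add: algebra_simps)
    then show ?thesis using eq unfolding q t m0 by (simp add: algebra_simps)
  next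
    assume 1: "p * (n + 1) + q * 1 = 1 * p - n * s" and 2: "s * (n + 1) + t * 1 = (n + 1) * s - 1 * p"
      and eq: "e * (int r * n * 1 + 2 * i) + (m * n + m' * 1)
        + ((int r * (n + 1) * 1 - 2 * 0) * (p * n + q * 1) + (int r * n * 1 + 2 * j) * (s * n + t * 1))
        = m' + 2 * int r * Y"
    have q: "q = - n * (p + s)" using 1 by (simp add: algebra_simps)
    have t: "t = - p" using 2 by (simp add: algebra_simps)
    have "?w = - e" using e(2) unfolding q t by (simp add: algebra_simps)
    then show ?thesis using eq unfolding q t m0 by (simp add: algebra_simps)
  qed
  then have w: "?w = e \<or> ?w = - e"
    and eq: "2 * (e * i - p * j) = int r * n * (s + p - e - p * s) + 2 * (int r * Y - m0 * n - j * n * s)"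
    by auto
  have gd: "g dvd int r * Y - m0 * n - j * n * s"
    using g(1,2) by (intro dvd_diff) auto
  have "g dvd e * i - p * j"
  proof (cases "odd g")
    case True
    have "g dvd int r * n * (s + p - e - p * s)" using g(2) by simp
    from dvd_add[OF this dvd_mult[OF gd]] have "g dvd 2 * (e * i - p * j)" unfolding eq .
    moreover have "coprime g 2" using True by (simp add: coprime_right_2_iff_odd)
    ultimately show ?thesis by (simp only: coprime_dvd_mult_right_iff)
  next
    case False
    then have "2 dvd n" using g(1) by (metis dvd_trans)
    then have "g * 2 dvd int r * n" using g(2) by (rule mult_dvd_mono[rotated])
    then have "2 * g dvd int r * n * (s + p - e - p * s)" by (simp add: mult.commute)
    moreover have "2 * g dvd 2 * (int r * Y - m0 * n - j * n * s)" using gd by (intro mult_dvd_mono) auto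
    ultimately have "2 * g dvd 2 * (e * i - p * j)" unfolding eq by (rule dvd_add)
    then show ?thesis by (simp only: dvd_mult_cancel_left) simp
  qed
  moreover have "?w = 1 \<or> ?w = -1" using e(1) w by auto
  ultimately show thesis using that[OF e(1)] by blast
qed

lemma companion_unit_mod:
  fixes n p s :: int
  assumes n: "1 \<le> n" "n \<le> 5"
    and w: "p * p - n * p * s - n * s * s = 1 \<or> p * p - n * p * s - n * s * s = -1"
  shows "n dvd p - 1 \<or> n dvd p + 1"
proof -
  define w where "w = p * p - n * p * s - n * s * s"
  have w1: "w = 1 \<or> w = -1" using w by (simp add: w_def)
  have pp: "p * p = w + n * (p * s + s * s)" by (simp add: w_def algebra_simps)
  then have sq: "(p mod n) * (p mod n) mod n = w mod n" by (simp add: mod_mult_eq)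
  consider "n = 1" | "n = 2" | "n = 3" | "n = 4" | "n = 5" using n by linarith
  then show ?thesis
  proof cases
    assume "n = 1"
    then show ?thesis by simp
  next
    case 2
    have "p mod 2 = 0 \<or> p mod 2 = 1" by presburger
    with sq w1 have "p mod 2 = 1" unfolding 2 by auto
    then show ?thesis unfolding 2 by presburger
  next
    case 3
    have "p mod 3 = 0 \<or> p mod 3 = 1 \<or> p mod 3 = 2" by presburger
    with sq w1 have "p mod 3 = 1 \<or> p mod 3 = 2" unfolding 3 by auto
    then show ?thesis unfolding 3 by presburger
  next
    case 4
    have "p mod 4 = 0 \<or> p mod 4 = 1 \<or> p mod 4 = 2 \<or> p mod 4 = 3" by presburger
    with sq w1 have "p mod 4 = 1 \<or> p mod 4 = 3" unfolding 4 by auto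
    then show ?thesis unfolding 4 by presburger
  next
    case 5
    \<comment> \<open>Modulo 5 alone, \<open>p = 2\<close> would be possible; modulo 3 the form is the square of \<open>p - s\<close>.\<close>
    have "(p - s) * (p - s) = w + 3 * (p * s + 2 * (s * s))"
      by (simp add: w_def 5 algebra_simps)
    then have "((p - s) mod 3) * ((p - s) mod 3) mod 3 = w mod 3" by (simp only: mod_mult_eq mod_mult_self2)
    moreover have "(p - s) mod 3 = 0 \<or> (p - s) mod 3 = 1 \<or> (p - s) mod 3 = 2" by presburger
    ultimately have "w = 1" using w1 by auto
    have "p mod 5 = 0 \<or> p mod 5 = 1 \<or> p mod 5 = 2 \<or> p mod 5 = 3 \<or> p mod 5 = 4" by presburger
    with sq \<open>w = 1\<close> have "p mod 5 = 1 \<or> p mod 5 = 4" unfolding 5 by auto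
    then show ?thesis unfolding 5 by presburger
  qed
qed

lemma osc_int_companion_distinct:
  fixes n g i j :: int
  assumes r: "1 \<le> r" and n: "1 \<le> n" "n \<le> 5"
    and g: "g dvd n" "g dvd int r"
    and iso: "osc_int r (n + 1) n 1 1 (i, 0) \<cong> osc_int r (n + 1) n 1 1 (j, 0)"
  shows "g dvd i - j \<or> g dvd i + j"
proof -
  from osc_int_companion_necessary[OF r n(1) g iso] obtain p s e where e: "e = 1 \<or> e = -1"
    and w: "p * p - n * p * s - n * s * s = 1 \<or> p * p - n * p * s - n * s * s = -1" and d: "g dvd e * i - p * j"
    by metis
  have "g dvd p - 1 \<or> g dvd p + 1" using companion_unit_mod[OF n w] g(1) dvd_trans by blast
  then have "g dvd (e * i - p * j) + (p - 1) * j \<or> g dvd (e * i - p * j) + (p + 1) * j"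
    using d by (meson dvd_add dvd_mult2)
  then have "g dvd e * i - j \<or> g dvd e * i + j" by (simp add: algebra_simps)
  moreover have "g dvd - i - j \<longleftrightarrow> g dvd i + j" "g dvd - i + j \<longleftrightarrow> g dvd i - j"
    using dvd_minus_iff[of g "i + j"] dvd_minus_iff[of g "i - j"] by (simp_all add: algebra_simps)
  ultimately show ?thesis using e by auto
qed

text \<open>Modulo 2, the matrices commuting with or inverting \<open>B\<close> are the identity and the swap of coordinates.\<close>

lemma osc_int_5221_distinct:
  assumes r: "1 \<le> r" "even r"
    and iso: "osc_int r 5 2 2 1 (l1, l2) \<cong> osc_int r 5 2 2 1 (l1', l2')"
  shows "(even l1 \<longleftrightarrow> even l1') \<and> (even l2 \<longleftrightarrow> even l2') \<or> (even l1 \<longleftrightarrow> even l2') \<and> (even l2 \<longleftrightarrow> even l1')"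
proof -
  obtain p q s t e m n X Y :: int where e: "e = 1 \<or> e = -1" "p * t - q * s = e"
    and mn: "even (m - int r * p * s)" "even (n - int r * q * t)" and
    cases: "(p * 5 + q * 2 = 5 * p + 2 * s \<and> s * 5 + t * 2 = 2 * p + 1 * s \<and>
      e * (int r * 5 * 2 - 2 * l2) + (m * 5 + n * 2)
        = m + ((int r * 5 * 2 - 2 * l2') * p + (int r * 2 * 1 + 2 * l1') * s) + 2 * int r * X \<and>
      e * (int r * 2 * 1 + 2 * l1) + (m * 2 + n * 1)
        = n + ((int r * 5 * 2 - 2 * l2') * q + (int r * 2 * 1 + 2 * l1') * t) + 2 * int r * Y) \<or>
     (p * 5 + q * 2 = 1 * p - 2 * s \<and> s * 5 + t * 2 = 5 * s - 2 * p \<and>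
      e * (int r * 5 * 2 - 2 * l2) + (m * 5 + n * 2)
        + ((int r * 5 * 2 - 2 * l2') * (p * 5 + q * 2) + (int r * 2 * 1 + 2 * l1') * (s * 5 + t * 2))
        = m + 2 * int r * X \<and>
      e * (int r * 2 * 1 + 2 * l1) + (m * 2 + n * 1)
        + ((int r * 5 * 2 - 2 * l2') * (p * 2 + q * 1) + (int r * 2 * 1 + 2 * l1') * (s * 2 + t * 1))
        = n + 2 * int r * Y)"
    by (rule osc_int_iso_necessary[OF r(1) r(1) _ _ _ _ iso, unfolded fst_conv snd_conv],
      simp, simp, simp, simp, rule that, (assumption+)?, blast)
  obtain \<rho> where \<rho>: "int r = 2 * \<rho>" using r(2) by (metis dvd_def even_of_nat)
  have "even m" "even n" using mn r(2) by simp_all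
  then obtain m0 n0 where m0: "m = 2 * m0" "n = 2 * n0" by (metis dvd_def)
  have par: "even (s - q)" "even (t - p)" using cases by presburger+
  have "e * l2 - l2' * p + l1' * s = 2 * (5 * \<rho> * e + 2 * m0 + n0 - 5 * \<rho> * p - \<rho> * s - \<rho> * X) \<and>
      e * l1 + l2' * q - l1' * t = 2 * (- \<rho> * e - m0 + 5 * \<rho> * q + \<rho> * t + \<rho> * Y) \<or>
      e * l2 + l2' * (p * 5 + q * 2) - l1' * (s * 5 + t * 2)
        = 2 * (5 * \<rho> * e + 2 * m0 + n0 + 5 * \<rho> * (p * 5 + q * 2) + \<rho> * (s * 5 + t * 2) - \<rho> * X) \<and>
      e * l1 - l2' * (p * 2 + q) + l1' * (s * 2 + t)
        = 2 * (- \<rho> * e - m0 - 5 * \<rho> * (p * 2 + q) - \<rho> * (s * 2 + t) + \<rho> * Y)"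
    using cases unfolding \<rho> m0 by (elim disjE conjE) (simp_all add: algebra_simps)
  then have "even (e * l2 - l2' * p + l1' * s) \<and> even (e * l1 + l2' * q - l1' * t) \<or>
      even (e * l2 + l2' * (p * 5 + q * 2) - l1' * (s * 5 + t * 2)) \<and> even (e * l1 - l2' * (p * 2 + q) + l1' * (s * 2 + t))"
    by (metis dvd_triv_left)
  moreover have "odd (p * t - q * s)" "odd e" using e by auto
  ultimately show ?thesis using par by (simp; safe; blast?)
qed

text \<open>If \<open>l = (0, 1)\<close> were equivalent to 0, then \<open>S\<close> would be singular modulo 5.\<close>

lemma osc_int_5332_distinct:
  assumes r: "1 \<le> r" "5 dvd r"
  shows "\<not> osc_int r 5 3 3 2 (0, 0) \<cong> osc_int r 5 3 3 2 (0, 1)"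
proof
  assume iso: "osc_int r 5 3 3 2 (0, 0) \<cong> osc_int r 5 3 3 2 (0, 1)"
  obtain p q s t e m n X Y :: int where e: "e = 1 \<or> e = -1" "p * t - q * s = e" and
    cases: "(p * 5 + q * 3 = 5 * p + 3 * s \<and> s * 5 + t * 3 = 3 * p + 2 * s \<and>
      e * (int r * 5 * 3 - 2 * 0) + (m * 5 + n * 3)
        = m + ((int r * 5 * 3 - 2 * 1) * p + (int r * 3 * 2 + 2 * 0) * s) + 2 * int r * X \<and>
      e * (int r * 3 * 2 + 2 * 0) + (m * 3 + n * 2)
        = n + ((int r * 5 * 3 - 2 * 1) * q + (int r * 3 * 2 + 2 * 0) * t) + 2 * int r * Y) \<or>
     (p * 5 + q * 3 = 2 * p - 3 * s \<and> s * 5 + t * 3 = 5 * s - 3 * p \<and>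
      e * (int r * 5 * 3 - 2 * 0) + (m * 5 + n * 3)
        + ((int r * 5 * 3 - 2 * 1) * (p * 5 + q * 3) + (int r * 3 * 2 + 2 * 0) * (s * 5 + t * 3))
        = m + 2 * int r * X \<and>
      e * (int r * 3 * 2 + 2 * 0) + (m * 3 + n * 2)
        + ((int r * 5 * 3 - 2 * 1) * (p * 3 + q * 2) + (int r * 3 * 2 + 2 * 0) * (s * 3 + t * 2))
        = n + 2 * int r * Y)"
    by (rule osc_int_iso_necessary[OF r(1) r(1) _ _ _ _ iso, unfolded fst_conv snd_conv],
      simp, simp, simp, simp, rule that, assumption, assumption, blast)
  obtain \<rho> where \<rho>: "int r = 5 * \<rho>" using r(2) by (metis dvd_def of_nat_mult of_nat_numeral)
  from cases have "5 dvd e"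
  proof (elim disjE conjE)
    assume 1: "p * 5 + q * 3 = 5 * p + 3 * s" "s * 5 + t * 3 = 3 * p + 2 * s"
      and 2: "e * (int r * 5 * 3 - 2 * 0) + (m * 5 + n * 3)
        = m + ((int r * 5 * 3 - 2 * 1) * p + (int r * 3 * 2 + 2 * 0) * s) + 2 * int r * X"
        "e * (int r * 3 * 2 + 2 * 0) + (m * 3 + n * 2)
        = n + ((int r * 5 * 3 - 2 * 1) * q + (int r * 3 * 2 + 2 * 0) * t) + 2 * int r * Y"
    have st: "s = q" "t = p - q" using 1 by linarith+
    obtain x y where "4 * m + 3 * n + 2 * p = 5 * x" "3 * m + n + 2 * q = 5 * y"
    proof
      show "4 * m + 3 * n + 2 * p = 5 * (\<rho> * (15 * p + 6 * s + 2 * X - 15 * e))"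
        "3 * m + n + 2 * q = 5 * (\<rho> * (15 * q + 6 * t + 2 * Y - 6 * e))"
        using 2 unfolding \<rho> by (simp_all add: algebra_simps)
    qed
    then have "2 * p - 6 * q = 5 * (m - 3 * y + x)" by (simp add: algebra_simps)
    then have "p = 3 * q + 5 * (3 * (m - 3 * y + x) - (p - 3 * q))" by simp
    then obtain z where "p = 3 * q + 5 * z" ..
    then have "e = 5 * (q * q + 5 * q * z + 5 * z * z)"
      unfolding e(2)[symmetric] st by (simp add: algebra_simps)
    then show ?thesis by simp
  next
    assume 1: "p * 5 + q * 3 = 2 * p - 3 * s" "s * 5 + t * 3 = 5 * s - 3 * p"
      and 2: "e * (int r * 5 * 3 - 2 * 0) + (m * 5 + n * 3)
        + ((int r * 5 * 3 - 2 * 1) * (p * 5 + q * 3) + (int r * 3 * 2 + 2 * 0) * (s * 5 + t * 3))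
        = m + 2 * int r * X"
        "e * (int r * 3 * 2 + 2 * 0) + (m * 3 + n * 2)
        + ((int r * 5 * 3 - 2 * 1) * (p * 3 + q * 2) + (int r * 3 * 2 + 2 * 0) * (s * 3 + t * 2))
        = n + 2 * int r * Y"
    have st: "s = - p - q" "t = - p" using 1 by linarith+
    obtain x y where "4 * m + 3 * n - 2 * (p * 5 + q * 3) = 5 * x" "3 * m + n - 2 * (p * 3 + q * 2) = 5 * y"
    proof
      show "4 * m + 3 * n - 2 * (p * 5 + q * 3) = 5 * (\<rho> * (2 * X - 15 * e - 15 * (p * 5 + q * 3) - 6 * (s * 5 + t * 3)))"
        "3 * m + n - 2 * (p * 3 + q * 2) = 5 * (\<rho> * (2 * Y - 6 * e - 15 * (p * 3 + q * 2) - 6 * (s * 3 + t * 2)))"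
        using 2 unfolding \<rho> by (simp_all add: algebra_simps)
    qed
    then have "8 * p + 6 * q = 5 * (m - 3 * y + x)" by (simp add: algebra_simps)
    then have "q = 2 * p + 5 * ((m - 3 * y + x) - 2 * p - q)" by simp
    then obtain z where "q = 2 * p + 5 * z" ..
    then have "e = 5 * (p * p + 5 * p * z + 5 * z * z)"
      unfolding e(2)[symmetric] st by (simp add: algebra_simps)
    then show ?thesis by simp
  qed
  then show False using e(1) by auto
qed

section \<open>The classification\<close>

lemma mat2_simps [simp]:
  "mat2 a b c d $ 1 $ 1 = a" "mat2 a b c d $ 1 $ 2 = b" "mat2 a b c d $ 2 $ 1 = c" "mat2 a b c d $ 2 $ 2 = d"
  by (simp_all add: mat2_def)

lemma trace_mat2: "trace (mat2 a b c d) = a + d"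
  by (simp add: trace_def sum_2)

lemma det_mat2: "det (mat2 a b c d) = a * d - b * c"
  by (simp add: det_2)

lemma mat2_eq_iff: "mat2 a b c d = mat2 a' b' c' d' \<longleftrightarrow> a = a' \<and> b = b' \<and> c = c' \<and> d = d'"
  by (auto simp: vec2_eq_iff)

text \<open>The case distinctions on \<open>r\<close> in the list enumerate the classes of \<open>\<int>/g\<close> up to sign, where
\<open>g = gcd n r\<close>.\<close>

lemma osc_list_companion:
  fixes n :: int
  assumes n: "1 \<le> n" "n \<le> 5"
  shows "(mat2 (n + 1) n 1 1, l) \<in> osc_list (n + 2) r \<longleftrightarrow>
    snd l = 0 \<and> 0 \<le> fst l \<and> 2 * fst l \<le> gcd n (int r)"
proof -
  obtain i j where l: "l = (i, j)" by (cases l)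
  have red: "gcd n (int r) = gcd n (int r mod n)"
    by (metis gcd.commute gcd_red_int)
  consider "n = 1" | "n = 2" | "n = 3" | "n = 4" | "n = 5" using n by linarith
  then show ?thesis
  proof cases
    assume [simp]: "n = 1"
    show ?thesis by (auto simp: osc_list_def mat2_eq_iff l)
  next
    assume [simp]: "n = 2"
    have "r mod 2 = 0 \<or> r mod 2 = 1" by presburger
    moreover have "int r mod 2 = int (r mod 2)" by (simp add: zmod_int)
    ultimately show ?thesis unfolding red by (auto simp: osc_list_def mat2_eq_iff l)
  next
    assume [simp]: "n = 3"
    have "r mod 3 = 0 \<or> r mod 3 = 1 \<or> r mod 3 = 2" by presburger
    moreover have "int r mod 3 = int (r mod 3)" by (simp add: zmod_int)
    ultimately show ?thesis unfolding red by (auto simp: osc_list_def mat2_eq_iff l gcd_non_0_int)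
  next
    assume [simp]: "n = 4"
    have "r mod 4 = 0 \<or> r mod 4 = 1 \<or> r mod 4 = 2 \<or> r mod 4 = 3" by presburger
    moreover have "int r mod 4 = int (r mod 4)" by (simp add: zmod_int)
    ultimately show ?thesis unfolding red by (auto simp: osc_list_def mat2_eq_iff l gcd_non_0_int)
  next
    assume [simp]: "n = 5"
    have "r mod 5 = 0 \<or> r mod 5 = 1 \<or> r mod 5 = 2 \<or> r mod 5 = 3 \<or> r mod 5 = 4" by presburger
    moreover have "int r mod 5 = int (r mod 5)" by (simp add: zmod_int)
    ultimately show ?thesis unfolding red by (auto simp: osc_list_def mat2_eq_iff l gcd_non_0_int)
  qed
qed

lemma osc_list_5221:
  "(mat2 5 2 2 1, l) \<in> osc_list 6 r \<longleftrightarrow> l = (0, 0) \<or> even r \<and> (l = (1, 0) \<or> l = (1, 1))"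
  by (auto simp: osc_list_def mat2_eq_iff)

lemma osc_list_5332:
  "(mat2 5 3 3 2, l) \<in> osc_list 7 r \<longleftrightarrow> l = (0, 0) \<or> 5 dvd r \<and> l = (0, 1)"
  by (auto simp: osc_list_def mat2_eq_iff)

lemma osc_list_cases:
  assumes "(B, l) \<in> osc_list T r"
  obtains
    (companion) n where "1 \<le> n" "n \<le> 5" "T = n + 2" "B = mat2 (n + 1) n 1 1"
  | (six) "T = 6" "B = mat2 5 2 2 1"
  | (seven) "T = 7" "B = mat2 5 3 3 2"
proof -
  have T: "T = 3 \<or> T = 4 \<or> T = 5 \<or> T = 6 \<or> T = 7"
    using assms by (auto simp: osc_list_def split: if_splits)
  have "B = mat2 (T - 1) (T - 2) 1 1 \<or> T = 6 \<and> B = mat2 5 2 2 1 \<or> T = 7 \<and> B = mat2 5 3 3 2"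
    using assms T by (elim disjE) (auto simp: osc_list_def)
  then show thesis
    using companion[of "T - 2"] six seven T by (elim disjE conjE; simp)
qed

lemma osc_list_trace:
  assumes "(B, l) \<in> osc_list T r"
  shows "trace B = T" "det B = 1" "2 < T" "T \<le> 7"
  using osc_list_cases[OF assms] by (cases; simp add: trace_mat2 det_mat2)+

lemma companion_representative:
  fixes n :: int
  assumes n: "1 \<le> n"
  obtains i where "0 \<le> i" "2 * i \<le> gcd n (int r)" "osc_int r (n + 1) n 1 1 l \<cong> osc_int r (n + 1) n 1 1 (i, 0)"
proof -
  define g where "g = gcd n (int r)"
  have g: "g > 0" using n by (simp add: g_def)
  define k where "k = fst l mod g"
  have k: "0 \<le> k" "k < g" "g dvd fst l - k" using g by (simp_all add: k_def)
  show thesis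
  proof (cases "2 * k \<le> g")
    case True
    then show thesis
      using that[of k] k osc_int_companion_shift[of n r "fst l" k "snd l"] by (simp add: g_def)
  next
    case False
    have "g dvd fst l + (g - k)" using dvd_add[OF k(3) dvd_refl] by (simp add: algebra_simps)
    with False show thesis
      using that[of "g - k"] k osc_int_companion_neg[of n r "fst l" "g - k" "snd l"] by (simp add: g_def)
  qed
qed

lemma osc_int_5221_mod_2:
  "osc_int r 5 2 2 1 (l1, l2) \<cong> osc_int r 5 2 2 1 (l1 mod 2, l2 mod 2)"
  by (rule osc_int_shift[of _ _ _ _ _ _ "- (l1 div 2)" "l2 div 2 + 2 * (l1 div 2)" _ 0 _ _ 0])
    (simp_all add: minus_div_mult_eq_mod[symmetric])

lemma representative_5221:
  obtains l' where "(mat2 5 2 2 1, l') \<in> osc_list 6 r" "osc_int r 5 2 2 1 l \<cong> osc_int r 5 2 2 1 l'"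
proof -
  obtain l1 l2 where l: "l = (l1, l2)" by (cases l)
  show thesis
  proof (cases "even r")
    case True
    note red = osc_int_5221_mod_2[of r l1 l2]
    have swap: "osc_int r 5 2 2 1 (0, 1) \<cong> osc_int r 5 2 2 1 (1, 0)"
      using iso_trans[OF osc_int_swap[of r 0 1] osc_int_5221_mod_2] by (simp add: mod_diff_eq[symmetric])
    have bits: "l1 mod 2 = 0 \<or> l1 mod 2 = 1" "l2 mod 2 = 0 \<or> l2 mod 2 = 1" by presburger+
    show thesis
    proof (cases "(l1 mod 2, l2 mod 2) = (0, 1)")
      case True
      then show thesis
        using that \<open>even r\<close> iso_trans[OF red[unfolded True] swap] unfolding osc_list_5221 l by blast
    next
      case False
      then have "(mat2 5 2 2 1, (l1 mod 2, l2 mod 2)) \<in> osc_list 6 r"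
        using bits \<open>even r\<close> unfolding osc_list_5221 by auto
      then show thesis using that red unfolding l by blast
    qed
  next
    case False
    then obtain j where j: "r = 2 * j + 1" by (metis oddE)
    have "osc_int r 5 2 2 1 l \<cong> osc_int r 5 2 2 1 (0, 0)"
      unfolding l
      by (rule osc_int_shift[of _ _ _ _ _ _ "int j * l1" "- 2 * int j * l1 - int j * l2" _ "- l2" _ _ "- l1"])
        (simp_all add: j algebra_simps)
    then show thesis using that unfolding osc_list_5221 by blast
  qed
qed

lemma osc_int_5332_class_2:
  assumes "5 dvd r" "(l1 - 3 * l2) mod 5 = 2"
  shows "osc_int r 5 3 3 2 (l1, l2) \<cong> osc_int r 5 3 3 2 (0, 1)"
proof (rule osc_int_golden_shift)
  have "gcd 5 (int r) dvd 5" by simp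
  moreover have "5 dvd l1 - 3 * l2 - (0 - 3 * 1)" using assms(2) by presburger
  ultimately show "gcd 5 (int r) dvd l1 - 3 * l2 - (0 - 3 * 1)" by (rule dvd_trans)
qed

lemma representative_5332:
  obtains l' where "(mat2 5 3 3 2, l') \<in> osc_list 7 r" "osc_int r 5 3 3 2 l \<cong> osc_int r 5 3 3 2 l'"
proof -
  obtain l1 l2 where l: "l = (l1, l2)" by (cases l)
  show thesis
  proof (cases "gcd 5 (int r) dvd l1 - 3 * l2")
    case True
    then have "osc_int r 5 3 3 2 l \<cong> osc_int r 5 3 3 2 (0, 0)"
      unfolding l by (intro osc_int_golden_shift) simp
    then show thesis using that unfolding osc_list_5332 by blast
  next
    case False
    have r: "5 dvd r"
    proof (rule ccontr)
      assume "\<not> 5 dvd r"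
      then have "int r mod 5 = 1 \<or> int r mod 5 = 2 \<or> int r mod 5 = 3 \<or> int r mod 5 = 4" by presburger
      moreover have "gcd 5 (int r) = gcd 5 (int r mod 5)" by (metis gcd.commute gcd_red_int)
      ultimately have "gcd 5 (int r) = 1" by (auto simp: gcd_non_0_int)
      then show False using False by simp
    qed
    then obtain j where j: "r = 5 * j" by blast
    \<comment> \<open>Each turn multiplies the class of l by -2, a generator of the units modulo 5.\<close>
    have turn: "(l1 + l2 - 7 * int r - 3 * (l1 + 9 * int r)) mod 5 = (- 2 * (l1 - 3 * l2)) mod 5" for l1 l2
    proof -
      have "l1 + l2 - 7 * int r - 3 * (l1 + 9 * int r) = - 2 * (l1 - 3 * l2) + 5 * (- l2 - 34 * int j)"
        by (simp add: j)
      then show ?thesis by (simp only: mod_mult_self2)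
    qed
    have to_01: "osc_int r 5 3 3 2 (l1, l2) \<cong> osc_int r 5 3 3 2 (0, 1)"
      if "osc_int r 5 3 3 2 (l1 + l2 - 7 * int r, l1 + 9 * int r) \<cong> osc_int r 5 3 3 2 (0, 1)" for l1 l2
      using iso_trans[OF osc_int_golden that] .
    have c2: "osc_int r 5 3 3 2 (l1, l2) \<cong> osc_int r 5 3 3 2 (0, 1)" if "(l1 - 3 * l2) mod 5 = 2" for l1 l2
      by (rule osc_int_5332_class_2[OF r that])
    have c4: "osc_int r 5 3 3 2 (l1, l2) \<cong> osc_int r 5 3 3 2 (0, 1)" if "(l1 - 3 * l2) mod 5 = 4" for l1 l2
      by (rule to_01, rule c2, unfold turn) (use that in presburger)
    have c3: "osc_int r 5 3 3 2 (l1, l2) \<cong> osc_int r 5 3 3 2 (0, 1)" if "(l1 - 3 * l2) mod 5 = 3" for l1 l2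
      by (rule to_01, rule c4, unfold turn) (use that in presburger)
    have c1: "osc_int r 5 3 3 2 (l1, l2) \<cong> osc_int r 5 3 3 2 (0, 1)" if "(l1 - 3 * l2) mod 5 = 1" for l1 l2
      by (rule to_01, rule c3, unfold turn) (use that in presburger)
    have "\<not> 5 dvd l1 - 3 * l2" using False dvd_trans[of "gcd 5 (int r)" 5] by auto
    then have "(l1 - 3 * l2) mod 5 = 1 \<or> (l1 - 3 * l2) mod 5 = 2 \<or> (l1 - 3 * l2) mod 5 = 3 \<or> (l1 - 3 * l2) mod 5 = 4"
      by presburger
    then have "osc_int r 5 3 3 2 l \<cong> osc_int r 5 3 3 2 (0, 1)"
      unfolding l using c1 c2 c3 c4 by blast
    then show thesis using that r unfolding osc_list_5332 by blast
  qed
qed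

lemma discrete_split_iso_listed:
  assumes G: "discrete_split_oscillator_group G T" "T \<le> 7"
  shows "\<exists>r B l. 1 \<le> r \<and> (B, l) \<in> osc_list T r \<and> G \<cong> Osc r B l"
proof -
  obtain r a b c d l where r: "1 \<le> r" and det: "a * d - b * c = 1" and iso: "G \<cong> osc_int r a b c d l"
    and T: "2 < T" and form: "(a, b, c, d) = (T - 1, T - 2, 1, 1) \<or> T = 6 \<and> (a, b, c, d) = (5, 2, 2, 1) \<or>
      T = 7 \<and> (a, b, c, d) = (5, 3, 3, 2)"
    using discrete_split_osc_int[OF G] by metis
  obtain l' where l': "(mat2 a b c d, l') \<in> osc_list T r" and iso': "osc_int r a b c d l \<cong> osc_int r a b c d l'"
    using form
  proof (elim disjE conjE)
    assume eq: "(a, b, c, d) = (T - 1, T - 2, 1, 1)"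
    obtain i where i: "0 \<le> i" "2 * i \<le> gcd (T - 2) (int r)"
      and "osc_int r (T - 2 + 1) (T - 2) 1 1 l \<cong> osc_int r (T - 2 + 1) (T - 2) 1 1 (i, 0)"
      using companion_representative[of "T - 2" r l] T by auto
    moreover have "(mat2 (T - 2 + 1) (T - 2) 1 1, (i, 0)) \<in> osc_list (T - 2 + 2) r"
      using i T G(2) by (subst osc_list_companion) auto
    ultimately show thesis using that[of "(i, 0)"] eq by simp
  next
    assume "T = 6" "(a, b, c, d) = (5, 2, 2, 1)"
    then show thesis using representative_5221[of r l] that by blast
  next
    assume "T = 7" "(a, b, c, d) = (5, 3, 3, 2)"
    then show thesis using representative_5332[of r l] that by blast
  qed
  have det': "mat2 a b c d $ 1 $ 1 * mat2 a b c d $ 2 $ 2 - mat2 a b c d $ 1 $ 2 * mat2 a b c d $ 2 $ 1 = 1"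
    using det by simp
  have "Osc r (mat2 a b c d) l' \<cong> osc_int r a b c d l'"
    using Osc_iso_osc_int(2)[OF det'] by simp
  then have "osc_int r a b c d l' \<cong> Osc r (mat2 a b c d) l'"
    by (rule group.iso_sym[OF Osc_iso_osc_int(1)[OF det']])
  then have "G \<cong> Osc r (mat2 a b c d) l'" by (rule iso_trans[OF iso_trans[OF iso iso']])
  then show ?thesis using r l' by blast
qed

lemma Osc_iso_imp_osc_int_iso:
  assumes "a * d - b * c = 1" "a' * d' - b' * c' = 1"
    and "Osc r (mat2 a b c d) l \<cong> Osc r' (mat2 a' b' c' d') l'"
  shows "osc_int r a b c d l \<cong> osc_int r' a' b' c' d' l'"
proof -
  have 1: "group (Osc r (mat2 a b c d) l)" "Osc r (mat2 a b c d) l \<cong> osc_int r a b c d l"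
    using Osc_iso_osc_int[of "mat2 a b c d" r l] assms(1) by simp_all
  have 2: "Osc r' (mat2 a' b' c' d') l' \<cong> osc_int r' a' b' c' d' l'"
    using Osc_iso_osc_int[of "mat2 a' b' c' d'" r' l'] assms(2) by simp
  show ?thesis
    using iso_trans[OF iso_trans[OF group.iso_sym[OF 1] assms(3)] 2] .
qed

lemma listed_iso_imp_eq:
  assumes r: "1 \<le> r" "1 \<le> r'"
    and mem: "(B, l) \<in> osc_list T r" "(B', l') \<in> osc_list T' r'" and iso: "Osc r B l \<cong> Osc r' B' l'"
  shows "(r, B, l) = (r', B', l')"
proof -
  have det1: "det B = 1" "det B' = 1" and T: "trace B = T" "2 < T" "trace B' = T'" "2 < T'"
    using osc_list_trace[OF mem(1)] osc_list_trace[OF mem(2)] by auto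
  have eqs: "r = r' \<and> T = T'"
  proof -
    let ?m = "\<lambda>B. mat2 (B $ 1 $ 1) (B $ 1 $ 2) (B $ 2 $ 1) (B $ 2 $ 2)"
    have B: "?m B = B" "?m B' = B'" by (simp_all add: vec2_eq_iff)
    have det: "B $ 1 $ 1 * B $ 2 $ 2 - B $ 1 $ 2 * B $ 2 $ 1 = 1" "B' $ 1 $ 1 * B' $ 2 $ 2 - B' $ 1 $ 2 * B' $ 2 $ 1 = 1"
      using det1 by (simp_all add: det_2)
    have tr: "B $ 1 $ 1 + B $ 2 $ 2 = T" "B' $ 1 $ 1 + B' $ 2 $ 2 = T'" using T by (simp_all add: trace_def sum_2)
    have "osc_int r (B $ 1 $ 1) (B $ 1 $ 2) (B $ 2 $ 1) (B $ 2 $ 2) l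
        \<cong> osc_int r' (B' $ 1 $ 1) (B' $ 1 $ 2) (B' $ 2 $ 1) (B' $ 2 $ 2) l'"
      using Osc_iso_imp_osc_int_iso[OF det, unfolded B, OF iso] .
    from osc_int_iso_invariants[OF r det(1) _ det(2) _ this] tr T show ?thesis by simp
  qed
  then have [simp]: "r' = r" "T' = T" by simp_all
  note mem' = mem(2)[simplified]
  have iso': "Osc r B' l' \<cong> Osc r B l"
    using group.iso_sym[OF Osc_iso_osc_int(1) iso] det1 by (simp add: det_2)
  have sq: "gcd n (int r) dvd i - j \<or> gcd n (int r) dvd i + j \<Longrightarrow> i = j"
    if "1 \<le> n" "0 \<le> i" "2 * i \<le> gcd n (int r)" "0 \<le> j" "2 * j \<le> gcd n (int r)" for n i j :: int
  proof -
    assume "gcd n (int r) dvd i - j \<or> gcd n (int r) dvd i + j"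
    moreover have "gcd n (int r) > 0" using that(1) by simp
    ultimately show "i = j"
      using that zdvd_imp_le[of "gcd n (int r)" "i - j"] zdvd_imp_le[of "gcd n (int r)" "j - i"]
        zdvd_imp_le[of "gcd n (int r)" "i + j"] dvd_minus_iff[of "gcd n (int r)" "i - j"]
      by (cases "i < j"; cases "i = j"; cases "i + j = 0") auto
  qed
  from mem(1) have "B = B' \<and> l = l'"
  proof (cases rule: osc_list_cases)
    case (companion n)
    from mem' show ?thesis
    proof (cases rule: osc_list_cases)
      case (companion n')
      have [simp]: "n' = n" and B': "B' = B" using companion \<open>T = n + 2\<close> \<open>B = _\<close> by simp_all
      have l: "snd l = 0 \<and> 0 \<le> fst l \<and> 2 * fst l \<le> gcd n (int r)"
        "snd l' = 0 \<and> 0 \<le> fst l' \<and> 2 * fst l' \<le> gcd n (int r)"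
        using mem(1) mem' osc_list_companion[OF \<open>1 \<le> n\<close> \<open>n \<le> 5\<close>] \<open>T = n + 2\<close> \<open>B = _\<close> B' by simp_all
      then have "l = (fst l, 0)" "l' = (fst l', 0)" by (metis prod.collapse)+
      then have "osc_int r (n + 1) n 1 1 (fst l, 0) \<cong> osc_int r (n + 1) n 1 1 (fst l', 0)"
        using Osc_iso_imp_osc_int_iso[of "n + 1" 1 n 1 "n + 1" 1 n 1 r l r l'] iso \<open>B = _\<close> B' by simp
      from osc_int_companion_distinct[OF r(1) \<open>1 \<le> n\<close> \<open>n \<le> 5\<close> gcd_dvd1 gcd_dvd2 this] l sq[OF \<open>1 \<le> n\<close>]
      have "fst l = fst l'" by blast
      then show ?thesis using l B' by (simp add: prod_eq_iff)
    next
      case six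
      then have "B = mat2 5 4 1 1" using \<open>T = n + 2\<close> \<open>B = _\<close> by simp
      then show ?thesis
        using Osc_iso_imp_osc_int_iso[of 5 1 4 1 5 1 2 2 r l r l'] iso six osc_int_5411_5221[OF r(1) r(1)] by simp
    next
      case seven
      then have "B = mat2 6 5 1 1" using \<open>T = n + 2\<close> \<open>B = _\<close> by simp
      then show ?thesis
        using Osc_iso_imp_osc_int_iso[of 6 1 5 1 5 2 3 3 r l r l'] iso seven osc_int_6511_5332[OF r(1) r(1)] by simp
    qed
  next
    case six
    from mem' show ?thesis
    proof (cases rule: osc_list_cases)
      case (companion n)
      then have "B' = mat2 5 4 1 1" using six by simp
      then show ?thesis
        using Osc_iso_imp_osc_int_iso[of 5 1 4 1 5 1 2 2 r l' r l] iso' six osc_int_5411_5221[OF r(1) r(1)] by simp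
    next
      case 2: six
      have iso2: "osc_int r 5 2 2 1 (fst l, snd l) \<cong> osc_int r 5 2 2 1 (fst l', snd l')"
        using Osc_iso_imp_osc_int_iso[of 5 1 2 2 5 1 2 2 r l r l'] iso six 2 by simp
      have l: "l = (0, 0) \<or> even r \<and> (l = (1, 0) \<or> l = (1, 1))" "l' = (0, 0) \<or> even r \<and> (l' = (1, 0) \<or> l' = (1, 1))"
        using mem(1) mem' six 2 by (simp_all add: osc_list_5221)
      have "l = l'"
      proof (cases "even r")
        case True
        then show ?thesis using osc_int_5221_distinct[OF r(1) True iso2] l by auto
      qed (use l in auto)
      then show ?thesis using six 2 by simp
    qed (use six in simp)
  next
    case seven
    from mem' show ?thesis
    proof (cases rule: osc_list_cases)
      case (companion n)
      then have "B' = mat2 6 5 1 1" using seven by simp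
      then show ?thesis
        using Osc_iso_imp_osc_int_iso[of 6 1 5 1 5 2 3 3 r l' r l] iso' seven osc_int_6511_5332[OF r(1) r(1)] by simp
    next
      case 2: seven
      have iso2: "osc_int r 5 3 3 2 l \<cong> osc_int r 5 3 3 2 l'" "osc_int r 5 3 3 2 l' \<cong> osc_int r 5 3 3 2 l"
        using Osc_iso_imp_osc_int_iso[of 5 2 3 3 5 2 3 3 r l r l'] Osc_iso_imp_osc_int_iso[of 5 2 3 3 5 2 3 3 r l' r l]
          iso iso' seven 2 by simp_all
      have "l = (0, 0) \<or> 5 dvd r \<and> l = (0, 1)" "l' = (0, 0) \<or> 5 dvd r \<and> l' = (0, 1)"
        using mem(1) mem' seven 2 by (simp_all add: osc_list_5332)
      then show ?thesis using iso2 osc_int_5332_distinct[OF r(1)] seven 2 by blast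
    qed (use seven in simp)
  qed
  then show ?thesis by simp
qed

theorem mainTheorem5:
  shows
    "(\<forall>T r B l. 1 \<le> r \<longrightarrow> (B, l) \<in> osc_list T r \<longrightarrow>
        T \<le> 7 \<and> trace B = T \<and> discrete_split_oscillator_group (Osc r B l) T) \<and>
     (\<forall>T r B l T' r' B' l'.
        1 \<le> r \<longrightarrow> (B, l) \<in> osc_list T r \<longrightarrow>
        1 \<le> r' \<longrightarrow> (B', l') \<in> osc_list T' r' \<longrightarrow>
        (r, B, l) \<noteq> (r', B', l') \<longrightarrow> \<not> Osc r B l \<cong> Osc r' B' l') \<and>
     (\<forall>(G :: ('g, 'm) monoid_scheme) T.
        discrete_split_oscillator_group G T \<longrightarrow> T \<le> 7 \<longrightarrow>
        (\<exists>r B l. 1 \<le> r \<and> (B, l) \<in> osc_list T r \<and> G \<cong> Osc r B l))"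
proof (intro conjI allI impI)
  fix T r B l assume r: "1 \<le> r" and mem: "(B, l) \<in> osc_list T r"
  note t = osc_list_trace[OF mem]
  show "T \<le> 7" "trace B = T" by (fact t)+
  show "discrete_split_oscillator_group (Osc r B l) T"
    using Osc_discrete_split[OF r t(2), of l] t(1,3) by simp
next
  fix T r B l T' r' B' l'
  assume "1 \<le> r" "(B, l) \<in> osc_list T r" "1 \<le> r'" "(B', l') \<in> osc_list T' r'" "(r, B, l) \<noteq> (r', B', l')"
  then show "\<not> Osc r B l \<cong> Osc r' B' l'" using listed_iso_imp_eq by blast
next
  fix G :: "('g, 'm) monoid_scheme" and T
  assume "discrete_split_oscillator_group G T" "T \<le> 7"
  then show "\<exists>r B l. 1 \<le> r \<and> (B, l) \<in> osc_list T r \<and> G \<cong> Osc r B l"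
    by (rule discrete_split_iso_listed)
qed

end
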